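(* Let $h>0$, $\Omega=\{(x_1,x_2)\in\mathbb{R}^2: |x_2|<x_1<h\}$ (an isosceles right triangle) and $\Gamma=\{x_1=h,\ x_2\in[-h,h]\}$ (the hypotenuse). Then the sharp constant $C_1(\Omega,\Gamma)$ is equal to $\widetilde z_0^{-1}h$, where $\widetilde z_0\approx2.02876$ is the unique root of the equation $$z\cot(z)+1=0$$ in the interval $(0,\pi)$.
   Context: For a bounded connected Lipschitz domain $\Omega\subset\mathbb{R}^d$ and a measurable part $\Gamma\subset\partial\Omega$ of positive $(d-1)$-dimensional measure, let $\widetilde H^1(\Omega,\Gamma)=\{w\in H^1(\Omega): \text{the mean value of (the trace of) } w \text{ on } \Gamma \text{ is zero}\}$. The norm in $L^2(\omega)$ is denoted $\|\cdot\|_{2,\omega}$. The sharp constant $C_1(\Omega,\Gamma)$ is the smallest constant $C$ such that $\|w\|_{2,\Omega}\le C\|\nabla w\|_{2,\Omega}$ for all $w\in\widetilde H^1(\Omega,\Gamma)$. *)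

theory Defs
  imports "HOL-Analysis.Analysis"
begin

definition in_L2 :: "'b measure \<Rightarrow> ('b \<Rightarrow> 'c::euclidean_space) \<Rightarrow> bool" where
  "in_L2 M f \<longleftrightarrow> f \<in> borel_measurable M \<and> integrable M (\<lambda>x. (norm (f x))\<^sup>2)"

definition L2_norm :: "'b measure \<Rightarrow> ('b \<Rightarrow> 'c::euclidean_space) \<Rightarrow> real" where
  "L2_norm M f = sqrt (\<integral>x. (norm (f x))\<^sup>2 \<partial>M)"

definition L2_tendsto ::
  "'b measure \<Rightarrow> (nat \<Rightarrow> 'b \<Rightarrow> 'c::euclidean_space) \<Rightarrow> ('b \<Rightarrow> 'c) \<Rightarrow> bool" where
  "L2_tendsto M f g \<longleftrightarrow> (\<forall>n. in_L2 M (f n)) \<and> in_L2 M g \<and>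
     (\<lambda>n. L2_norm M (\<lambda>x. f n x - g x)) \<longlonglongrightarrow> 0"

subsection \<open>Hausdorff measure\<close>

text \<open>Normalised so that the \<open>s\<close>-dimensional measure agrees with Lebesgue measure on
  \<open>s\<close>-dimensional planes. Boundedness is required because \<^const>\<open>diameter\<close> is
  meaningless for unbounded sets; empty sets get weight 0 also for \<open>s = 0\<close>, so that the
  countable covers include the finite ones.\<close>

definition hausdorff_weight :: "nat \<Rightarrow> 'a::euclidean_space set \<Rightarrow> ennreal" where
  "hausdorff_weight s A =
     (if A = {} then 0 else ennreal (unit_ball_vol (real s) * (diameter A / 2) ^ s))"

definition hausdorff_pre :: "nat \<Rightarrow> real \<Rightarrow> 'a::euclidean_space set \<Rightarrow> ennreal" where
  "hausdorff_pre s \<delta> A =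
     (INF C \<in> {C :: nat \<Rightarrow> 'a set. A \<subseteq> (\<Union>i. C i) \<and> (\<forall>i. bounded (C i) \<and> diameter (C i) \<le> \<delta>)}.
        (\<Sum>i. hausdorff_weight s (C i)))"

definition hausdorff_outer :: "nat \<Rightarrow> 'a::euclidean_space set \<Rightarrow> ennreal" where
  "hausdorff_outer s A = (SUP \<delta> \<in> {0<..}. hausdorff_pre s \<delta> A)"

text \<open>A metric outer measure is countably additive on the Borel sets, so
  \<^const>\<open>measure_of\<close> does not fall back to the zero measure here.\<close>

definition hausdorff_measure :: "nat \<Rightarrow> 'a::euclidean_space measure" where
  "hausdorff_measure s = measure_of UNIV (sets borel) (hausdorff_outer s)"

definition surface_measure_on :: "'a::euclidean_space set \<Rightarrow> 'a measure" where
  "surface_measure_on \<Gamma> = restrict_space (hausdorff_measure (DIM('a) - 1)) \<Gamma>"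

subsection \<open>Smooth functions and weak gradients\<close>

definition partial_deriv :: "'a::euclidean_space \<Rightarrow> ('a \<Rightarrow> real) \<Rightarrow> 'a \<Rightarrow> real" where
  "partial_deriv i f x = frechet_derivative f (at x) i"

definition gradient :: "('a::euclidean_space \<Rightarrow> real) \<Rightarrow> 'a \<Rightarrow> 'a" where
  "gradient f x = (\<Sum>i\<in>Basis. partial_deriv i f x *\<^sub>R i)"

fun Ck :: "nat \<Rightarrow> ('a::euclidean_space \<Rightarrow> real) \<Rightarrow> bool" where
  "Ck 0 f \<longleftrightarrow> continuous_on UNIV f"
| "Ck (Suc n) f \<longleftrightarrow> (\<forall>x. f differentiable (at x)) \<and> (\<forall>i\<in>Basis. Ck n (partial_deriv i f))"

definition smooth :: "('a::euclidean_space \<Rightarrow> real) \<Rightarrow> bool" where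
  "smooth f \<longleftrightarrow> (\<forall>n. Ck n f)"

definition test_function :: "'a::euclidean_space set \<Rightarrow> ('a \<Rightarrow> real) \<Rightarrow> bool" where
  "test_function \<Omega> \<phi> \<longleftrightarrow> smooth \<phi> \<and>
     compact (closure {x. \<phi> x \<noteq> 0}) \<and> closure {x. \<phi> x \<noteq> 0} \<subseteq> \<Omega>"

definition has_weak_gradient ::
  "'a::euclidean_space set \<Rightarrow> ('a \<Rightarrow> real) \<Rightarrow> ('a \<Rightarrow> 'a) \<Rightarrow> bool" where
  "has_weak_gradient \<Omega> w G \<longleftrightarrow> (\<forall>\<phi>. test_function \<Omega> \<phi> \<longrightarrow> (\<forall>i\<in>Basis.
     (\<integral>x. w x * partial_deriv i \<phi> x \<partial>lebesgue_on \<Omega>) =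
       - (\<integral>x. (G x \<bullet> i) * \<phi> x \<partial>lebesgue_on \<Omega>)))"

subsection \<open>Sobolev functions, traces and the sharp constant\<close>

text \<open>A function \<open>w\<close> in \<open>H\<^sup>1(\<Omega>)\<close> is carried together with its weak gradient \<open>G\<close>,
  which \<open>w\<close> determines up to a null set. Values outside \<open>\<Omega>\<close> play no role.\<close>

definition sobolev_H1 :: "'a::euclidean_space set \<Rightarrow> (('a \<Rightarrow> real) \<times> ('a \<Rightarrow> 'a)) set" where
  "sobolev_H1 \<Omega> = {(w, G). in_L2 (lebesgue_on \<Omega>) w \<and> in_L2 (lebesgue_on \<Omega>) G \<and>
     has_weak_gradient \<Omega> w G}"

text \<open>The trace operator is the continuous extension to \<open>H\<^sup>1(\<Omega>)\<close> of the restriction map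
  on functions smooth up to the boundary. On a bounded Lipschitz domain these are dense in
  \<open>H\<^sup>1(\<Omega>)\<close> and restriction is continuous into \<open>L\<^sup>2(\<partial>\<Omega>)\<close>, so every element of
  \<open>H\<^sup>1(\<Omega>)\<close> has exactly one trace (up to null sets) in the following sense.\<close>

definition has_trace ::
  "'a::euclidean_space set \<Rightarrow> 'a set \<Rightarrow> ('a \<Rightarrow> real) \<times> ('a \<Rightarrow> 'a) \<Rightarrow> ('a \<Rightarrow> real) \<Rightarrow> bool" where
  "has_trace \<Omega> \<Gamma> = (\<lambda>(w, G) g. \<exists>\<phi> :: nat \<Rightarrow> 'a \<Rightarrow> real.
     (\<forall>n. smooth (\<phi> n)) \<and>
     L2_tendsto (lebesgue_on \<Omega>) \<phi> w \<and>
     L2_tendsto (lebesgue_on \<Omega>) (\<lambda>n. gradient (\<phi> n)) G \<and>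
     L2_tendsto (surface_measure_on \<Gamma>) \<phi> g)"

definition surface_mean :: "'a::euclidean_space set \<Rightarrow> ('a \<Rightarrow> real) \<Rightarrow> real" where
  "surface_mean \<Gamma> g =
     (\<integral>x. g x \<partial>surface_measure_on \<Gamma>) / measure (surface_measure_on \<Gamma>) \<Gamma>"

definition H1_tilde ::
  "'a::euclidean_space set \<Rightarrow> 'a set \<Rightarrow> (('a \<Rightarrow> real) \<times> ('a \<Rightarrow> 'a)) set" where
  "H1_tilde \<Omega> \<Gamma> =
     {W \<in> sobolev_H1 \<Omega>. \<exists>g. has_trace \<Omega> \<Gamma> W g \<and> surface_mean \<Gamma> g = 0}"

definition admissible_constant :: "'a::euclidean_space set \<Rightarrow> 'a set \<Rightarrow> real \<Rightarrow> bool" where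
  "admissible_constant \<Omega> \<Gamma> C \<longleftrightarrow> (\<forall>(w, G) \<in> H1_tilde \<Omega> \<Gamma>.
     L2_norm (lebesgue_on \<Omega>) w \<le> C * L2_norm (lebesgue_on \<Omega>) G)"

definition is_sharp_constant :: "'a::euclidean_space set \<Rightarrow> 'a set \<Rightarrow> real \<Rightarrow> bool" where
  "is_sharp_constant \<Omega> \<Gamma> C \<longleftrightarrow> admissible_constant \<Omega> \<Gamma> C \<and>
     (\<forall>C'. admissible_constant \<Omega> \<Gamma> C' \<longrightarrow> C \<le> C')"

subsection \<open>The triangle\<close>

definition right_triangle :: "real \<Rightarrow> (real \<times> real) set" where
  "right_triangle h = {(x1, x2). \<bar>x2\<bar> < x1 \<and> x1 < h}"

definition hypotenuse :: "real \<Rightarrow> (real \<times> real) set" where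
  "hypotenuse h = {(x1, x2). x1 = h \<and> x2 \<in> {-h..h}}"

end

theory Submission
  imports Defs
begin

text \<open>
  Why the theorem holds. Folding the square \<open>[-h,h]\<^sup>2\<close> along its two diagonals maps it four-to-one
  onto the triangle, so a function on the triangle becomes a function \<open>u\<close> on the square with
  \<open>u (y, x) = u (x, y) = u (- x, - y)\<close>; by this symmetry the Dirichlet energy is twice the
  energy of the \<open>x\<close>-derivative alone, and the condition on the hypotenuse says that the marginal
  \<open>A x = \<integral> u (x, y) dy\<close> vanishes at \<open>x = h\<close>.
  Subtracting from each horizontal slice its mean and \<open>A / (2 h)\<close> separates the estimate into two
  one-dimensional ones: the slices have mean zero, where Wirtinger's inequality has room to spare
  (this uses \<open>2 z\<^sup>2 < pi\<^sup>2\<close>), and \<open>A\<close> satisfies the critical inequality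
  \<open>z\<^sup>2 (\<integral> A\<^sup>2 - (\<integral> A)\<^sup>2 / (4 h)) \<le> h\<^sup>2 \<integral> A'\<^sup>2\<close> because \<open>A h = 0\<close> and \<open>A\<close> is even
  (\<open>poincare_square\<close>).

  The extremal of the critical problem changes sign, so it cannot be compared with a positive
  solution directly. Its primitive \<open>F\<close> can: with \<open>f = F'\<close> an integration by parts turns
  \<open>\<integral> f\<^sup>2\<close> plus a boundary term into \<open>- \<integral> F f'\<close>, and the inequality needed
  for \<open>F\<close> belongs to the Robin problem \<open>F 0 = 0\<close>, \<open>F' h = - F h / h\<close>. Its ground state \<open>sin (z x / h)\<close> is
  positive on \<open>(0, h]\<close> and satisfies the boundary condition exactly because \<open>z cot z = -1\<close>.
  Both one-dimensional estimates are the same statement, \<open>poincare_interval_robin\<close>, for two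
  boundary conditions.

  Since the trace is defined by approximation with smooth functions, the estimate for smooth
  functions passes to the limit once the mean over the hypotenuse is subtracted. This needs the
  surface measure in concrete form: one-dimensional Hausdorff measure is a metric outer measure,
  hence a Borel measure, and on a straight line it is Lebesgue measure
  (\<open>surface_measure_hypotenuse\<close>).

  Equality holds for \<open>cos (z x / h) + cos (z y / h)\<close> (\<open>cosine_mode_norms\<close>), so the constant is sharp.
\<close>

section \<open>One-dimensional inequalities\<close>

lemma tendsto_times_cot: "((\<lambda>t::real. t * cot t) \<longlongrightarrow> 1) (at 0)"
proof -
  have "((\<lambda>t::real. sin t / t) \<longlongrightarrow> 1) (at 0)"
    using DERIV_sin[of "0::real"] by (simp add: has_field_derivative_iff)
  then have "((\<lambda>t::real. cos t / (sin t / t)) \<longlongrightarrow> cos 0 / 1) (at 0)"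
    by (intro tendsto_intros) auto
  then show ?thesis by (simp add: cot_def mult.commute)
qed

text \<open>
  The Riccati function \<open>p x = k cot (k (x - a))\<close> of the ground state \<open>sin (k (x - a))\<close> satisfies
  \<open>p' + p\<^sup>2 = - k\<^sup>2\<close>. Therefore \<open>f\<^sup>2 - k\<^sup>2 F\<^sup>2 - (f - p F)\<^sup>2\<close> is the derivative of \<open>p F\<^sup>2\<close>, and
  discarding the last square leaves the boundary value of \<open>p F\<^sup>2\<close> at \<open>b\<close>.
\<close>

lemma cotangent_inequality:
  fixes F f :: "real \<Rightarrow> real"
  assumes ab: "a < b" and k: "0 < k" "k * (b - a) < pi"
    and deriv: "\<And>x. x \<in> {a..b} \<Longrightarrow> (F has_real_derivative f x) (at x within {a..b})"
    and contf: "continuous_on {a..b} f" and F0: "F a = 0"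
  shows "k\<^sup>2 * integral {a..b} (\<lambda>x. (F x)\<^sup>2) + k * cot (k * (b - a)) * (F b)\<^sup>2
           \<le> integral {a..b} (\<lambda>x. (f x)\<^sup>2)"
proof -
  define H where "H x = k * cot (k * (x - a)) * (F x)\<^sup>2" for x
  define H' where "H' x = (f x)\<^sup>2 - k\<^sup>2 * (F x)\<^sup>2 - (f x - k * cot (k * (x - a)) * F x)\<^sup>2" for x
  have contF: "continuous_on {a..b} F"
    by (rule DERIV_continuous_on[OF deriv])
  have range: "0 < k * (x - a)" "k * (x - a) < pi" if "x \<in> {a<..b}" for x
  proof -
    show "0 < k * (x - a)" using that k by auto
    have "k * (x - a) \<le> k * (b - a)" using that k by (intro mult_left_mono) auto
    also note k(2)
    finally show "k * (x - a) < pi" .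
  qed
  have sin0: "sin (k * (x - a)) > 0" if "x \<in> {a<..b}" for x
    using range[OF that] by (intro sin_gt_zero) auto
  have "continuous_on {a..b} H"
    unfolding continuous_on_eq_continuous_within
  proof
    fix x assume x: "x \<in> {a..b}"
    show "continuous (at x within {a..b}) H"
    proof (cases "x = a")
      \<comment> \<open>Only here does \<open>p\<close> blow up; \<open>F\<close> vanishes at \<open>a\<close>, so \<open>p F\<^sup>2\<close> still tends to
        \<open>0\<close>, which is also its value at \<open>a\<close> because \<open>cot 0 = 0\<close>.\<close>
      case True
      have 1: "((\<lambda>y. (F y - F a) / (y - a)) \<longlongrightarrow> f a) (at a within {a..b})"
        using deriv[of a] ab by (simp add: has_field_derivative_iff)
      have 2: "(F \<longlongrightarrow> F a) (at a within {a..b})"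
        using contF ab by (auto simp: continuous_on_def)
      have lim0: "filterlim (\<lambda>y. k * (y - a)) (at 0) (at a within {a..b})"
        unfolding filterlim_at
      proof
        show "\<forall>\<^sub>F y in at a within {a..b}. k * (y - a) \<in> UNIV \<and> k * (y - a) \<noteq> 0"
          using k by (auto simp: eventually_at_filter)
        show "((\<lambda>y. k * (y - a)) \<longlongrightarrow> 0) (at a within {a..b})"
          by (auto intro!: tendsto_eq_intros)
      qed
      have 3: "((\<lambda>y. k * (y - a) * cot (k * (y - a))) \<longlongrightarrow> 1) (at a within {a..b})"
        by (rule filterlim_compose[OF tendsto_times_cot lim0])
      have "((\<lambda>y. (F y - F a) / (y - a) * F y * (k * (y - a) * cot (k * (y - a))))
              \<longlongrightarrow> f a * F a * 1) (at a within {a..b})"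
        by (intro tendsto_intros 1 2 3)
      then have "(H \<longlongrightarrow> f a * F a * 1) (at a within {a..b})"
        by (rule Lim_transform_eventually)
           (auto simp: eventually_at_filter H_def F0 power2_eq_square)
      then show ?thesis using True F0 by (simp add: continuous_within H_def)
    next
      case False
      then have "x \<in> {a<..b}" using x by auto
      then have "isCont (\<lambda>y. cot (k * (y - a))) x"
        using sin0[of x] by (intro continuous_intros) auto
      then have "continuous (at x within {a..b}) (\<lambda>y. cot (k * (y - a)))"
        by (rule continuous_at_imp_continuous_at_within)
      moreover have "continuous (at x within {a..b}) F"
        using contF x by (simp add: continuous_on_eq_continuous_within)
      ultimately show ?thesis unfolding H_def by (intro continuous_mult continuous_power continuous_const)
    qed
  qed
  moreover have "(H has_vector_derivative H' x) (at x)" if x: "x \<in> {a<..<b}" for x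
  proof -
    have s: "sin (k * (x - a)) > 0" using x sin0 by auto
    have "(F has_real_derivative f x) (at x)"
      using deriv[of x] x at_within_interior[of x "{a..b}"] by (auto simp: interior_atLeastAtMost_real)
    then have "(H has_real_derivative
        (k * (- inverse ((sin (k * (x - a)))\<^sup>2) * k) * (F x)\<^sup>2 + k * cot (k * (x - a)) * (2 * F x * f x))) (at x)"
      unfolding H_def using s
      by (auto intro!: derivative_eq_intros DERIV_chain2[OF DERIV_cot])
    moreover have "inverse ((sin (k * (x - a)))\<^sup>2) = 1 + (cot (k * (x - a)))\<^sup>2"
      using s sin_cos_squared_add[of "k * (x - a)"] by (auto simp: cot_def field_simps)
    ultimately have "(H has_real_derivative H' x) (at x)"
      unfolding H'_def by (simp add: algebra_simps power2_eq_square)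
    then show ?thesis by (simp add: has_real_derivative_iff_has_vector_derivative)
  qed
  ultimately have "(H' has_integral (H b - H a)) {a..b}"
    using ab by (intro fundamental_theorem_of_calculus_interior) auto
  moreover have "((\<lambda>x. (f x)\<^sup>2 - k\<^sup>2 * (F x)\<^sup>2) has_integral
      (integral {a..b} (\<lambda>x. (f x)\<^sup>2) - k\<^sup>2 * integral {a..b} (\<lambda>x. (F x)\<^sup>2))) {a..b}"
    by (intro has_integral_diff has_integral_mult_right integrable_integral integrable_continuous_real
          continuous_intros contf contF)
  ultimately have "H b - H a \<le> integral {a..b} (\<lambda>x. (f x)\<^sup>2) - k\<^sup>2 * integral {a..b} (\<lambda>x. (F x)\<^sup>2)"
    by (rule has_integral_le) (auto simp: H'_def)
  then show ?thesis by (simp add: H_def F0)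
qed

text \<open>
  Let \<open>F\<close> be the primitive of \<open>f\<close> with \<open>F a = 0\<close>. Under either alternative of \<open>bc\<close>,
  integration by parts gives \<open>- \<integral> F g = \<integral> f\<^sup>2 - k cot (k (b - a)) m\<^sup>2\<close>, and the preceding lemma
  bounds the right-hand side below by \<open>k\<^sup>2 \<integral> F\<^sup>2\<close>. Expanding \<open>0 \<le> \<integral> (g + k\<^sup>2 F)\<^sup>2\<close> combines the
  two. The condition \<open>m = 0\<close> is the Wirtinger case.
\<close>

lemma poincare_interval_robin:
  fixes f g :: "real \<Rightarrow> real"
  assumes ab: "a < b" and k: "0 < k" "k * (b - a) < pi"
    and S: "finite S" and contf: "continuous_on {a..b} f"
    and deriv: "\<And>x. x \<in> {a<..<b} - S \<Longrightarrow> (f has_real_derivative g x) (at x)"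
    and g2: "(\<lambda>x. (g x)\<^sup>2) integrable_on {a..b}"
    and m: "m = integral {a..b} f"
    and bc: "m = 0 \<or> f b = k * cot (k * (b - a)) * m"
  shows "k\<^sup>2 * (integral {a..b} (\<lambda>x. (f x)\<^sup>2) - k * cot (k * (b - a)) * m\<^sup>2)
           \<le> integral {a..b} (\<lambda>x. (g x)\<^sup>2)"
proof -
  define F where "F x = integral {a..x} f" for x
  define I where "I q = integral {a..b} q" for q :: "real \<Rightarrow> real"
  have dF: "(F has_real_derivative f x) (at x within {a..b})" if "x \<in> {a..b}" for x
    unfolding F_def using integral_has_vector_derivative[OF contf that]
    by (simp add: has_real_derivative_iff_has_vector_derivative)
  have F0: "F a = 0" and Fb: "F b = m" by (simp_all add: F_def m)
  have contF: "continuous_on {a..b} F"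
    by (rule DERIV_continuous_on[OF dF])
  have W: "k\<^sup>2 * I (\<lambda>x. (F x)\<^sup>2) + k * cot (k * (b - a)) * m\<^sup>2 \<le> I (\<lambda>x. (f x)\<^sup>2)"
    unfolding I_def using cotangent_inequality[OF ab k dF contf F0] by (simp add: Fb)
  have "((\<lambda>x. f x * f x + F x * g x) has_integral (F b * f b - F a * f a)) {a..b}"
  proof (rule fundamental_theorem_of_calculus_interior_strong[OF S])
    fix x assume x: "x \<in> {a<..<b} - S"
    have "(F has_real_derivative f x) (at x)"
      using dF[of x] x at_within_interior[of x "{a..b}"] by (auto simp: interior_atLeastAtMost_real)
    from DERIV_mult[OF this deriv[OF x]]
    show "((\<lambda>x. F x * f x) has_vector_derivative f x * f x + F x * g x) (at x)"
      by (simp add: has_real_derivative_iff_has_vector_derivative algebra_simps)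
  qed (use ab in \<open>auto intro!: continuous_intros contF contf\<close>)
  moreover have "((\<lambda>x. f x * f x) has_integral I (\<lambda>x. (f x)\<^sup>2)) {a..b}"
    unfolding I_def power2_eq_square
    by (intro integrable_integral integrable_continuous_real continuous_intros contf)
  ultimately have Fg: "((\<lambda>x. F x * g x) has_integral (m * f b - I (\<lambda>x. (f x)\<^sup>2))) {a..b}"
    using has_integral_diff[of "\<lambda>x. f x * f x + F x * g x" _ "{a..b}" "\<lambda>x. f x * f x"]
    by (simp add: F0 Fb)
  have F2: "((\<lambda>x. (F x)\<^sup>2) has_integral I (\<lambda>x. (F x)\<^sup>2)) {a..b}"
    unfolding I_def by (intro integrable_integral integrable_continuous_real continuous_intros contF)
  have "((\<lambda>x. (g x)\<^sup>2) has_integral I (\<lambda>x. (g x)\<^sup>2)) {a..b}"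
    unfolding I_def using g2 by (rule integrable_integral)
  from has_integral_add[OF has_integral_add[OF this has_integral_mult_right[OF Fg, of "2 * k\<^sup>2"]]
       has_integral_mult_right[OF F2, of "k^4"]]
  have "((\<lambda>x. (g x + k\<^sup>2 * F x)\<^sup>2) has_integral
     (I (\<lambda>x. (g x)\<^sup>2) + 2 * k\<^sup>2 * (m * f b - I (\<lambda>x. (f x)\<^sup>2)) + k^4 * I (\<lambda>x. (F x)\<^sup>2))) {a..b}"
    by (simp add: power2_eq_square power4_eq_xxxx algebra_simps)
  then have "0 \<le> I (\<lambda>x. (g x)\<^sup>2) + 2 * k\<^sup>2 * (m * f b - I (\<lambda>x. (f x)\<^sup>2)) + k^4 * I (\<lambda>x. (F x)\<^sup>2)"
    by (rule has_integral_nonneg) auto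
  moreover have "m * f b = k * cot (k * (b - a)) * m\<^sup>2"
    using bc by (auto simp: power2_eq_square)
  moreover have "k^4 * I (\<lambda>x. (F x)\<^sup>2) \<le> k\<^sup>2 * (I (\<lambda>x. (f x)\<^sup>2) - k * cot (k * (b - a)) * m\<^sup>2)"
  proof -
    have "k\<^sup>2 * (k\<^sup>2 * I (\<lambda>x. (F x)\<^sup>2)) \<le> k\<^sup>2 * (I (\<lambda>x. (f x)\<^sup>2) - k * cot (k * (b - a)) * m\<^sup>2)"
      using W by (intro mult_left_mono) auto
    then show ?thesis by (simp add: power2_eq_square power4_eq_xxxx mult.assoc)
  qed
  ultimately have "k\<^sup>2 * (I (\<lambda>x. (f x)\<^sup>2) - k * cot (k * (b - a)) * m\<^sup>2) \<le> I (\<lambda>x. (g x)\<^sup>2)"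
    by (simp add: algebra_simps)
  then show ?thesis by (simp add: I_def)
qed

text \<open>
  On \<open>[0,h]\<close> the function \<open>A - c\<close> with \<open>c = a / (4 h)\<close> has integral \<open>a / 4\<close> and the boundary value
  \<open>- a / (4 h)\<close>, so it satisfies the Robin condition \<open>f h = k cot (k h) m\<close> for \<open>k = z / h\<close>. The other half
  of the interval is the reflection of this one.
\<close>

lemma poincare_even_zero_boundary:
  fixes A g :: "real \<Rightarrow> real"
  assumes h: "0 < h" and z: "0 < z" "z < pi" "z * cot z + 1 = 0"
    and contA: "continuous_on {-h..h} A"
    and deriv: "\<And>x. x \<in> {-h<..<h} \<Longrightarrow> (A has_real_derivative g x) (at x)"
    and g2: "(\<lambda>x. (g x)\<^sup>2) integrable_on {-h..h}"
    and even: "\<And>x. A (- x) = A x" and bd: "A h = 0"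
    and a: "a = integral {-h..h} A"
  shows "z\<^sup>2 * (integral {-h..h} (\<lambda>x. (A x)\<^sup>2) - a\<^sup>2 / (4 * h)) \<le> h\<^sup>2 * integral {-h..h} (\<lambda>x. (g x)\<^sup>2)"
proof -
  have split: "integral {-h..h} q = integral {-h..0} q + integral {0..h} q"
    if "q integrable_on {-h..h}" for q :: "real \<Rightarrow> real"
    using h that by (intro Henstock_Kurzweil_Integration.integral_combine[symmetric]) auto
  have refl: "integral {-h..0} q = integral {0..h} (\<lambda>x. q (- x))" for q :: "real \<Rightarrow> real"
    using Henstock_Kurzweil_Integration.integral_reflect_real[of h 0 "\<lambda>x. q (- x)"] by simp
  have contA0: "continuous_on {0..h} A" by (rule continuous_on_subset[OF contA]) (use h in auto)
  have intA: "(\<lambda>x. (A x)\<^sup>2) integrable_on {-h..h}" "A integrable_on {-h..h}"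
    by (intro integrable_continuous_real continuous_intros contA)+
  have halfA: "a = 2 * integral {0..h} A"
    using split[OF intA(2)] refl[of A] by (simp add: a even)
  define I where "I = integral {0..h} (\<lambda>x. (A x)\<^sup>2)"
  have halfI: "integral {-h..h} (\<lambda>x. (A x)\<^sup>2) = 2 * I"
    using split[OF intA(1)] refl[of "\<lambda>x. (A x)\<^sup>2"] by (simp add: I_def even)
  define c where "c = a / (4 * h)"
  define k where "k = z / h"
  have k: "0 < k" "k * (h - 0) < pi" using h z by (auto simp: k_def)
  have kcot: "k * cot (k * (h - 0)) = - 1 / h" using h z by (simp add: k_def field_simps)
  have iA: "(A has_integral a / 2) {0..h}"
    using integrable_continuous_real[OF contA0] halfA by (simp add: has_integral_iff)
  have iA2: "((\<lambda>x. (A x)\<^sup>2) has_integral I) {0..h}"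
    unfolding I_def by (intro integrable_integral integrable_continuous_real continuous_intros contA0)
  have m: "a / 4 = integral {0..h} (\<lambda>x. A x - c)"
  proof -
    have "((\<lambda>x. A x - c) has_integral a / 2 - c * (h - 0)) {0..h}"
      using has_integral_const_real[of c 0 h] h by (intro has_integral_diff iA) (simp add: mult.commute)
    then have "integral {0..h} (\<lambda>x. A x - c) = a / 2 - c * (h - 0)" by (rule integral_unique)
    also have "\<dots> = a / 4" using h by (simp add: c_def field_simps)
    finally show ?thesis by simp
  qed
  have sq: "integral {0..h} (\<lambda>x. (A x - c)\<^sup>2) = I - c * a + c\<^sup>2 * h"
  proof -
    have "((\<lambda>x. (A x)\<^sup>2 - 2 * c * A x + c\<^sup>2) has_integral I - 2 * c * (a / 2) + c\<^sup>2 * (h - 0)) {0..h}"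
      using has_integral_const_real[of "c\<^sup>2" 0 h] h
      by (intro has_integral_diff has_integral_add iA2 has_integral_mult_right[OF iA, of "2 * c"]) (simp add: mult.commute)
    then show ?thesis by (simp add: integral_unique power2_diff algebra_simps)
  qed
  have half: "k\<^sup>2 * (I - a\<^sup>2 / (8 * h)) \<le> integral {0..h} (\<lambda>x. (q x)\<^sup>2)"
    if q: "\<And>x. x \<in> {0<..<h} \<Longrightarrow> (A has_real_derivative q x) (at x)"
      and q2: "(\<lambda>x. (q x)\<^sup>2) integrable_on {0..h}" for q
  proof -
    have "k\<^sup>2 * (integral {0..h} (\<lambda>x. (A x - c)\<^sup>2) - k * cot (k * (h - 0)) * (a / 4)\<^sup>2)
        \<le> integral {0..h} (\<lambda>x. (q x)\<^sup>2)"
    proof (rule poincare_interval_robin[where S = "{}"])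
      show "((\<lambda>x. A x - c) has_real_derivative q x) (at x)" if "x \<in> {0<..<h} - {}" for x
        using DERIV_diff[OF q DERIV_const[of c]] that by simp
      show "a / 4 = 0 \<or> A h - c = k * cot (k * (h - 0)) * (a / 4)"
        using kcot by (simp add: bd c_def)
    qed (use h k q2 m contA0 in \<open>auto intro!: continuous_intros\<close>)
    moreover have "integral {0..h} (\<lambda>x. (A x - c)\<^sup>2) - k * cot (k * (h - 0)) * (a / 4)\<^sup>2 = I - a\<^sup>2 / (8 * h)"
      unfolding sq kcot using h by (simp add: c_def field_simps power2_eq_square)
    ultimately show ?thesis by simp
  qed
  have sub: "(\<lambda>x. (g x)\<^sup>2) integrable_on {0..h}" "(\<lambda>x. (g x)\<^sup>2) integrable_on {-h..0}"
    by (rule integrable_subinterval_real[OF g2], use h in auto)+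
  have "k\<^sup>2 * (I - a\<^sup>2 / (8 * h)) \<le> integral {0..h} (\<lambda>x. (g x)\<^sup>2)"
    using sub(1) by (intro half deriv) auto
  moreover have "k\<^sup>2 * (I - a\<^sup>2 / (8 * h)) \<le> integral {0..h} (\<lambda>x. (- g (- x))\<^sup>2)"
  proof (rule half)
    fix x :: real assume x: "x \<in> {0<..<h}"
    then have "(A has_real_derivative g (- x)) (at (- x))" by (intro deriv) auto
    then have "((\<lambda>x. A (- x)) has_real_derivative - g (- x)) (at x)"
      by (auto simp: DERIV_mirror)
    then show "(A has_real_derivative - g (- x)) (at x)" by (simp add: even)
  next
    show "(\<lambda>x. (- g (- x))\<^sup>2) integrable_on {0..h}"
      using sub(2) Henstock_Kurzweil_Integration.integrable_reflect_real[of "\<lambda>x. (g (- x))\<^sup>2" h 0] by simp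
  qed
  moreover have "integral {-h..h} (\<lambda>x. (g x)\<^sup>2)
      = integral {0..h} (\<lambda>x. (- g (- x))\<^sup>2) + integral {0..h} (\<lambda>x. (g x)\<^sup>2)"
    unfolding split[OF g2] refl by simp
  ultimately have "2 * (k\<^sup>2 * (I - a\<^sup>2 / (8 * h))) \<le> integral {-h..h} (\<lambda>x. (g x)\<^sup>2)"
    by (simp only: mult_2 add_mono add.commute)
  then have "h\<^sup>2 * (2 * (k\<^sup>2 * (I - a\<^sup>2 / (8 * h)))) \<le> h\<^sup>2 * integral {-h..h} (\<lambda>x. (g x)\<^sup>2)"
    by (intro mult_left_mono) auto
  then show ?thesis unfolding halfI using h by (simp add: k_def power_divide algebra_simps)
qed

lemma lipschitz_of_bounded_derivative:
  fixes f g :: "real \<Rightarrow> real"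
  assumes S: "finite S" and contf: "continuous_on {a..b} f"
    and deriv: "\<And>x. x \<in> {a<..<b} - S \<Longrightarrow> (f has_real_derivative g x) (at x)"
    and g: "\<And>x. x \<in> {a..b} \<Longrightarrow> \<bar>g x\<bar> \<le> L"
    and xy: "x \<in> {a..b}" "y \<in> {a..b}"
  shows "\<bar>f x - f y\<bar> \<le> L * \<bar>x - y\<bar>"
proof -
  have *: "\<bar>f v - f u\<bar> \<le> L * \<bar>v - u\<bar>" if uv: "a \<le> u" "u \<le> v" "v \<le> b" for u v
  proof -
    have "(g has_integral (f v - f u)) {u..v}"
      using uv by (intro fundamental_theorem_of_calculus_interior_strong[OF S] continuous_on_subset[OF contf])
        (auto simp flip: has_real_derivative_iff_has_vector_derivative intro!: deriv)
    moreover have "0 \<le> L" using g[of u] uv by (auto intro: order_trans[OF abs_ge_zero])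
    ultimately have "norm (f v - f u) \<le> L * measure lborel (cbox u v)"
      using g uv by (intro has_integral_bound[of L g]) auto
    then show ?thesis using uv by simp
  qed
  show ?thesis
    using *[of x y] *[of y x] xy by (cases "x \<le> y") (auto simp: abs_minus_commute)
qed

section \<open>Bounded Borel functions on the square\<close>

text \<open>
  On a set of finite measure these functions are integrable, and they form an algebra;
  this settles all integrability questions below. Measurability is required on the whole space,
  boundedness only on the set, so that continuous functions qualify for compact sets.
\<close>

definition bounded_borel :: "'a::topological_space set \<Rightarrow> ('a \<Rightarrow> real) \<Rightarrow> bool" where
  "bounded_borel S f \<longleftrightarrow> f \<in> borel_measurable borel \<and> (\<exists>B. \<forall>x\<in>S. \<bar>f x\<bar> \<le> B)"

lemma bounded_borelI: "f \<in> borel_measurable borel \<Longrightarrow> (\<And>x. x \<in> S \<Longrightarrow> \<bar>f x\<bar> \<le> B) \<Longrightarrow> bounded_borel S f"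
  by (auto simp: bounded_borel_def)

lemma bounded_borel_const: "bounded_borel S (\<lambda>x. c)"
  by (rule bounded_borelI[of _ _ "\<bar>c\<bar>"]) auto

lemma bounded_borel_add:
  assumes "bounded_borel S f" "bounded_borel S g" shows "bounded_borel S (\<lambda>x. f x + g x)"
proof -
  obtain B C where B: "\<And>x. x \<in> S \<Longrightarrow> \<bar>f x\<bar> \<le> B" and C: "\<And>x. x \<in> S \<Longrightarrow> \<bar>g x\<bar> \<le> C"
    using assms unfolding bounded_borel_def by blast
  show ?thesis
  proof (rule bounded_borelI)
    show "(\<lambda>x. f x + g x) \<in> borel_measurable borel"
      using assms by (auto simp: bounded_borel_def)
    show "\<bar>f x + g x\<bar> \<le> B + C" if "x \<in> S" for x using B[OF that] C[OF that] by linarith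
  qed
qed

lemma bounded_borel_mult:
  assumes "bounded_borel S f" "bounded_borel S g" shows "bounded_borel S (\<lambda>x. f x * g x)"
proof -
  obtain B C where B: "\<And>x. x \<in> S \<Longrightarrow> \<bar>f x\<bar> \<le> B" and C: "\<And>x. x \<in> S \<Longrightarrow> \<bar>g x\<bar> \<le> C"
    using assms unfolding bounded_borel_def by blast
  show ?thesis
  proof (rule bounded_borelI)
    show "(\<lambda>x. f x * g x) \<in> borel_measurable borel"
      using assms by (auto simp: bounded_borel_def)
    show "\<bar>f x * g x\<bar> \<le> B * C" if "x \<in> S" for x
      unfolding abs_mult using B[OF that] C[OF that] by (intro mult_mono) auto
  qed
qed

lemma bounded_borel_diff:
  assumes "bounded_borel S f" "bounded_borel S g" shows "bounded_borel S (\<lambda>x. f x - g x)"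
  using bounded_borel_add[OF assms(1) bounded_borel_mult[OF bounded_borel_const[of S "-1"] assms(2)]] by simp

lemma bounded_borel_power2: "bounded_borel S f \<Longrightarrow> bounded_borel S (\<lambda>x. (f x)\<^sup>2)"
  unfolding power2_eq_square by (intro bounded_borel_mult)

lemma bounded_borel_divide: "bounded_borel S f \<Longrightarrow> bounded_borel S (\<lambda>x. f x / c)"
  using bounded_borel_mult[OF _ bounded_borel_const[of S "inverse c"]] by (simp add: divide_inverse)

lemmas bounded_borel_intros = bounded_borel_const bounded_borel_add bounded_borel_mult bounded_borel_diff
  bounded_borel_power2 bounded_borel_divide

lemma bounded_borel_continuous:
  fixes f :: "'a::topological_space \<Rightarrow> real"
  assumes "continuous_on UNIV f" "compact S" shows "bounded_borel S f"
proof -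
  have "compact (f ` S)" using assms by (intro compact_continuous_image) (auto intro: continuous_on_subset)
  then obtain B where "\<And>x. x \<in> S \<Longrightarrow> \<bar>f x\<bar> \<le> B"
    by (meson compact_imp_bounded bounded_real image_eqI)
  then show ?thesis using assms(1) by (intro bounded_borelI borel_measurable_continuous_onI)
qed

abbreviation seg :: "real \<Rightarrow> real measure" where "seg h \<equiv> restrict_space lborel {-h..h}"
abbreviation square :: "real \<Rightarrow> (real \<times> real) set" where "square h \<equiv> {-h..h} \<times> {-h..h}"
abbreviation seg2 :: "real \<Rightarrow> (real \<times> real) measure" where "seg2 h \<equiv> seg h \<Otimes>\<^sub>M seg h"

lemma finite_measure_seg: "finite_measure (seg h)"
  by (rule finite_measureI) (simp add: emeasure_restrict_space emeasure_lborel_Icc_eq)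

lemma measure_seg: "0 \<le> h \<Longrightarrow> measure (seg h) {-h..h} = 2 * h"
  by (simp add: measure_restrict_space)

lemma space_seg2: "space (seg2 h) = square h"
  by (simp add: space_pair_measure)

lemma ident_seg: "(\<lambda>x. x) \<in> seg h \<rightarrow>\<^sub>M borel"
  by (rule measurable_restrict_space1) simp

lemma bounded_borel_seg: "bounded_borel S f \<Longrightarrow> f \<in> borel_measurable (seg h)"
  by (rule measurable_compose[OF ident_seg]) (simp add: bounded_borel_def)

lemma borel_measurable_seg2:
  assumes "f \<in> borel_measurable (borel :: (real \<times> real) measure)"
  shows "f \<in> borel_measurable (seg2 h)" "f \<in> borel_measurable (borel \<Otimes>\<^sub>M seg h)"
proof -
  have f: "f \<in> borel_measurable (borel \<Otimes>\<^sub>M borel)"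
    using assms unfolding borel_prod .
  have "(\<lambda>q. (fst q, snd q)) \<in> seg2 h \<rightarrow>\<^sub>M borel \<Otimes>\<^sub>M borel"
    using measurable_compose[OF measurable_fst ident_seg] measurable_compose[OF measurable_snd ident_seg]
    by (rule measurable_Pair)
  from measurable_compose[OF this f] show "f \<in> borel_measurable (seg2 h)" by simp
  have "(\<lambda>q. (fst q, snd q)) \<in> borel \<Otimes>\<^sub>M seg h \<rightarrow>\<^sub>M borel \<Otimes>\<^sub>M borel"
    using measurable_fst measurable_compose[OF measurable_snd ident_seg]
    by (rule measurable_Pair)
  from measurable_compose[OF this f] show "f \<in> borel_measurable (borel \<Otimes>\<^sub>M seg h)" by simp
qed

lemma integrable_seg:
  assumes "bounded_borel {-h..h} f" shows "integrable (seg h) f"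
proof -
  interpret finite_measure "seg h" by (rule finite_measure_seg)
  obtain B where "\<And>x. x \<in> {-h..h} \<Longrightarrow> \<bar>f x\<bar> \<le> B" using assms unfolding bounded_borel_def by blast
  then have "AE x in seg h. norm (f x) \<le> B" by (intro AE_I2) simp
  then show ?thesis by (rule integrable_const_bound) (rule bounded_borel_seg[OF assms])
qed

lemma integrable_seg2:
  assumes "bounded_borel (square h) f" shows "integrable (seg2 h) f"
proof -
  interpret finite_measure "seg2 h" by (intro finite_measure_pair_measure finite_measure_seg)
  obtain B where "\<And>x. x \<in> square h \<Longrightarrow> \<bar>f x\<bar> \<le> B" using assms unfolding bounded_borel_def by blast
  then have "AE x in seg2 h. norm (f x) \<le> B" by (intro AE_I2) (simp add: space_seg2)
  moreover have "f \<in> borel_measurable (seg2 h)"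
    using assms by (intro borel_measurable_seg2) (simp add: bounded_borel_def)
  ultimately show ?thesis by (rule integrable_const_bound)
qed

lemma has_integral_seg:
  assumes "bounded_borel {-h..h} f" shows "(f has_integral (\<integral>x. f x \<partial>seg h)) {-h..h}"
proof -
  have "set_integrable lborel {-h..h} f"
    using integrable_seg[OF assms] unfolding set_integrable_def
    by (subst (asm) integrable_restrict_space) auto
  from set_borel_integral_eq_integral[OF this] show ?thesis
    by (simp add: has_integral_iff integral_restrict_space set_lebesgue_integral_def)
qed

lemma pair_sigma_finite_seg: "pair_sigma_finite (seg h) (seg h)"
  using finite_measure.axioms(1)[OF finite_measure_seg] by (intro pair_sigma_finite.intro)

lemma integral_seg2:
  assumes "bounded_borel (square h) f"
  shows "(\<integral>y. \<integral>x. f (x, y) \<partial>seg h \<partial>seg h) = (\<integral>q. f q \<partial>seg2 h)"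
    and "(\<integral>x. \<integral>y. f (x, y) \<partial>seg h \<partial>seg h) = (\<integral>q. f q \<partial>seg2 h)"
proof -
  interpret pair_sigma_finite "seg h" "seg h" by (rule pair_sigma_finite_seg)
  show "(\<integral>y. \<integral>x. f (x, y) \<partial>seg h \<partial>seg h) = (\<integral>q. f q \<partial>seg2 h)"
    using integral_snd[of "\<lambda>x y. f (x, y)"] integrable_seg2[OF assms] by simp
  show "(\<integral>x. \<integral>y. f (x, y) \<partial>seg h \<partial>seg h) = (\<integral>q. f q \<partial>seg2 h)"
    by (rule integral_fst'[OF integrable_seg2[OF assms]])
qed

lemma borel_swap: "(\<lambda>q. (snd q, fst q)) \<in> borel \<rightarrow>\<^sub>M (borel :: (real \<times> real) measure)"
  unfolding borel_prod[symmetric] by measurable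

lemma bounded_borel_swap:
  assumes "bounded_borel (square h) f" shows "bounded_borel (square h) (\<lambda>q. f (snd q, fst q))"
proof -
  have "(\<lambda>q. f (snd q, fst q)) \<in> borel_measurable borel"
    using assms unfolding bounded_borel_def by (intro measurable_compose[OF borel_swap]) auto
  then show ?thesis using assms unfolding bounded_borel_def by auto
qed

lemma bounded_borel_fst:
  "bounded_borel {-h..h} f \<Longrightarrow> bounded_borel (square h) (\<lambda>q. f (fst q))"
  unfolding bounded_borel_def borel_prod[symmetric] by (auto intro: measurable_compose[OF measurable_fst])

lemma bounded_borel_slice:
  assumes "bounded_borel (square h) f" 
  shows "y \<in> {-h..h} \<Longrightarrow> bounded_borel {-h..h} (\<lambda>x. f (x, y))"
    and "x \<in> {-h..h} \<Longrightarrow> bounded_borel {-h..h} (\<lambda>y. f (x, y))"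
proof -
  have f: "f \<in> borel_measurable (borel \<Otimes>\<^sub>M borel)"
    using assms unfolding bounded_borel_def borel_prod by blast
  obtain B where B: "\<And>q. q \<in> square h \<Longrightarrow> \<bar>f q\<bar> \<le> B"
    using assms unfolding bounded_borel_def by blast
  show "bounded_borel {-h..h} (\<lambda>x. f (x, y))" if "y \<in> {-h..h}"
    by (rule bounded_borelI[where B = B], rule measurable_compose[OF _ f]) (use B that in auto)
  show "bounded_borel {-h..h} (\<lambda>y. f (x, y))" if "x \<in> {-h..h}"
    by (rule bounded_borelI[where B = B], rule measurable_compose[OF _ f]) (use B that in auto)
qed

lemma bounded_borel_marginal:
  assumes f: "bounded_borel (square h) f"
  shows "bounded_borel {-h..h} (\<lambda>x. \<integral>y. f (x, y) \<partial>seg h)"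
proof -
  interpret finite_measure "seg h" by (rule finite_measure_seg)
  obtain B where B: "\<And>x. x \<in> square h \<Longrightarrow> \<bar>f x\<bar> \<le> B" using f unfolding bounded_borel_def by blast
  show ?thesis
  proof (rule bounded_borelI)
    have "case_prod (\<lambda>x y. f (x, y)) \<in> borel_measurable (borel \<Otimes>\<^sub>M seg h)"
      unfolding case_prod_eta by (rule borel_measurable_seg2(2)) (use f in \<open>simp add: bounded_borel_def\<close>)
    then show "(\<lambda>x. \<integral>y. f (x, y) \<partial>seg h) \<in> borel_measurable borel"
      by (rule borel_measurable_lebesgue_integral)
    show "\<bar>\<integral>y. f (x, y) \<partial>seg h\<bar> \<le> (\<integral>y. B \<partial>seg h)" if x: "x \<in> {-h..h}" for x
    proof -
      have "\<bar>\<integral>y. f (x, y) \<partial>seg h\<bar> \<le> (\<integral>y. \<bar>f (x, y)\<bar> \<partial>seg h)"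
        by (rule integral_abs_bound)
      also have "\<dots> \<le> (\<integral>y. B \<partial>seg h)"
      proof (rule integral_mono)
        show "integrable (seg h) (\<lambda>y. \<bar>f (x, y)\<bar>)"
          by (rule integrable_abs[OF integrable_seg[OF bounded_borel_slice(2)[OF f x]]])
        show "integrable (seg h) (\<lambda>y. B)" by (rule integrable_seg[OF bounded_borel_const])
        show "\<bar>f (x, y)\<bar> \<le> B" if "y \<in> space (seg h)" for y using that x by (intro B) simp
      qed
      finally show ?thesis .
    qed
  qed
qed

lemma integral_seg_reflect: "(\<integral>x. f (- x) \<partial>seg h) = (\<integral>x. f x \<partial>seg h)" for f :: "real \<Rightarrow> real"
proof -
  have "(\<integral>x. f x \<partial>seg h) = (\<integral>x. indicator {-h..h} x *\<^sub>R f x \<partial>lborel)"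
    by (simp add: integral_restrict_space)
  also have "\<dots> = \<bar>- 1 :: real\<bar> *\<^sub>R (\<integral>x. indicator {-h..h} (0 + (- 1) * x) *\<^sub>R f (0 + (- 1) * x) \<partial>lborel)"
    by (rule lborel_integral_real_affine) simp
  also have "\<dots> = (\<integral>x. indicator {-h..h} x *\<^sub>R f (- x) \<partial>lborel)"
    by (auto intro!: Bochner_Integration.integral_cong simp: indicator_def)
  also have "\<dots> = (\<integral>x. f (- x) \<partial>seg h)"
    by (simp add: integral_restrict_space)
  finally show ?thesis by simp
qed

lemma AE_seg_neq: "AE x in seg h. x \<noteq> c"
  by (subst AE_restrict_space_iff) (auto intro: eventually_mono[OF AE_lborel_singleton[of c]])

section \<open>The inequality on the square\<close>

text \<open>
  The difference quotients of \<open>u\<close> in \<open>x\<close> are bounded by the Lipschitz constant and converge for all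
  \<open>y\<close> off the diagonals, so the derivative passes under the integral by dominated convergence.
\<close>

lemma marginal_derivative:
  fixes u p :: "real \<times> real \<Rightarrow> real"
  assumes u: "bounded_borel (square h) u" and p: "bounded_borel (square h) p"
    and L: "\<And>x x' y. x \<in> {-h..h} \<Longrightarrow> x' \<in> {-h..h} \<Longrightarrow> y \<in> {-h..h} \<Longrightarrow> \<bar>u (x, y) - u (x', y)\<bar> \<le> L * \<bar>x - x'\<bar>"
    and deriv: "\<And>x y. x \<in> {-h<..<h} \<Longrightarrow> y \<in> {-h..h} \<Longrightarrow> y \<noteq> x \<Longrightarrow> y \<noteq> - x
          \<Longrightarrow> ((\<lambda>x. u (x, y)) has_real_derivative p (x, y)) (at x)"
    and x: "x \<in> {-h<..<h}"
  shows "((\<lambda>x. \<integral>y. u (x, y) \<partial>seg h) has_real_derivative (\<integral>y. p (x, y) \<partial>seg h)) (at x)"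
proof -
  have "((\<lambda>w. ((\<integral>y. u (w, y) \<partial>seg h) - (\<integral>y. u (x, y) \<partial>seg h)) / (w - x))
      \<longlongrightarrow> (\<integral>y. p (x, y) \<partial>seg h)) (at x within {-h<..<h})"
    unfolding tendsto_at_iff_sequentially
  proof (intro allI impI)
    fix X :: "nat \<Rightarrow> real"
    assume X: "\<forall>i. X i \<in> {-h<..<h} - {x}" "X \<longlonglongrightarrow> x"
    have xI: "w \<in> {-h..h}" if "w \<in> {-h<..<h}" for w using that by auto
    define q where "q i y = (u (X i, y) - u (x, y)) / (X i - x)" for i y
    have slice: "bounded_borel {-h..h} (\<lambda>y. u (w, y))" if "w \<in> {-h<..<h}" for w
      by (rule bounded_borel_slice(2)[OF u xI[OF that]])
    have "(\<lambda>i. \<integral>y. q i y \<partial>seg h) \<longlonglongrightarrow> (\<integral>y. p (x, y) \<partial>seg h)"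
    proof (rule integral_dominated_convergence[where w = "\<lambda>_. L"])
      show "(\<lambda>y. p (x, y)) \<in> borel_measurable (seg h)"
        by (rule bounded_borel_seg[OF bounded_borel_slice(2)[OF p xI[OF x]]])
      show "q i \<in> borel_measurable (seg h)" for i
        unfolding q_def using X(1) x
        by (intro bounded_borel_seg[where S = "{-h..h}"] bounded_borel_intros slice) auto
      show "integrable (seg h) (\<lambda>_. L)" by (rule integrable_seg[OF bounded_borel_const])
      show "AE y in seg h. norm (q i y) \<le> L" for i
      proof (rule AE_I2)
        fix y assume "y \<in> space (seg h)"
        then have y: "y \<in> {-h..h}" by simp
        have Xi: "X i \<in> {-h..h}" "X i \<noteq> x" using X(1) by (auto simp: less_imp_le)
        show "norm (q i y) \<le> L"
          using L[OF Xi(1) xI[OF x] y] Xi(2) by (simp add: q_def divide_le_eq)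
      qed
      have "AE y in seg h. y \<in> {-h..h} \<and> y \<noteq> x \<and> y \<noteq> - x"
        using AE_seg_neq[of x h] AE_seg_neq[of "-x" h] AE_space[of "seg h"] by eventually_elim auto
      then show "AE y in seg h. (\<lambda>i. q i y) \<longlonglongrightarrow> p (x, y)"
      proof eventually_elim
        case (elim y)
        then have "((\<lambda>x. u (x, y)) has_real_derivative p (x, y)) (at x)" using x by (intro deriv) auto
        then have "((\<lambda>w. (u (w, y) - u (x, y)) / (w - x)) \<longlongrightarrow> p (x, y)) (at x)"
          by (simp add: has_field_derivative_iff)
        then show ?case unfolding tendsto_at_iff_sequentially using X by (auto simp: q_def o_def)
      qed
    qed
    moreover have "(\<integral>y. q i y \<partial>seg h) = ((\<integral>y. u (X i, y) \<partial>seg h) - (\<integral>y. u (x, y) \<partial>seg h)) / (X i - x)" for i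
    proof -
      have "X i \<in> {-h<..<h}" using X(1) by auto
      then show ?thesis unfolding q_def using integrable_seg[OF slice] x by simp
    qed
    ultimately show "((\<lambda>w. ((\<integral>y. u (w, y) \<partial>seg h) - (\<integral>y. u (x, y) \<partial>seg h)) / (w - x)) \<circ> X)
        \<longlonglongrightarrow> (\<integral>y. p (x, y) \<partial>seg h)" by (simp add: o_def)
  qed
  moreover have "at x within {-h<..<h} = at x" using x by (intro at_within_open) auto
  ultimately show ?thesis by (simp add: has_field_derivative_iff)
qed

text \<open>
  With \<open>A\<close> the marginal of \<open>u\<close>, \<open>g\<close> its derivative and \<open>a = \<integral> A\<close>, the Wirtinger inequality for the
  slices \<open>u (x, y) - A x / (2 h)\<close>, with their means \<open>c y\<close> removed, integrates over \<open>y\<close> to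
  \<open>k\<^sup>2 (\<integral> u\<^sup>2 - \<integral> A\<^sup>2 / h + a\<^sup>2 / (4 h\<^sup>2)) \<le> \<integral> p\<^sup>2 - \<integral> g\<^sup>2 / (2 h)\<close>.
  Bounding \<open>\<integral> g\<^sup>2\<close> below by \<open>poincare_even_zero_boundary\<close> cancels all terms in \<open>A\<close>. Here \<open>2 h\<^sup>2 k\<^sup>2 = z\<^sup>2\<close>:
  only the \<open>x\<close>-derivative enters, which explains the factor \<open>2\<close> in the conclusion.
\<close>

lemma poincare_square:
  fixes u p :: "real \<times> real \<Rightarrow> real"
  assumes h: "0 < h" and z: "0 < z" "sqrt 2 * z < pi" "z * cot z + 1 = 0"
    and u: "bounded_borel (square h) u" and p: "bounded_borel (square h) p"
    and cont: "\<And>y. y \<in> {-h..h} \<Longrightarrow> continuous_on {-h..h} (\<lambda>x. u (x, y))"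
    and deriv: "\<And>x y. x \<in> {-h<..<h} \<Longrightarrow> y \<in> {-h..h} \<Longrightarrow> y \<noteq> x \<Longrightarrow> y \<noteq> - x
          \<Longrightarrow> ((\<lambda>x. u (x, y)) has_real_derivative p (x, y)) (at x)"
    and sym: "\<And>x y. u (y, x) = u (x, y)" "\<And>x y. u (- x, - y) = u (x, y)"
    and mean: "(\<integral>y. u (h, y) \<partial>seg h) = 0"
  shows "z\<^sup>2 * (\<integral>q. (u q)\<^sup>2 \<partial>seg2 h) \<le> 2 * h\<^sup>2 * (\<integral>q. (p q)\<^sup>2 \<partial>seg2 h)"
proof -
  define A where "A x = (\<integral>y. u (x, y) \<partial>seg h)" for x
  define g where "g x = (\<integral>y. p (x, y) \<partial>seg h)" for x
  have A_eq: "A = (\<lambda>x. \<integral>y. u (x, y) \<partial>seg h)" and g_eq: "g = (\<lambda>x. \<integral>y. p (x, y) \<partial>seg h)"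
    by (simp_all add: fun_eq_iff A_def g_def)
  obtain L where L: "\<And>q. q \<in> square h \<Longrightarrow> \<bar>p q\<bar> \<le> L" using p unfolding bounded_borel_def by blast
  have A: "bounded_borel {-h..h} A" and g: "bounded_borel {-h..h} g"
    unfolding A_def g_def by (intro bounded_borel_marginal u p)+
  have lip: "\<bar>u (x, y) - u (x', y)\<bar> \<le> L * \<bar>x - x'\<bar>"
    if "x \<in> {-h..h}" "x' \<in> {-h..h}" "y \<in> {-h..h}" for x x' y
    by (rule lipschitz_of_bounded_derivative[where f = "\<lambda>x. u (x, y)" and g = "\<lambda>x. p (x, y)" and S = "{y, -y}"])
       (use that L cont in \<open>auto intro!: deriv\<close>)
  have dA: "(A has_real_derivative g x) (at x)" if "x \<in> {-h<..<h}" for x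
    unfolding A_def g_def by (rule marginal_derivative[OF u p lip deriv that])
  have A_even: "A (- x) = A x" for x
    using integral_seg_reflect[of h "\<lambda>y. u (x, y)"] sym(2)[of x "- y" for y] by (simp add: A_def)
  have Ah: "A h = 0" unfolding A_def by (rule mean)
  have contA: "continuous_on {-h..h} A"
  proof -
    have "\<bar>A x - A x'\<bar> \<le> L * 2 * h * \<bar>x - x'\<bar>" if x: "x \<in> {-h..h}" "x' \<in> {-h..h}" for x x'
    proof -
      have "A x - A x' = (\<integral>y. u (x, y) - u (x', y) \<partial>seg h)"
        unfolding A_def using x
        by (intro Bochner_Integration.integral_diff[symmetric] integrable_seg bounded_borel_slice(2)[OF u])
      also have "\<bar>\<dots>\<bar> \<le> (\<integral>y. \<bar>u (x, y) - u (x', y)\<bar> \<partial>seg h)" by (rule integral_abs_bound)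
      also have "\<dots> \<le> (\<integral>y. L * \<bar>x - x'\<bar> \<partial>seg h)"
      proof (rule integral_mono)
        show "integrable (seg h) (\<lambda>y. \<bar>u (x, y) - u (x', y)\<bar>)"
          using x by (intro integrable_abs integrable_seg bounded_borel_intros bounded_borel_slice(2)[OF u])
        show "integrable (seg h) (\<lambda>y. L * \<bar>x - x'\<bar>)" by (rule integrable_seg[OF bounded_borel_const])
      qed (use lip x in auto)
      also have "\<dots> = L * 2 * h * \<bar>x - x'\<bar>" using h by (simp add: measure_seg)
      finally show ?thesis .
    qed
    moreover have "0 \<le> L" using L[of "(0,0)"] h by auto
    ultimately have "(L * 2 * h)-lipschitz_on {-h..h} A"
      using h by (intro lipschitz_onI) (auto simp: dist_real_def)
    then show ?thesis by (rule lipschitz_on_continuous_on)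
  qed
  define a where "a = (\<integral>x. A x \<partial>seg h)"
  note seg_eq = integral_unique[OF has_integral_seg]
  have IA: "z\<^sup>2 * ((\<integral>x. (A x)\<^sup>2 \<partial>seg h) - a\<^sup>2 / (4 * h)) \<le> h\<^sup>2 * (\<integral>x. (g x)\<^sup>2 \<partial>seg h)"
  proof -
    have "z * 1 \<le> z * sqrt 2" using z by (intro mult_left_mono) auto
    then have "z < pi" using z(2) by (simp add: mult.commute)
    then have "z\<^sup>2 * (integral {-h..h} (\<lambda>x. (A x)\<^sup>2) - a\<^sup>2 / (4 * h)) \<le> h\<^sup>2 * integral {-h..h} (\<lambda>x. (g x)\<^sup>2)"
      using has_integral_seg[OF bounded_borel_power2[OF g]]
      by (intro poincare_even_zero_boundary[OF h z(1) _ z(3) contA dA _ A_even Ah])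
         (auto simp: a_def seg_eq[OF A] has_integral_iff)
    then show ?thesis by (simp add: seg_eq[OF bounded_borel_power2] A g)
  qed
  \<comment> \<open>The slices need only half of the constant, and for it the interval \<open>[-h,h]\<close> is
    short enough: \<open>k (2 h) = sqrt 2 * z < pi\<close>.\<close>
  define k where "k = z / (sqrt 2 * h)"
  have k: "0 < k" "k * (h - (- h)) < pi"
  proof -
    have "k * (h - (- h)) = sqrt 2 * z"
      using h by (simp add: k_def field_simps)
    then show "k * (h - (- h)) < pi" using z by simp
    show "0 < k" using h z by (simp add: k_def)
  qed
  have slice_u: "bounded_borel {-h..h} (\<lambda>x. u (x, y))" and slice_p: "bounded_borel {-h..h} (\<lambda>x. p (x, y))"
    if "y \<in> {-h..h}" for y using bounded_borel_slice(1) that u p by blast+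
  define c where "c y = (A y - a / (2 * h)) / (2 * h)" for y
  have slice: "k\<^sup>2 * ((\<integral>x. (u (x, y) - A x / (2 * h))\<^sup>2 \<partial>seg h) - 2 * h * (c y)\<^sup>2)
      \<le> (\<integral>x. (p (x, y) - g x / (2 * h))\<^sup>2 \<partial>seg h)" if y: "y \<in> {-h..h}" for y
  proof -
    define f0 where "f0 x = u (x, y) - A x / (2 * h)" for x
    define f where "f x = f0 x - c y" for x
    define q where "q x = p (x, y) - g x / (2 * h)" for x
    have f0: "bounded_borel {-h..h} f0" and f: "bounded_borel {-h..h} f" and q: "bounded_borel {-h..h} q"
      unfolding f_def f0_def q_def by (intro bounded_borel_intros slice_u slice_p A g y)+
    have int_f0: "(\<integral>x. f0 x \<partial>seg h) = 2 * h * c y"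
    proof -
      have "(\<integral>x. f0 x \<partial>seg h) = (\<integral>x. u (x, y) \<partial>seg h) - a / (2 * h)"
        using integrable_seg[OF slice_u[OF y]] integrable_seg[OF A] by (simp add: f0_def a_def)
      also have "(\<integral>x. u (x, y) \<partial>seg h) = A y" using sym(1) by (simp add: A_def)
      finally show ?thesis using h by (simp add: c_def)
    qed
    have int_f: "integral {-h..h} f = 0"
      unfolding seg_eq[OF f]
      using integrable_seg[OF f0] integrable_seg[OF bounded_borel_const, of h "c y"] int_f0 measure_seg[of h] h
      by (simp add: f_def[abs_def])
    have int_f2: "(\<integral>x. (f x)\<^sup>2 \<partial>seg h) = (\<integral>x. (f0 x)\<^sup>2 \<partial>seg h) - 2 * h * (c y)\<^sup>2"
    proof -
      have "(\<integral>x. (f x)\<^sup>2 \<partial>seg h) = (\<integral>x. (f0 x)\<^sup>2 - 2 * c y * f0 x + (c y)\<^sup>2 \<partial>seg h)"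
        by (intro Bochner_Integration.integral_cong) (auto simp: f_def power2_diff)
      also have "\<dots> = (\<integral>x. (f0 x)\<^sup>2 \<partial>seg h) - 2 * c y * (\<integral>x. f0 x \<partial>seg h) + (c y)\<^sup>2 * (2 * h)"
        using integrable_seg[OF f0] integrable_seg[OF bounded_borel_power2[OF f0]]
          integrable_seg[OF bounded_borel_const, of h "(c y)\<^sup>2"] measure_seg[of h] h
        by simp
      finally show ?thesis unfolding int_f0 by (simp add: power2_eq_square)
    qed
    have "k\<^sup>2 * (integral {-h..h} (\<lambda>x. (f x)\<^sup>2) - k * cot (k * (h - (- h))) * 0\<^sup>2) \<le> integral {-h..h} (\<lambda>x. (q x)\<^sup>2)"
    proof (rule poincare_interval_robin[where S = "{y, - y}"])
      show "continuous_on {- h..h} f"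
        unfolding f_def f0_def by (intro continuous_intros cont contA y) (use h in auto)
      show "(f has_real_derivative q x) (at x)" if x: "x \<in> {- h<..<h} - {y, - y}" for x
        unfolding f_def f0_def q_def using x y h
        by (auto intro!: derivative_eq_intros deriv dA)
      show "(\<lambda>x. (q x)\<^sup>2) integrable_on {- h..h}"
        using has_integral_seg[OF bounded_borel_power2[OF q]] by blast
    qed (use h k int_f in auto)
    then show ?thesis
      unfolding seg_eq[OF bounded_borel_power2[OF f]] seg_eq[OF bounded_borel_power2[OF q]] int_f2
      by (simp add: f0_def q_def)
  qed
  define U where "U = (\<integral>q. (u q)\<^sup>2 \<partial>seg2 h)"
  define P where "P = (\<integral>q. (p q)\<^sup>2 \<partial>seg2 h)"
  define IA2 where "IA2 = (\<integral>x. (A x)\<^sup>2 \<partial>seg h)"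
  define Ig2 where "Ig2 = (\<integral>x. (g x)\<^sup>2 \<partial>seg h)"
  \<comment> \<open>Pythagoras: \<open>B / (2 h)\<close> is the orthogonal projection of \<open>w\<close> onto the functions of the
    first coordinate.\<close>
  have cross: "(\<integral>q. (w q - B (fst q) / (2 * h))\<^sup>2 \<partial>seg2 h) = (\<integral>q. (w q)\<^sup>2 \<partial>seg2 h) - (\<integral>x. (B x)\<^sup>2 \<partial>seg h) / (2 * h)"
    if w: "bounded_borel (square h) w" and B: "B = (\<lambda>x. \<integral>y. w (x, y) \<partial>seg h)" for w B
  proof -
    have Bb: "bounded_borel {-h..h} B" unfolding B by (rule bounded_borel_marginal[OF w])
    note Bf = bounded_borel_fst[OF Bb] bounded_borel_fst[OF bounded_borel_power2[OF Bb]]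
    have 1: "(\<integral>q. w q * B (fst q) \<partial>seg2 h) = (\<integral>x. (B x)\<^sup>2 \<partial>seg h)"
      using integral_seg2(2)[OF bounded_borel_mult[OF w Bf(1)]] by (simp add: B power2_eq_square)
    have 2: "(\<integral>q. (B (fst q))\<^sup>2 \<partial>seg2 h) = 2 * h * (\<integral>x. (B x)\<^sup>2 \<partial>seg h)"
      using integral_seg2(2)[OF Bf(2)] h by (simp add: measure_seg)
    have "(\<integral>q. (w q - B (fst q) / (2 * h))\<^sup>2 \<partial>seg2 h)
        = (\<integral>q. (w q)\<^sup>2 - (w q * B (fst q)) / h + (B (fst q))\<^sup>2 / (4 * h\<^sup>2) \<partial>seg2 h)"
      using h by (intro Bochner_Integration.integral_cong)
        (auto simp: power2_diff power_divide power_mult_distrib)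
    also have "\<dots> = (\<integral>q. (w q)\<^sup>2 \<partial>seg2 h) - (\<integral>q. w q * B (fst q) \<partial>seg2 h) / h
        + (\<integral>q. (B (fst q))\<^sup>2 \<partial>seg2 h) / (4 * h\<^sup>2)"
      using integrable_seg2[OF bounded_borel_power2[OF w]] integrable_seg2[OF bounded_borel_mult[OF w Bf(1)]]
        integrable_seg2[OF Bf(2)] by simp
    also have "\<dots> = (\<integral>q. (w q)\<^sup>2 \<partial>seg2 h) - (\<integral>x. (B x)\<^sup>2 \<partial>seg h) / (2 * h)"
      unfolding 1 2 using h by (simp add: field_simps power2_eq_square)
    finally show ?thesis .
  qed
  have bA: "bounded_borel (square h) (\<lambda>q. A (fst q))" and bg: "bounded_borel (square h) (\<lambda>q. g (fst q))"
    by (intro bounded_borel_fst A g)+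
  have bc: "bounded_borel {-h..h} c" unfolding c_def by (intro bounded_borel_intros A)
  note bq = bounded_borel_power2[OF bounded_borel_diff[OF u bounded_borel_divide[OF bA]], of "2 * h"]
    bounded_borel_power2[OF bounded_borel_diff[OF p bounded_borel_divide[OF bg]], of "2 * h"]
  have int_c: "(\<integral>y. (c y)\<^sup>2 \<partial>seg h) = (IA2 - a\<^sup>2 / (2 * h)) / (4 * h\<^sup>2)"
  proof -
    have "(\<integral>y. (c y)\<^sup>2 \<partial>seg h) = (\<integral>y. (A y)\<^sup>2 / (4 * h\<^sup>2) - A y * (a / (4 * h ^ 3)) + a\<^sup>2 / (16 * h ^ 4) \<partial>seg h)"
      using h by (intro Bochner_Integration.integral_cong)
        (auto simp: c_def power2_diff power_divide power_mult_distrib field_simps power2_eq_square power3_eq_cube power4_eq_xxxx)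
    also have "\<dots> = IA2 / (4 * h\<^sup>2) - a * (a / (4 * h ^ 3)) + a\<^sup>2 / (16 * h ^ 4) * (2 * h)"
      using integrable_seg[OF bounded_borel_power2[OF A]] integrable_seg[OF A]
        integrable_seg[OF bounded_borel_const, of h "a\<^sup>2 / (16 * h ^ 4)"] measure_seg[of h] h
      by (simp add: IA2_def a_def)
    also have "\<dots> = (IA2 - a\<^sup>2 / (2 * h)) / (4 * h\<^sup>2)"
      using h by (simp add: field_simps power2_eq_square power3_eq_cube power4_eq_xxxx)
    finally show ?thesis .
  qed
  have bm: "bounded_borel {-h..h} (\<lambda>y. \<integral>x. f (x, y) \<partial>seg h)" if "bounded_borel (square h) f" for f
    using bounded_borel_marginal[OF bounded_borel_swap[OF that]] by simp
  have "(\<integral>y. k\<^sup>2 * ((\<integral>x. (u (x, y) - A x / (2 * h))\<^sup>2 \<partial>seg h) - 2 * h * (c y)\<^sup>2) \<partial>seg h)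
      \<le> (\<integral>y. (\<integral>x. (p (x, y) - g x / (2 * h))\<^sup>2 \<partial>seg h) \<partial>seg h)"
    using bm[OF bq(1)] bm[OF bq(2)] bc
    by (intro integral_mono integrable_seg bounded_borel_intros) (auto intro!: slice)
  also have "\<dots> = P - Ig2 / (2 * h)"
    unfolding P_def Ig2_def using integral_seg2(1)[OF bq(2)] cross[OF p g_eq] by simp
  also have "(\<integral>y. k\<^sup>2 * ((\<integral>x. (u (x, y) - A x / (2 * h))\<^sup>2 \<partial>seg h) - 2 * h * (c y)\<^sup>2) \<partial>seg h)
      = k\<^sup>2 * ((U - IA2 / (2 * h)) - 2 * h * (\<integral>y. (c y)\<^sup>2 \<partial>seg h))"
    unfolding U_def IA2_def using integral_seg2(1)[OF bq(1)] cross[OF u A_eq]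
      integrable_seg[OF bm[OF bq(1)]] integrable_seg[OF bounded_borel_power2[OF bc]]
    by simp
  finally have main: "k\<^sup>2 * ((U - IA2 / (2 * h)) - 2 * h * ((IA2 - a\<^sup>2 / (2 * h)) / (4 * h\<^sup>2))) \<le> P - Ig2 / (2 * h)"
    unfolding int_c .
  have "2 * h\<^sup>2 * (k\<^sup>2 * ((U - IA2 / (2 * h)) - 2 * h * ((IA2 - a\<^sup>2 / (2 * h)) / (4 * h\<^sup>2)))) \<le> 2 * h\<^sup>2 * (P - Ig2 / (2 * h))"
    using h by (intro mult_left_mono main) auto
  moreover have "2 * h\<^sup>2 * k\<^sup>2 = z\<^sup>2" using h by (simp add: k_def power_divide power_mult_distrib)
  ultimately have "z\<^sup>2 * ((U - IA2 / (2 * h)) - 2 * h * ((IA2 - a\<^sup>2 / (2 * h)) / (4 * h\<^sup>2))) \<le> 2 * h\<^sup>2 * (P - Ig2 / (2 * h))"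
    by (simp only: mult.assoc[symmetric])
  moreover have "(U - IA2 / (2 * h)) - 2 * h * ((IA2 - a\<^sup>2 / (2 * h)) / (4 * h\<^sup>2)) = U - (IA2 - a\<^sup>2 / (4 * h)) / h"
    using h by (simp add: field_simps power2_eq_square)
  moreover have "2 * h\<^sup>2 * (P - Ig2 / (2 * h)) = 2 * h\<^sup>2 * P - (h\<^sup>2 * Ig2) / h"
    using h by (simp add: field_simps power2_eq_square)
  ultimately have "z\<^sup>2 * U - z\<^sup>2 * (IA2 - a\<^sup>2 / (4 * h)) / h \<le> 2 * h\<^sup>2 * P - h\<^sup>2 * Ig2 / h"
    by (simp only: right_diff_distrib[of "z\<^sup>2" U] times_divide_eq_right)
  moreover have "z\<^sup>2 * (IA2 - a\<^sup>2 / (4 * h)) / h \<le> h\<^sup>2 * Ig2 / h"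
    using IA h unfolding IA2_def Ig2_def by (intro divide_right_mono) auto
  ultimately show ?thesis unfolding U_def[symmetric] P_def[symmetric] by linarith
qed

section \<open>Unfolding the triangle to the square\<close>

lemma bounded_borel_uminus_both:
  assumes "bounded_borel (square h) f" shows "bounded_borel (square h) (\<lambda>q. f (- fst q, - snd q))"
proof -
  obtain B where B: "\<And>q. q \<in> square h \<Longrightarrow> \<bar>f q\<bar> \<le> B"
    using assms unfolding bounded_borel_def by blast
  have "(\<lambda>q. (- fst q, - snd q)) \<in> borel \<rightarrow>\<^sub>M (borel :: (real \<times> real) measure)"
    by (intro borel_measurable_continuous_onI continuous_intros)
  moreover have "f \<in> borel_measurable borel" using assms by (simp add: bounded_borel_def)
  ultimately have "(\<lambda>q. f (- fst q, - snd q)) \<in> borel_measurable borel"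
    by (rule measurable_compose)
  then show ?thesis
    by (rule bounded_borelI[where B = B]) (rule B, auto)
qed

lemma integral_seg2_swap:
  assumes "bounded_borel (square h) f"
  shows "(\<integral>q. f (snd q, fst q) \<partial>seg2 h) = (\<integral>q. f q \<partial>seg2 h)"
  using integral_seg2(1)[OF assms] integral_seg2(2)[OF bounded_borel_swap[OF assms]] by simp

lemma integral_seg2_uminus:
  assumes "bounded_borel (square h) f"
  shows "(\<integral>q. f (- fst q, - snd q) \<partial>seg2 h) = (\<integral>q. f q \<partial>seg2 h)"
proof -
  have "(\<integral>q. f (- fst q, - snd q) \<partial>seg2 h) = (\<integral>y. \<integral>x. f (- x, - y) \<partial>seg h \<partial>seg h)"
    using integral_seg2(1)[OF bounded_borel_uminus_both[OF assms]] by simp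
  also have "\<dots> = (\<integral>y. \<integral>x. f (x, - y) \<partial>seg h \<partial>seg h)"
    by (intro Bochner_Integration.integral_cong refl integral_seg_reflect[where f = "\<lambda>x. f (x, - y)" for y])
  also have "\<dots> = (\<integral>y. \<integral>x. f (x, y) \<partial>seg h \<partial>seg h)"
    by (rule integral_seg_reflect[where f = "\<lambda>y. \<integral>x. f (x, y) \<partial>seg h"])
  finally show ?thesis using integral_seg2(1)[OF assms] by simp
qed

lemma right_triangle_iff: "(x, y) \<in> right_triangle h \<longleftrightarrow> \<bar>y\<bar> < x \<and> x < h"
  by (simp add: right_triangle_def)

lemma right_triangle_subset: "right_triangle h \<subseteq> square h"
  by (auto simp: right_triangle_def)

lemma open_right_triangle: "open (right_triangle h)"
proof -
  have "right_triangle h = {q. \<bar>snd q\<bar> < fst q} \<inter> {q. fst q < h}"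
    by (auto simp: right_triangle_def)
  also have "open \<dots>" by (intro open_Int open_Collect_less continuous_intros)
  finally show ?thesis .
qed

lemma bounded_borel_indicator_triangle: "bounded_borel (square h) (indicator (right_triangle h))"
  using open_right_triangle[of h]
  by (intro bounded_borelI[where B = 1] borel_measurable_indicator borel_open) (auto simp: indicator_def)

text \<open>
  Up to the diagonals and the boundary, the square is the union of the triangle and its images under
  \<open>(x, y) \<mapsto> (y, x)\<close>, \<open>(- x, - y)\<close> and \<open>(- y, - x)\<close>.
\<close>

lemma integral_square_eq_triangle:
  assumes f: "bounded_borel (square h) f"
  shows "(\<integral>q. f q \<partial>seg2 h) = (\<integral>q. indicator (right_triangle h) q *
      (f (fst q, snd q) + f (snd q, fst q) + f (- fst q, - snd q) + f (- snd q, - fst q)) \<partial>seg2 h)"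
proof -
  define w :: "real \<times> real \<Rightarrow> real" where "w = indicator (right_triangle h)"
  have w: "bounded_borel (square h) w" unfolding w_def by (rule bounded_borel_indicator_triangle)
  have w_swap: "bounded_borel (square h) (\<lambda>q. w (snd q, fst q))" by (rule bounded_borel_swap[OF w])
  have f_swap: "bounded_borel (square h) (\<lambda>q. f (snd q, fst q))" by (rule bounded_borel_swap[OF f])
  have f_neg: "bounded_borel (square h) (\<lambda>q. f (- fst q, - snd q))" by (rule bounded_borel_uminus_both[OF f])
  have w_neg: "bounded_borel (square h) (\<lambda>q. w (- fst q, - snd q))" by (rule bounded_borel_uminus_both[OF w])
  have f_ns: "bounded_borel (square h) (\<lambda>q. f (- snd q, - fst q))" using bounded_borel_swap[OF f_neg] by simp
  have w_ns: "bounded_borel (square h) (\<lambda>q. w (- snd q, - fst q))" using bounded_borel_swap[OF w_neg] by simp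
  note b = w f w_swap f_swap f_neg w_neg f_ns w_ns
  define s where "s q = (w q + w (snd q, fst q) + w (- fst q, - snd q) + w (- snd q, - fst q)) * f q" for q
  have s: "bounded_borel (square h) s" unfolding s_def by (intro bounded_borel_intros b)
  have sum1: "w (x, y) + w (y, x) + w (- x, - y) + w (- y, - x) = 1"
    if "\<bar>x\<bar> < h" "\<bar>y\<bar> < h" "y \<noteq> x" "y \<noteq> - x" for x y
  proof -
    consider "\<bar>y\<bar> < x" | "\<bar>x\<bar> < y" | "\<bar>y\<bar> < - x" | "\<bar>x\<bar> < - y" using \<open>y \<noteq> x\<close> \<open>y \<noteq> - x\<close> by linarith
    then show ?thesis
      by cases (use that in \<open>auto simp: w_def indicator_def right_triangle_iff\<close>)
  qed
  \<comment> \<open>The diagonals and the sides of the square meet each vertical line with \<open>\<bar>x\<bar> < h\<close> in at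
    most four points.\<close>
  have inner: "(\<integral>y. f (x, y) \<partial>seg h) = (\<integral>y. s (x, y) \<partial>seg h)" if x: "x \<in> {-h..h}" "x \<noteq> h" "x \<noteq> - h" for x
  proof (rule integral_cong_AE)
    show "(\<lambda>y. f (x, y)) \<in> borel_measurable (seg h)" "(\<lambda>y. s (x, y)) \<in> borel_measurable (seg h)"
      by (intro bounded_borel_seg[OF bounded_borel_slice(2)[OF _ x(1)]] f s)+
    show "AE y in seg h. f (x, y) = s (x, y)"
      using AE_seg_neq[of x h] AE_seg_neq[of "-x" h] AE_seg_neq[of h h] AE_seg_neq[of "-h" h] AE_space[of "seg h"]
    proof eventually_elim
      case (elim y)
      then have "\<bar>x\<bar> < h" "\<bar>y\<bar> < h" using x by auto
      then show ?case using sum1[of x y] elim by (simp add: s_def)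
    qed
  qed
  have "(\<integral>q. f q \<partial>seg2 h) = (\<integral>x. \<integral>y. f (x, y) \<partial>seg h \<partial>seg h)" by (rule integral_seg2(2)[OF f, symmetric])
  also have "\<dots> = (\<integral>x. \<integral>y. s (x, y) \<partial>seg h \<partial>seg h)"
  proof (rule integral_cong_AE)
    show "(\<lambda>x. \<integral>y. f (x, y) \<partial>seg h) \<in> borel_measurable (seg h)" "(\<lambda>x. \<integral>y. s (x, y) \<partial>seg h) \<in> borel_measurable (seg h)"
      by (intro bounded_borel_seg[OF bounded_borel_marginal] f s)+
    show "AE x in seg h. (\<integral>y. f (x, y) \<partial>seg h) = (\<integral>y. s (x, y) \<partial>seg h)"
      using AE_seg_neq[of h h] AE_seg_neq[of "-h" h] AE_space[of "seg h"]
      by eventually_elim (auto intro: inner)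
  qed
  also have "\<dots> = (\<integral>q. s q \<partial>seg2 h)" by (rule integral_seg2(2)[OF s])
  also have "\<dots> = (\<integral>q. w q * f q \<partial>seg2 h) + (\<integral>q. w (snd q, fst q) * f q \<partial>seg2 h)
      + (\<integral>q. w (- fst q, - snd q) * f q \<partial>seg2 h) + (\<integral>q. w (- snd q, - fst q) * f q \<partial>seg2 h)"
    unfolding s_def distrib_right
    by (simp add: integrable_seg2 bounded_borel_intros b)
  also have "(\<integral>q. w (snd q, fst q) * f q \<partial>seg2 h) = (\<integral>q. w q * f (snd q, fst q) \<partial>seg2 h)"
    using integral_seg2_swap[OF bounded_borel_mult[OF w f_swap]] by simp
  also have "(\<integral>q. w (- fst q, - snd q) * f q \<partial>seg2 h) = (\<integral>q. w q * f (- fst q, - snd q) \<partial>seg2 h)"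
    using integral_seg2_uminus[OF bounded_borel_mult[OF w f_neg]] by simp
  also have "(\<integral>q. w (- snd q, - fst q) * f q \<partial>seg2 h) = (\<integral>q. w q * f (- snd q, - fst q) \<partial>seg2 h)"
    using integral_seg2_swap[OF bounded_borel_uminus_both[OF bounded_borel_mult[OF w f_ns]]]
      integral_seg2_uminus[OF bounded_borel_mult[OF w f_ns]] by simp
  also have "(\<integral>q. w q * f q \<partial>seg2 h) + (\<integral>q. w q * f (snd q, fst q) \<partial>seg2 h)
      + (\<integral>q. w q * f (- fst q, - snd q) \<partial>seg2 h) + (\<integral>q. w q * f (- snd q, - fst q) \<partial>seg2 h)
    = (\<integral>q. w q * (f (fst q, snd q) + f (snd q, fst q) + f (- fst q, - snd q) + f (- snd q, - fst q)) \<partial>seg2 h)"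
    unfolding distrib_left prod.collapse
    by (simp add: integrable_seg2 bounded_borel_intros b)
  finally show ?thesis unfolding w_def .
qed

lemma seg2_eq: "seg2 h = restrict_space lborel (square h)"
proof -
  have sq: "square h \<in> sets lborel" by (simp add: borel_Times)
  interpret pair_sigma_finite "seg h" "seg h" by (rule pair_sigma_finite_seg)
  show ?thesis
  proof (rule pair_measure_eqI)
    show "sigma_finite_measure (seg h)" "sigma_finite_measure (seg h)"
      by (rule finite_measure.axioms(1)[OF finite_measure_seg])+
    have id1: "(\<lambda>q. q) \<in> seg2 h \<rightarrow>\<^sub>M (borel :: (real \<times> real) measure)"
    proof -
      have "(\<lambda>q. (fst q, snd q)) \<in> seg2 h \<rightarrow>\<^sub>M borel \<Otimes>\<^sub>M borel"
        using measurable_compose[OF measurable_fst ident_seg] measurable_compose[OF measurable_snd ident_seg]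
        by (rule measurable_Pair)
      then show ?thesis unfolding borel_prod by simp
    qed
    show "sets (seg2 h) = sets (restrict_space lborel (square h))"
    proof (rule antisym; rule subsetI)
      fix A assume A: "A \<in> sets (restrict_space lborel (square h))"
      then have "A \<in> sets borel" "A \<subseteq> square h" using sq by (auto simp: sets_restrict_space_iff)
      moreover have "(\<lambda>q. q) -` A \<inter> space (seg2 h) \<in> sets (seg2 h)"
        using id1 \<open>A \<in> sets borel\<close> by (rule measurable_sets)
      ultimately show "A \<in> sets (seg2 h)" by (simp add: space_seg2 Int_absorb2)
    next
      fix A assume A: "A \<in> sets (seg2 h)"
      have f: "fst \<in> restrict_space lborel (square h) \<rightarrow>\<^sub>M seg h"
        by (intro measurable_restrict_space3) (auto simp: borel_prod[symmetric])
      have s: "snd \<in> restrict_space lborel (square h) \<rightarrow>\<^sub>M seg h"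
        by (intro measurable_restrict_space3) (auto simp: borel_prod[symmetric])
      have "(\<lambda>q. (fst q, snd q)) \<in> restrict_space lborel (square h) \<rightarrow>\<^sub>M seg2 h"
        by (rule measurable_Pair[OF f s])
      from measurable_sets[OF this A]
      show "A \<in> sets (restrict_space lborel (square h))"
        using sets.sets_into_space[OF A] by (simp add: space_restrict_space space_seg2 Int_absorb2 vimage_def)
    qed
    fix A B assume AB: "A \<in> sets (seg h)" "B \<in> sets (seg h)"
    then have AB': "A \<in> sets lborel" "B \<in> sets lborel" "A \<subseteq> {-h..h}" "B \<subseteq> {-h..h}"
      by (auto simp: sets_restrict_space_iff)
    then have "emeasure (restrict_space lborel (square h)) (A \<times> B) = emeasure lborel (A \<times> B)"
      using sq by (intro emeasure_restrict_space) auto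
    also have "\<dots> = emeasure lborel A * emeasure lborel B"
      using AB' by (simp add: lborel_prod[symmetric] lborel.emeasure_pair_measure_Times)
    also have "\<dots> = emeasure (seg h) A * emeasure (seg h) B"
      using AB' by (simp add: emeasure_restrict_space)
    finally show "emeasure (seg h) A * emeasure (seg h) B = emeasure (restrict_space lborel (square h)) (A \<times> B)"
      by simp
  qed
qed

lemma triangle_lebesgue: "right_triangle h \<in> sets lebesgue"
  using open_right_triangle by (simp add: borel_open)

text \<open>
  Moves integrals from the completed Lebesgue measure on the triangle to the product measure on the
  square, where Fubini's theorem is available.
\<close>

lemma integrable_triangle:
  assumes f: "bounded_borel (square h) f"
  shows "integrable (lebesgue_on (right_triangle h)) f"
    and "(\<integral>q. f q \<partial>lebesgue_on (right_triangle h)) = (\<integral>q. indicator (right_triangle h) q * f q \<partial>seg2 h)"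
proof -
  let ?T = "right_triangle h"
  have sq: "square h \<inter> space lborel \<in> sets lborel" by (simp add: borel_Times)
  have eq: "indicator (square h) q *\<^sub>R (indicator ?T q * f q) = indicator ?T q *\<^sub>R f q" for q
    using right_triangle_subset[of h] by (auto simp: indicator_def)
  have bf: "bounded_borel (square h) (\<lambda>q. indicator ?T q * f q)"
    by (intro bounded_borel_intros bounded_borel_indicator_triangle f)
  have meas: "(\<lambda>q. indicator ?T q *\<^sub>R f q) \<in> borel_measurable lborel"
    using bf by (simp add: bounded_borel_def)
  have "integrable (seg2 h) (\<lambda>q. indicator ?T q * f q)" by (rule integrable_seg2[OF bf])
  then have "integrable lborel (\<lambda>q. indicator ?T q *\<^sub>R f q)"
    unfolding seg2_eq integrable_restrict_space[OF sq] eq .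
  then have "integrable lebesgue (\<lambda>q. indicator ?T q *\<^sub>R f q)"
    using meas by (simp add: integrable_completion)
  then show "integrable (lebesgue_on ?T) f"
    using triangle_lebesgue[of h] by (simp add: integrable_restrict_space)
  have "(\<integral>q. f q \<partial>lebesgue_on ?T) = (\<integral>q. indicator ?T q *\<^sub>R f q \<partial>lebesgue)"
    using triangle_lebesgue[of h] by (simp add: integral_restrict_space)
  also have "\<dots> = (\<integral>q. indicator ?T q *\<^sub>R f q \<partial>lborel)" by (rule integral_completion[OF meas])
  also have "\<dots> = (\<integral>q. indicator ?T q * f q \<partial>seg2 h)"
    unfolding seg2_eq integral_restrict_space[OF sq] eq ..
  finally show "(\<integral>q. f q \<partial>lebesgue_on ?T) = (\<integral>q. indicator ?T q * f q \<partial>seg2 h)" .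
qed

text \<open>
  The partial derivatives are parameters because for products and for shifts by constants they are
  known in closed form.
\<close>

definition C1_partials :: "(real \<times> real \<Rightarrow> real) \<Rightarrow> (real \<times> real \<Rightarrow> real) \<Rightarrow> (real \<times> real \<Rightarrow> real) \<Rightarrow> bool" where
  "C1_partials \<phi> \<phi>1 \<phi>2 \<longleftrightarrow> (\<forall>q. (\<phi> has_derivative (\<lambda>v. fst v * \<phi>1 q + snd v * \<phi>2 q)) (at q)) \<and>
     continuous_on UNIV \<phi>1 \<and> continuous_on UNIV \<phi>2"

lemma C1_partials_continuous:
  assumes "C1_partials \<phi> \<phi>1 \<phi>2"
  shows "continuous_on UNIV \<phi>" "continuous_on UNIV \<phi>1" "continuous_on UNIV \<phi>2"
  using assms unfolding C1_partials_def
  by (auto intro!: continuous_at_imp_continuous_on dest: has_derivative_continuous)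

lemma C1_partials_bounded_borel:
  assumes "C1_partials \<phi> \<phi>1 \<phi>2"
  shows "bounded_borel (square h) \<phi>" "bounded_borel (square h) \<phi>1" "bounded_borel (square h) \<phi>2"
  by (intro bounded_borel_continuous C1_partials_continuous[OF assms] compact_Times compact_Icc)+

lemma C1_partials_path:
  assumes C1: "C1_partials \<phi> \<phi>1 \<phi>2"
    and "(\<alpha> has_real_derivative a) (at x)" "(\<beta> has_real_derivative b) (at x)"
  shows "((\<lambda>x. \<phi> (\<alpha> x, \<beta> x)) has_real_derivative a * \<phi>1 (\<alpha> x, \<beta> x) + b * \<phi>2 (\<alpha> x, \<beta> x)) (at x)"
proof -
  have "((\<lambda>x. (\<alpha> x, \<beta> x)) has_derivative (\<lambda>t. (a * t, b * t))) (at x)"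
    using assms(2,3) by (intro has_derivative_Pair) (simp_all add: has_field_derivative_def)
  moreover have "(\<phi> has_derivative (\<lambda>v. fst v * \<phi>1 (\<alpha> x, \<beta> x) + snd v * \<phi>2 (\<alpha> x, \<beta> x))) (at (\<alpha> x, \<beta> x))"
    using C1 by (simp add: C1_partials_def)
  ultimately have "((\<lambda>x. \<phi> (\<alpha> x, \<beta> x)) has_derivative
      (\<lambda>t. fst (a * t, b * t) * \<phi>1 (\<alpha> x, \<beta> x) + snd (a * t, b * t) * \<phi>2 (\<alpha> x, \<beta> x))) (at x)"
    by (rule has_derivative_compose)
  then show ?thesis
    unfolding has_field_derivative_def by (rule has_derivative_eq_rhs) (auto simp: fun_eq_iff algebra_simps)
qed

lemma C1_partials_axes:
  assumes "C1_partials \<phi> \<phi>1 \<phi>2"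
  shows "((\<lambda>x. \<phi> (x, y)) has_real_derivative \<phi>1 (x, y)) (at x)"
    and "((\<lambda>y. \<phi> (x, y)) has_real_derivative \<phi>2 (x, y)) (at y)"
  using C1_partials_path[OF assms DERIV_ident DERIV_const[of y]]
    C1_partials_path[OF assms DERIV_const[of x] DERIV_ident] by simp_all

lemma smooth_C1_partials:
  assumes "smooth \<phi>"
  shows "C1_partials \<phi> (partial_deriv (1, 0) \<phi>) (partial_deriv (0, 1) \<phi>)"
proof -
  have "Ck (Suc 0) \<phi>" using assms by (simp add: smooth_def)
  then have d: "\<And>q. \<phi> differentiable (at q)"
    and c: "\<And>i. i \<in> Basis \<Longrightarrow> continuous_on UNIV (partial_deriv i \<phi>)"
    unfolding Ck.simps by blast+
  have "(\<phi> has_derivative (\<lambda>v. fst v * partial_deriv (1, 0) \<phi> q + snd v * partial_deriv (0, 1) \<phi> q)) (at q)" for q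
  proof -
    let ?D = "frechet_derivative \<phi> (at q)"
    have D: "(\<phi> has_derivative ?D) (at q)" using d[of q] by (simp add: frechet_derivative_works)
    then interpret linear ?D by (rule has_derivative_linear)
    have "?D = (\<lambda>v. fst v * partial_deriv (1, 0) \<phi> q + snd v * partial_deriv (0, 1) \<phi> q)"
    proof
      fix v :: "real \<times> real"
      have "v = fst v *\<^sub>R (1, 0) + snd v *\<^sub>R (0, 1)" by (simp add: prod_eq_iff)
      then have "?D v = ?D (fst v *\<^sub>R (1, 0) + snd v *\<^sub>R (0, 1))" by simp
      also have "\<dots> = fst v * ?D (1, 0) + snd v * ?D (0, 1)" unfolding add scale by simp
      finally show "?D v = fst v * partial_deriv (1, 0) \<phi> q + snd v * partial_deriv (0, 1) \<phi> q"
        by (simp add: partial_deriv_def)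
    qed
    then show ?thesis using D by simp
  qed
  moreover have "(1, 0) \<in> (Basis :: (real \<times> real) set)" "(0, 1) \<in> (Basis :: (real \<times> real) set)"
    by (simp_all add: Basis_prod_def)
  ultimately show ?thesis using c by (simp add: C1_partials_def)
qed

lemma gradient_prod:
  "gradient \<phi> q = (partial_deriv (1, 0) \<phi> q, partial_deriv (0, 1) \<phi> q)" for q :: "real \<times> real"
  by (simp add: gradient_def Basis_prod_def zero_prod_def)

text \<open>
  For \<open>\<bar>y\<bar> < x\<close> this is the identity; elsewhere it is the reflection in one or both diagonals that leads
  to the closed cone \<open>\<bar>y\<bar> \<le> x\<close>. Writing it through \<open>\<bar>x + y\<bar>\<close> and \<open>\<bar>x - y\<bar>\<close> makes its continuity and its kinks at the
  diagonals evident.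
\<close>

definition triangle_fold :: "real \<times> real \<Rightarrow> real \<times> real" where
  "triangle_fold q = ((\<bar>fst q + snd q\<bar> + \<bar>fst q - snd q\<bar>) / 2, (\<bar>fst q + snd q\<bar> - \<bar>fst q - snd q\<bar>) / 2)"

lemma triangle_fold_triangle:
  assumes "\<bar>y\<bar> < x"
  shows "triangle_fold (x, y) = (x, y)" "triangle_fold (y, x) = (x, y)"
    "triangle_fold (- x, - y) = (x, y)" "triangle_fold (- y, - x) = (x, y)"
  using assms by (auto simp: triangle_fold_def)

lemma continuous_triangle_fold: "continuous_on S triangle_fold"
  unfolding triangle_fold_def by (intro continuous_intros) auto

lemma bounded_borel_fold:
  assumes "continuous_on UNIV \<phi>" 
  shows "bounded_borel (square h) (\<lambda>q. \<phi> (triangle_fold q))"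
  by (intro bounded_borel_continuous continuous_on_compose2[OF assms continuous_triangle_fold]
      compact_Times compact_Icc) auto

lemma has_real_derivative_abs_shift:
  fixes c x :: real
  assumes "x + c \<noteq> 0"
  shows "((\<lambda>x. \<bar>x + c\<bar>) has_real_derivative sgn (x + c)) (at x)"
proof (cases "x + c > 0")
  case True
  have "((\<lambda>x. x + c) has_real_derivative 1) (at x)" by (auto intro!: derivative_eq_intros)
  then have "((\<lambda>x. \<bar>x + c\<bar>) has_real_derivative 1) (at x)"
    by (rule has_field_derivative_transform_within_open[where S = "{-c<..}"]) (use True in auto)
  then show ?thesis using True by simp
next
  case False
  have "((\<lambda>x. - (x + c)) has_real_derivative - 1) (at x)" by (auto intro!: derivative_eq_intros)
  then have "((\<lambda>x. \<bar>x + c\<bar>) has_real_derivative - 1) (at x)"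
    by (rule has_field_derivative_transform_within_open[where S = "{..<-c}"]) (use False assms in auto)
  then show ?thesis using False assms by simp
qed

text \<open>
  The \<open>x\<close>-derivative of \<open>\<phi> (triangle_fold q)\<close> off the diagonals, by the chain rule.
\<close>

definition fold_partial :: "(real \<times> real \<Rightarrow> real) \<Rightarrow> (real \<times> real \<Rightarrow> real) \<Rightarrow> real \<times> real \<Rightarrow> real" where
  "fold_partial \<phi>1 \<phi>2 q =
     \<phi>1 (triangle_fold q) * (sgn (fst q + snd q) + sgn (fst q - snd q)) / 2 +
     \<phi>2 (triangle_fold q) * (sgn (fst q + snd q) - sgn (fst q - snd q)) / 2"

lemma fold_partial_triangle:
  assumes "\<bar>y\<bar> < x"
  shows "fold_partial \<phi>1 \<phi>2 (x, y) = \<phi>1 (x, y)" "fold_partial \<phi>1 \<phi>2 (y, x) = \<phi>2 (x, y)"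
    "fold_partial \<phi>1 \<phi>2 (- x, - y) = - \<phi>1 (x, y)" "fold_partial \<phi>1 \<phi>2 (- y, - x) = - \<phi>2 (x, y)"
  unfolding fold_partial_def triangle_fold_triangle[OF assms] using assms by (auto simp: sgn_if)

lemma fold_derivative:
  assumes C1: "C1_partials \<phi> \<phi>1 \<phi>2" and xy: "y \<noteq> x" "y \<noteq> - x"
  shows "((\<lambda>x. \<phi> (triangle_fold (x, y))) has_real_derivative fold_partial \<phi>1 \<phi>2 (x, y)) (at x)"
proof -
  have 1: "((\<lambda>x. \<bar>x + y\<bar>) has_real_derivative sgn (x + y)) (at x)"
    using xy by (intro has_real_derivative_abs_shift) auto
  have 2: "((\<lambda>x. \<bar>x - y\<bar>) has_real_derivative sgn (x - y)) (at x)"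
    using has_real_derivative_abs_shift[of x "- y"] xy by simp
  have "((\<lambda>x. (\<bar>x + y\<bar> + \<bar>x - y\<bar>) / 2) has_real_derivative (sgn (x + y) + sgn (x - y)) / 2) (at x)"
       "((\<lambda>x. (\<bar>x + y\<bar> - \<bar>x - y\<bar>) / 2) has_real_derivative (sgn (x + y) - sgn (x - y)) / 2) (at x)"
    by (intro DERIV_cdivide DERIV_add DERIV_diff 1 2)+
  from C1_partials_path[OF C1 this] show ?thesis
    by (simp add: triangle_fold_def fold_partial_def mult.commute)
qed

lemma bounded_borel_fold_partial:
  assumes "continuous_on UNIV \<phi>1" "continuous_on UNIV \<phi>2"
  shows "bounded_borel (square h) (fold_partial \<phi>1 \<phi>2)"
proof -
  have "sgn \<in> borel_measurable (borel :: real measure)" by (rule borel_measurable_sgn)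
  then have sgn: "bounded_borel (square h) (\<lambda>q. sgn (l q))" if "continuous_on UNIV l" for l :: "real \<times> real \<Rightarrow> real"
    by (intro bounded_borelI[where B = 1] measurable_compose[OF borel_measurable_continuous_onI[OF that]])
       (simp_all add: abs_sgn_eq)
  show ?thesis
    unfolding fold_partial_def
    by (intro bounded_borel_intros bounded_borel_fold sgn assms continuous_intros)
qed

lemma integral_fold_square:
  fixes \<phi> :: "real \<times> real \<Rightarrow> real"
  assumes "continuous_on UNIV \<phi>"
  shows "(\<integral>q. (\<phi> (triangle_fold q))\<^sup>2 \<partial>seg2 h) = 4 * (\<integral>q. (\<phi> q)\<^sup>2 \<partial>lebesgue_on (right_triangle h))"
proof -
  have b: "bounded_borel (square h) (\<lambda>q. (\<phi> q)\<^sup>2)"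
    by (intro bounded_borel_power2 bounded_borel_continuous assms compact_Times compact_Icc)
  have "(\<integral>q. (\<phi> (triangle_fold q))\<^sup>2 \<partial>seg2 h) = (\<integral>q. 4 * (indicator (right_triangle h) q * (\<phi> q)\<^sup>2) \<partial>seg2 h)"
    unfolding integral_square_eq_triangle[OF bounded_borel_power2[OF bounded_borel_fold[OF assms]]]
    by (intro Bochner_Integration.integral_cong refl)
       (auto simp: indicator_def right_triangle_def triangle_fold_triangle)
  then show ?thesis by (simp add: integrable_triangle(2)[OF b])
qed

text \<open>
  On two of the four copies of the triangle the \<open>x\<close>-derivative of the folded function is
  \<open>\<plusminus> \<phi>1\<close>, on the two others \<open>\<plusminus> \<phi>2\<close>.
\<close>

lemma integral_fold_partial_square:
  assumes c: "continuous_on UNIV \<phi>1" "continuous_on UNIV \<phi>2"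
  shows "(\<integral>q. (fold_partial \<phi>1 \<phi>2 q)\<^sup>2 \<partial>seg2 h)
    = 2 * (\<integral>q. (\<phi>1 q)\<^sup>2 + (\<phi>2 q)\<^sup>2 \<partial>lebesgue_on (right_triangle h))"
proof -
  have b: "bounded_borel (square h) (\<lambda>q. (\<phi>1 q)\<^sup>2 + (\<phi>2 q)\<^sup>2)"
    by (intro bounded_borel_intros bounded_borel_continuous c compact_Times compact_Icc)
  have "(\<integral>q. (fold_partial \<phi>1 \<phi>2 q)\<^sup>2 \<partial>seg2 h)
      = (\<integral>q. 2 * (indicator (right_triangle h) q * ((\<phi>1 q)\<^sup>2 + (\<phi>2 q)\<^sup>2)) \<partial>seg2 h)"
    unfolding integral_square_eq_triangle[OF bounded_borel_power2[OF bounded_borel_fold_partial[OF c]]]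
    by (intro Bochner_Integration.integral_cong refl)
       (auto simp: indicator_def right_triangle_def fold_partial_triangle)
  then show ?thesis by (simp add: integrable_triangle(2)[OF b])
qed

lemma poincare_triangle_C1:
  assumes h: "0 < h" and z: "0 < z" "sqrt 2 * z < pi" "z * cot z + 1 = 0"
    and C1: "C1_partials \<phi> \<phi>1 \<phi>2" and mean: "(\<integral>t. \<phi> (h, t) \<partial>seg h) = 0"
  shows "z\<^sup>2 * (\<integral>q. (\<phi> q)\<^sup>2 \<partial>lebesgue_on (right_triangle h))
    \<le> h\<^sup>2 * (\<integral>q. (\<phi>1 q)\<^sup>2 + (\<phi>2 q)\<^sup>2 \<partial>lebesgue_on (right_triangle h))"
proof -
  note c = C1_partials_continuous[OF C1]
  have "z\<^sup>2 * (\<integral>q. (\<phi> (triangle_fold q))\<^sup>2 \<partial>seg2 h) \<le> 2 * h\<^sup>2 * (\<integral>q. (fold_partial \<phi>1 \<phi>2 q)\<^sup>2 \<partial>seg2 h)"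
  proof (rule poincare_square[OF h z])
    show "bounded_borel (square h) (\<lambda>q. \<phi> (triangle_fold q))" by (rule bounded_borel_fold[OF c(1)])
    show "bounded_borel (square h) (fold_partial \<phi>1 \<phi>2)" by (rule bounded_borel_fold_partial[OF c(2,3)])
    show "continuous_on {-h..h} (\<lambda>x. \<phi> (triangle_fold (x, y)))" for y
      by (rule continuous_on_compose2[OF c(1)], rule continuous_on_compose2[OF continuous_triangle_fold[of UNIV]])
         (auto intro!: continuous_intros)
    show "((\<lambda>x. \<phi> (triangle_fold (x, y))) has_real_derivative fold_partial \<phi>1 \<phi>2 (x, y)) (at x)"
      if "y \<noteq> x" "y \<noteq> - x" for x y by (rule fold_derivative[OF C1 that])
    show "\<phi> (triangle_fold (y, x)) = \<phi> (triangle_fold (x, y))" for x y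
      by (simp add: triangle_fold_def add.commute abs_minus_commute)
    show "\<phi> (triangle_fold (- x, - y)) = \<phi> (triangle_fold (x, y))" for x y
    proof -
      have "\<bar>- x - y\<bar> = \<bar>x + y\<bar>" "\<bar>- x + y\<bar> = \<bar>x - y\<bar>" by linarith+
      then show ?thesis by (simp add: triangle_fold_def)
    qed
    have "triangle_fold (h, y) = (h, y)" if "y \<in> {-h..h}" for y using that by (auto simp: triangle_fold_def)
    then have "(\<integral>y. \<phi> (triangle_fold (h, y)) \<partial>seg h) = (\<integral>y. \<phi> (h, y) \<partial>seg h)"
      by (intro Bochner_Integration.integral_cong) auto
    then show "(\<integral>y. \<phi> (triangle_fold (h, y)) \<partial>seg h) = 0" using mean by simp
  qed
  then show ?thesis unfolding integral_fold_square[OF c(1)] integral_fold_partial_square[OF c(2,3)] by simp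
qed

section \<open>Hausdorff measure on the hypotenuse\<close>

text \<open>
  Finite additivity over shells \<open>{a k \<le> d \<le> b k}\<close> which shrink towards \<open>d = 0\<close> with gaps between them.
\<close>

lemma separated_family_sum_le:
  fixes \<mu> :: "'a set \<Rightarrow> ennreal" and d :: "'a \<Rightarrow> real" and R :: "nat \<Rightarrow> 'a set"
  assumes empty: "\<mu> {} = 0" and mono: "\<And>A B. A \<subseteq> B \<Longrightarrow> \<mu> A \<le> \<mu> B"
    and sep: "\<And>A B s t. s < t \<Longrightarrow> (\<And>x. x \<in> A \<Longrightarrow> t \<le> d x) \<Longrightarrow> (\<And>x. x \<in> B \<Longrightarrow> d x \<le> s)
                 \<Longrightarrow> \<mu> A + \<mu> B \<le> \<mu> (A \<union> B)"
    and R: "\<And>k x. x \<in> R k \<Longrightarrow> a k \<le> d x \<and> d x \<le> b k" "\<And>k. R k \<subseteq> X"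
    and ab: "\<And>j k. j < k \<Longrightarrow> b k < a j" "\<And>j k. j \<le> k \<Longrightarrow> a k \<le> a j"
  shows "(\<Sum>k<n. \<mu> (R k)) \<le> \<mu> X"
proof -
  have "(\<Sum>k<n. \<mu> (R k)) \<le> \<mu> (\<Union>k<n. R k)"
  proof (induction n)
    case (Suc n)
    have "\<mu> (\<Union>k<n. R k) + \<mu> (R n) \<le> \<mu> ((\<Union>k<n. R k) \<union> R n)"
    proof (cases n)
      case 0
      then show ?thesis by (simp add: empty)
    next
      case (Suc m)
      show ?thesis
      proof (rule sep[of "b n" "a m"])
        show "b n < a m" using ab(1) Suc by simp
        show "a m \<le> d x" if "x \<in> (\<Union>k<n. R k)" for x
        proof -
          obtain k where "k < n" "x \<in> R k" using \<open>x \<in> (\<Union>k<n. R k)\<close> by blast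
          then show ?thesis using R(1)[of x k] ab(2)[of k m] Suc by simp
        qed
      qed (use R in blast)
    qed
    moreover have "(\<Union>k<n. R k) \<union> R n = (\<Union>k<Suc n. R k)" by (auto simp: less_Suc_eq)
    ultimately have "\<mu> (\<Union>k<n. R k) + \<mu> (R n) \<le> \<mu> (\<Union>k<Suc n. R k)"
      by (simp only:)
    with add_right_mono[OF Suc.IH, of "\<mu> (R n)"] show ?case
      unfolding sum.lessThan_Suc by (rule order_trans)
  qed (simp add: empty)
  also have "\<dots> \<le> \<mu> X" using R(2) by (intro mono) blast
  finally show ?thesis .
qed

lemma sum_even_odd: "(\<Sum>k<2*n. f k) = (\<Sum>k<n. f (2*k)) + (\<Sum>k<n. f (2*k+1))"
  for f :: "nat \<Rightarrow> ennreal"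
  by (induction n) (simp_all add: add_ac)

text \<open>
  Caratheodory's criterion. Off \<open>C\<close>, a set \<open>X\<close> is exhausted by the parts \<open>A n\<close> at distance at least
  \<open>r n\<close> from \<open>C\<close>, for which additivity with \<open>X \<inter> C\<close> is the hypothesis. It remains to control the
  shells \<open>R k\<close> between consecutive distances: shells with indices of the same parity are separated from each other, so
  the measures of all shells sum to at most \<open>2 \<mu> X\<close>, and their tails are negligible.
\<close>

lemma metric_outer_measure_closed:
  fixes \<mu> :: "'a::metric_space set \<Rightarrow> ennreal"
  assumes om: "outer_measure_space (Pow UNIV) \<mu>"
    and sep: "\<And>A B e. 0 < e \<Longrightarrow> (\<And>x y. x \<in> A \<Longrightarrow> y \<in> B \<Longrightarrow> e \<le> dist x y) \<Longrightarrow> \<mu> A + \<mu> B \<le> \<mu> (A \<union> B)"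
    and C: "closed C"
  shows "C \<in> lambda_system UNIV (Pow UNIV) \<mu>"
proof -
  interpret sigma_algebra "UNIV :: 'a set" "Pow UNIV" by (rule sigma_algebra_Pow)
  have empty: "\<mu> {} = 0" and mono: "\<And>A B. A \<subseteq> B \<Longrightarrow> \<mu> A \<le> \<mu> B"
    using om by (auto simp: outer_measure_space_def positive_def increasing_def)
  have subadd: "\<mu> (\<Union>i. A i) \<le> (\<Sum>i. \<mu> (A i))" for A :: "nat \<Rightarrow> 'a set"
  proof -
    have "\<mu> (\<Union>i. A i) \<le> (\<Sum>i. \<mu> (disjointed A i))"
      using om disjoint_family_disjointed[of A]
      by (auto simp: outer_measure_space_def countably_subadditive_def UN_disjointed_eq[of A, symmetric])
    also have "\<dots> \<le> (\<Sum>i. \<mu> (A i))"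
      by (intro suminf_le allI mono disjointed_subset summableI)
    finally show ?thesis .
  qed
  have subadd2: "\<mu> (A \<union> B) \<le> \<mu> A + \<mu> B" for A B
  proof -
    have "\<mu> (A \<union> B) \<le> (\<Sum>i. \<mu> (binaryset A B i))"
      using subadd[of "binaryset A B"] by (simp add: UN_binaryset_eq)
    also have "\<dots> = \<mu> A + \<mu> B" by (intro suminf_binaryset_eq empty)
    finally show ?thesis .
  qed
  have key: "\<mu> (X \<inter> C) + \<mu> (X - C) \<le> \<mu> X" for X
  proof (cases "C = {} \<or> \<mu> X = \<infinity>")
    case True
    then show ?thesis using empty by auto
  next
    case False
    define d where "d x = infdist x C" for x
    have d_pos: "0 < d x" if "x \<notin> C" for x
      using that False C in_closed_iff_infdist_zero[of C x] infdist_nonneg[of x C] by (auto simp: d_def less_le)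
    have d_lip: "d x \<le> d y + dist x y" for x y
      unfolding d_def by (rule infdist_triangle)
    have sep_d: "\<mu> A + \<mu> B \<le> \<mu> (A \<union> B)"
      if "s < t" "\<And>x. x \<in> A \<Longrightarrow> t \<le> d x" "\<And>x. x \<in> B \<Longrightarrow> d x \<le> s" for A B s t
    proof (rule sep[of "t - s"])
      fix x y assume "x \<in> A" "y \<in> B"
      then show "t - s \<le> dist x y" using that(2)[of x] that(3)[of y] d_lip[of x y] by linarith
    qed (use that in simp)
    define r where "r n = 1 / (real n + 1)" for n
    have r_dec: "r n < r m" if "m < n" for m n
      using that by (simp add: r_def frac_less2)
    have r_pos: "0 < r n" for n by (simp add: r_def)
    define Y where "Y = X - C"
    define A where "A n = {x \<in> Y. r n \<le> d x}" for n
    define R where "R n = {x \<in> Y. r (Suc n) \<le> d x \<and> d x \<le> r n}" for n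
    have fin: "\<mu> X < \<infinity>" using False by (simp add: less_top)
    have "(\<Sum>k<n. \<mu> (R (2*k))) \<le> \<mu> X" for n
    proof (rule separated_family_sum_le[where d = d and a = "\<lambda>k. r (2*k+1)" and b = "\<lambda>k. r (2*k)"])
      show "r (2*k) < r (2*j+1)" if "j < k" for j k using that by (intro r_dec) auto
      show "r (2*k+1) \<le> r (2*j+1)" if "j \<le> k" for j k
        using that r_dec[of "2*j+1" "2*k+1"] by (cases "j = k") auto
    qed (use empty mono sep_d in \<open>auto simp: R_def Y_def\<close>)
    moreover have "(\<Sum>k<n. \<mu> (R (2*k+1))) \<le> \<mu> X" for n
    proof (rule separated_family_sum_le[where d = d and a = "\<lambda>k. r (2*k+2)" and b = "\<lambda>k. r (2*k+1)"])
      show "r (2*k+1) < r (2*j+2)" if "j < k" for j k using that by (intro r_dec) auto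
      show "r (2*k+2) \<le> r (2*j+2)" if "j \<le> k" for j k
        using that r_dec[of "2*j+2" "2*k+2"] by (cases "j = k") auto
    qed (use empty mono sep_d in \<open>auto simp: R_def Y_def\<close>)
    ultimately have two: "(\<Sum>k<2*n. \<mu> (R k)) \<le> \<mu> X + \<mu> X" for n
      unfolding sum_even_odd by (intro add_mono)
    have "(\<Sum>k<n. \<mu> (R k)) \<le> \<mu> X + \<mu> X" for n
      by (rule order_trans[OF _ two[of n]]) (intro sum_mono2, auto)
    then have "(\<Sum>k. \<mu> (R k)) \<le> \<mu> X + \<mu> X"
      by (intro suminf_le_const) auto
    then have S_fin: "(\<Sum>k. \<mu> (R k)) \<noteq> \<infinity>"
      using fin by (auto simp: top_unique)
    have Y_le: "\<mu> Y \<le> \<mu> (A n) + (\<Sum>k. if n \<le> k then \<mu> (R k) else 0)" for n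
    proof -
      have "Y \<subseteq> A n \<union> (\<Union>k. if n \<le> k then R k else {})"
      proof
        fix x assume x: "x \<in> Y"
        show "x \<in> A n \<union> (\<Union>k. if n \<le> k then R k else {})"
        proof (cases "r n \<le> d x")
          case False
          have "\<exists>m. r m \<le> d x"
          proof -
            obtain m where "inverse (real (Suc m)) < d x"
              using d_pos[of x] x reals_Archimedean[of "d x"] by (auto simp: Y_def)
            then show ?thesis by (intro exI[of _ m]) (simp add: r_def inverse_eq_divide add.commute)
          qed
          then obtain m where m: "r m \<le> d x" "\<And>j. j < m \<Longrightarrow> \<not> r j \<le> d x"
            using exists_least_iff[of "\<lambda>m. r m \<le> d x"] by blast
          have "n < m"
          proof (rule ccontr)
            assume "\<not> n < m"
            then have "r n \<le> r m" using r_dec[of m n] by (cases "m = n") auto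
            then show False using m(1) False by simp
          qed
          then obtain j where j: "m = Suc j" "n \<le> j" by (cases m) auto
          then have "x \<in> R j" using m(1) m(2)[of j] x by (auto simp: R_def)
          then show ?thesis using j(2) by auto
        qed (use x in \<open>auto simp: A_def\<close>)
      qed
      then have "\<mu> Y \<le> \<mu> (A n) + \<mu> (\<Union>k. if n \<le> k then R k else {})"
        using order_trans[OF mono subadd2] by blast
      also have "\<mu> (\<Union>k. if n \<le> k then R k else {}) \<le> (\<Sum>k. \<mu> (if n \<le> k then R k else {}))"
        by (rule subadd)
      also have "(\<Sum>k. \<mu> (if n \<le> k then R k else {})) = (\<Sum>k. if n \<le> k then \<mu> (R k) else 0)"
        by (intro arg_cong[where f = suminf]) (auto simp: empty)
      finally show ?thesis by (simp add: add_left_mono)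
    qed
    \<comment> \<open>Adding the total measure of the shells to both sides avoids a limit over the tails; it is
      finite and cancels at the end.\<close>
    have "(\<Sum>k. \<mu> (R k)) + (\<mu> (X \<inter> C) + \<mu> Y) \<le> \<mu> X + (\<Sum>k. \<mu> (R k))"
    proof (rule ennreal_suminf_bound_add)
      fix n
      have "(\<Sum>k<n. \<mu> (R k)) = (\<Sum>k. if k < n then \<mu> (R k) else 0)"
        by (subst suminf_finite[of "{..<n}"]) auto
      then have "(\<Sum>k<n. \<mu> (R k)) + (\<Sum>k. if n \<le> k then \<mu> (R k) else 0)
          = (\<Sum>k. (if k < n then \<mu> (R k) else 0) + (if n \<le> k then \<mu> (R k) else 0))"
        by (simp add: suminf_add)
      also have "\<dots> = (\<Sum>k. \<mu> (R k))" by (intro arg_cong[where f = suminf]) auto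
      finally have split: "(\<Sum>k<n. \<mu> (R k)) + (\<Sum>k. if n \<le> k then \<mu> (R k) else 0) = (\<Sum>k. \<mu> (R k))" .
      have "\<mu> (A n) + \<mu> (X \<inter> C) \<le> \<mu> (A n \<union> (X \<inter> C))"
        using r_pos[of n] by (intro sep_d[of 0 "r n"]) (auto simp: A_def d_def)
      also have "\<dots> \<le> \<mu> X" by (intro mono) (auto simp: A_def Y_def)
      finally have AX: "\<mu> (A n) + \<mu> (X \<inter> C) \<le> \<mu> X" .
      have "(\<Sum>k<n. \<mu> (R k)) + (\<mu> (X \<inter> C) + \<mu> Y)
          \<le> (\<Sum>k<n. \<mu> (R k)) + (\<mu> (X \<inter> C) + (\<mu> (A n) + (\<Sum>k. if n \<le> k then \<mu> (R k) else 0)))"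
        by (intro add_left_mono Y_le)
      also have "\<dots> = (\<mu> (A n) + \<mu> (X \<inter> C)) + (\<Sum>k. \<mu> (R k))"
        unfolding split[symmetric] by (simp add: add_ac)
      also have "\<dots> \<le> \<mu> X + (\<Sum>k. \<mu> (R k))" by (intro add_right_mono AX)
      finally show "(\<Sum>k<n. \<mu> (R k)) + (\<mu> (X \<inter> C) + \<mu> Y) \<le> \<mu> X + (\<Sum>k. \<mu> (R k))" .
    qed
    then have "(\<Sum>k. \<mu> (R k)) + (\<mu> (X \<inter> C) + \<mu> Y) \<le> (\<Sum>k. \<mu> (R k)) + \<mu> X"
      by (simp only: add.commute[of "\<mu> X"])
    then show ?thesis using S_fin unfolding ennreal_add_left_cancel_le Y_def by simp
  qed
  have "\<mu> (X \<inter> C) + \<mu> (X - C) = \<mu> X" for X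
    using key[of X] subadd2[of "X \<inter> C" "X - C"] by (simp add: Int_Diff_Un antisym)
  then show ?thesis unfolding lambda_system_eq by blast
qed

lemma metric_outer_measure_borel:
  fixes \<mu> :: "'a::metric_space set \<Rightarrow> ennreal"
  assumes om: "outer_measure_space (Pow UNIV) \<mu>"
    and sep: "\<And>A B e. 0 < e \<Longrightarrow> (\<And>x y. x \<in> A \<Longrightarrow> y \<in> B \<Longrightarrow> e \<le> dist x y) \<Longrightarrow> \<mu> A + \<mu> B \<le> \<mu> (A \<union> B)"
    and B: "B \<in> sets borel"
  shows "emeasure (measure_of UNIV (sets borel) \<mu>) B = \<mu> B"
proof (rule emeasure_measure_of_sigma)
  interpret sigma_algebra "UNIV :: 'a set" "Pow UNIV" by (rule sigma_algebra_Pow)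
  let ?L = "lambda_system UNIV (Pow UNIV) \<mu>"
  have ms: "measure_space UNIV ?L \<mu>" by (rule caratheodory_lemma[OF om])
  then interpret L: sigma_algebra UNIV ?L by (simp add: measure_space_def)
  have "sets borel = sigma_sets UNIV (Collect closed :: 'a set set)"
    by (simp add: borel_eq_closed)
  also have "\<dots> \<subseteq> ?L"
    using metric_outer_measure_closed[OF om sep] by (intro L.sigma_sets_subset) auto
  finally have sub: "sets borel \<subseteq> ?L" .
  show "sigma_algebra UNIV (sets borel :: 'a set set)"
    using sets.sigma_algebra_axioms[of "borel :: 'a measure"] by simp
  show "positive (sets borel) \<mu>" "countably_additive (sets borel) \<mu>"
    using ms sub by (auto simp: measure_space_def positive_def countably_additive_def)
qed (rule B)

lemma hausdorff_pre_mono: "A \<subseteq> B \<Longrightarrow> hausdorff_pre s \<delta> A \<le> hausdorff_pre s \<delta> B"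
  unfolding hausdorff_pre_def by (rule INF_superset_mono) auto

lemma hausdorff_pre_antimono: "\<delta> \<le> \<epsilon> \<Longrightarrow> hausdorff_pre s \<epsilon> A \<le> hausdorff_pre s \<delta> A"
  unfolding hausdorff_pre_def by (rule INF_superset_mono) (auto intro: order_trans)

lemma hausdorff_pre_le:
  assumes "A \<subseteq> (\<Union>i. C i)" "\<And>i. bounded (C i)" "\<And>i. diameter (C i) \<le> \<delta>"
  shows "hausdorff_pre s \<delta> A \<le> (\<Sum>i. hausdorff_weight s (C i))"
  unfolding hausdorff_pre_def using assms by (intro INF_lower) auto

lemma hausdorff_pre_subadditive:
  fixes A :: "nat \<Rightarrow> 'a::euclidean_space set"
  shows "hausdorff_pre s \<delta> (\<Union>i. A i) \<le> (\<Sum>i. hausdorff_pre s \<delta> (A i))"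
proof (rule ennreal_le_epsilon)
  fix e :: real assume e: "0 < e" and fin: "(\<Sum>n. hausdorff_pre s \<delta> (A n)) < top"
  have "\<exists>C. A n \<subseteq> (\<Union>i. C i) \<and> (\<forall>i. bounded (C i) \<and> diameter (C i) \<le> \<delta>) \<and>
      (\<Sum>i. hausdorff_weight s (C i)) \<le> hausdorff_pre s \<delta> (A n) + e * (1/2)^Suc n" for n
  proof -
    have "hausdorff_pre s \<delta> (A n) < hausdorff_pre s \<delta> (A n) + e * (1/2)^Suc n"
      using fin e by (auto simp add: less_top dest!: ennreal_suminf_lessD)
    then show ?thesis
      by (subst (asm) hausdorff_pre_def) (auto simp: INF_less_iff intro: less_imp_le)
  qed
  then obtain B where B: "\<And>n. A n \<subseteq> (\<Union>i. B n i)" "\<And>n i. bounded (B n i)" "\<And>n i. diameter (B n i) \<le> \<delta>"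
      "\<And>n. (\<Sum>i. hausdorff_weight s (B n i)) \<le> hausdorff_pre s \<delta> (A n) + e * (1/2)^Suc n"
    by metis
  define C where "C = case_prod B o prod_decode"
  have "(\<Union>i. A i) \<subseteq> (\<Union>i. C i)"
    using B(1) by (auto simp add: C_def subset_eq) (metis prod.case prod_encode_inverse)
  then have "hausdorff_pre s \<delta> (\<Union>i. A i) \<le> (\<Sum>i. hausdorff_weight s (C i))"
    by (rule hausdorff_pre_le) (auto simp: C_def split_beta B)
  also have "\<dots> = (\<Sum>n. \<Sum>i. hausdorff_weight s (B n i))"
    using suminf_ennreal_2dimen[of "\<lambda>n. \<Sum>i. hausdorff_weight s (B n i)" "\<lambda>p. hausdorff_weight s (case_prod B p)"]
    by (simp add: C_def)
  also have "\<dots> \<le> (\<Sum>n. hausdorff_pre s \<delta> (A n) + e * (1/2) ^ Suc n)"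
    by (intro suminf_le allI B(4)) auto
  also have "\<dots> = (\<Sum>n. hausdorff_pre s \<delta> (A n)) + (\<Sum>n. ennreal e * ennreal ((1/2) ^ Suc n))"
    using \<open>0 < e\<close> by (subst suminf_add[symmetric])
                     (auto simp del: ennreal_suminf_cmult simp add: ennreal_mult[symmetric])
  also have "\<dots> = (\<Sum>n. hausdorff_pre s \<delta> (A n)) + e"
    unfolding ennreal_suminf_cmult
    by (subst suminf_ennreal_eq[OF zero_le_power power_half_series]) auto
  finally show "hausdorff_pre s \<delta> (\<Union>i. A i) \<le> (\<Sum>n. hausdorff_pre s \<delta> (A n)) + e" .
qed

lemma hausdorff_outer_measure_space:
  "outer_measure_space (Pow UNIV) (hausdorff_outer s :: 'a::euclidean_space set \<Rightarrow> ennreal)"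
  unfolding outer_measure_space_def
proof (intro conjI)
  have "hausdorff_pre s \<delta> ({} :: 'a set) \<le> 0" if "0 < \<delta>" for \<delta>
    using hausdorff_pre_le[of "{} :: 'a set" "\<lambda>_. {}" \<delta> s] that by (simp add: hausdorff_weight_def)
  then show "positive (Pow UNIV) (hausdorff_outer s :: 'a set \<Rightarrow> ennreal)"
    by (auto simp: positive_def hausdorff_outer_def intro!: antisym SUP_least)
  show "increasing (Pow UNIV) (hausdorff_outer s :: 'a set \<Rightarrow> ennreal)"
    by (auto simp: increasing_def hausdorff_outer_def intro!: SUP_mono' hausdorff_pre_mono)
  show "countably_subadditive (Pow UNIV) (hausdorff_outer s :: 'a set \<Rightarrow> ennreal)"
    unfolding countably_subadditive_def
  proof (intro allI impI)
    fix A :: "nat \<Rightarrow> 'a set"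
    show "hausdorff_outer s (\<Union>i. A i) \<le> (\<Sum>i. hausdorff_outer s (A i))"
      unfolding hausdorff_outer_def[of s "\<Union>i. A i"]
    proof (rule SUP_least)
      fix \<delta> :: real assume "\<delta> \<in> {0<..}"
      then have "(\<Sum>i. hausdorff_pre s \<delta> (A i)) \<le> (\<Sum>i. hausdorff_outer s (A i))"
        unfolding hausdorff_outer_def by (intro suminf_le allI SUP_upper) auto
      then show "hausdorff_pre s \<delta> (\<Union>i. A i) \<le> (\<Sum>i. hausdorff_outer s (A i))"
        using hausdorff_pre_subadditive order_trans by blast
    qed
  qed
qed

text \<open>
  A set of diameter less than \<open>e\<close> cannot meet both \<open>A\<close> and \<open>B\<close>, so a fine cover of the union splits into
  a cover of \<open>A\<close> and one of \<open>B\<close>.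
\<close>

lemma hausdorff_outer_separated:
  fixes A B :: "'a::euclidean_space set"
  assumes e: "0 < e" and sep: "\<And>x y. x \<in> A \<Longrightarrow> y \<in> B \<Longrightarrow> e \<le> dist x y"
  shows "hausdorff_outer s A + hausdorff_outer s B \<le> hausdorff_outer s (A \<union> B)"
proof -
  have pre: "hausdorff_pre s \<delta> A + hausdorff_pre s \<delta> B \<le> hausdorff_pre s \<delta> (A \<union> B)" if \<delta>: "0 < \<delta>" "\<delta> < e" for \<delta>
    unfolding hausdorff_pre_def[of s \<delta> "A \<union> B"]
  proof (rule INF_greatest, clarify)
    fix C :: "nat \<Rightarrow> 'a set"
    assume C: "A \<union> B \<subseteq> (\<Union>i. C i)" "\<forall>i. bounded (C i) \<and> diameter (C i) \<le> \<delta>"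
    define CA where "CA i = (if C i \<inter> A = {} then {} else C i)" for i
    define CB where "CB i = (if C i \<inter> B = {} then {} else C i)" for i
    have excl: "C i \<inter> A = {} \<or> C i \<inter> B = {}" for i
    proof (rule ccontr)
      assume "\<not> (C i \<inter> A = {} \<or> C i \<inter> B = {})"
      then obtain x y where xy: "x \<in> C i" "x \<in> A" "y \<in> C i" "y \<in> B" by blast
      then have "e \<le> diameter (C i)"
        using sep[of x y] diameter_bounded_bound[of "C i" x y] C(2) by (meson order_trans)
      then show False using C(2) \<delta> by (meson not_le order_trans)
    qed
    have "hausdorff_pre s \<delta> A \<le> (\<Sum>i. hausdorff_weight s (CA i))"
    proof (rule hausdorff_pre_le)
      show "A \<subseteq> (\<Union>i. CA i)"
      proof
        fix x assume x: "x \<in> A"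
        then obtain i where "x \<in> C i" using C(1) by blast
        then have "x \<in> CA i" using x by (auto simp: CA_def)
        then show "x \<in> (\<Union>i. CA i)" by blast
      qed
    qed (use C(2) \<delta> in \<open>auto simp: CA_def\<close>)
    moreover have "hausdorff_pre s \<delta> B \<le> (\<Sum>i. hausdorff_weight s (CB i))"
    proof (rule hausdorff_pre_le)
      show "B \<subseteq> (\<Union>i. CB i)"
      proof
        fix x assume x: "x \<in> B"
        then obtain i where "x \<in> C i" using C(1) by blast
        then have "x \<in> CB i" using x by (auto simp: CB_def)
        then show "x \<in> (\<Union>i. CB i)" by blast
      qed
    qed (use C(2) \<delta> in \<open>auto simp: CB_def\<close>)
    ultimately have "hausdorff_pre s \<delta> A + hausdorff_pre s \<delta> B
        \<le> (\<Sum>i. hausdorff_weight s (CA i) + hausdorff_weight s (CB i))"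
      by (subst suminf_add[symmetric]) (auto intro: add_mono)
    also have "\<dots> \<le> (\<Sum>i. hausdorff_weight s (C i))"
      by (intro suminf_le allI) (use excl in \<open>auto simp: CA_def CB_def hausdorff_weight_def\<close>)
    finally show "hausdorff_pre s \<delta> A + hausdorff_pre s \<delta> B \<le> (\<Sum>i. hausdorff_weight s (C i))" .
  qed
  have "hausdorff_outer s A + hausdorff_outer s B = (SUP \<delta>\<in>{0<..}. hausdorff_pre s \<delta> A + hausdorff_pre s \<delta> B)"
    unfolding hausdorff_outer_def
  proof (rule SUP_add_directed_ennreal[symmetric])
    fix i j :: real assume "i \<in> {0<..}" "j \<in> {0<..}"
    then show "\<exists>k\<in>{0<..}. hausdorff_pre s i A + hausdorff_pre s j B \<le> hausdorff_pre s k A + hausdorff_pre s k B"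
      by (intro bexI[of _ "min i j"] add_mono hausdorff_pre_antimono) auto
  qed
  also have "\<dots> \<le> hausdorff_outer s (A \<union> B)"
  proof (rule SUP_least)
    fix \<delta> :: real assume \<delta>: "\<delta> \<in> {0<..}"
    define \<eta> where "\<eta> = min \<delta> (e / 2)"
    have \<eta>: "0 < \<eta>" "\<eta> < e" "\<eta> \<le> \<delta>" using \<delta> e by (auto simp: \<eta>_def min_def)
    have "hausdorff_pre s \<delta> A + hausdorff_pre s \<delta> B \<le> hausdorff_pre s \<eta> A + hausdorff_pre s \<eta> B"
      by (intro add_mono hausdorff_pre_antimono \<eta>)
    also have "\<dots> \<le> hausdorff_pre s \<eta> (A \<union> B)" by (rule pre[OF \<eta>(1,2)])
    also have "\<dots> \<le> hausdorff_outer s (A \<union> B)"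
      unfolding hausdorff_outer_def using \<eta> by (intro SUP_upper) auto
    finally show "hausdorff_pre s \<delta> A + hausdorff_pre s \<delta> B \<le> hausdorff_outer s (A \<union> B)" .
  qed
  finally show ?thesis .
qed

lemma sets_hausdorff_measure: "sets (hausdorff_measure s :: 'a::euclidean_space measure) = sets borel"
  by (simp add: hausdorff_measure_def sets.sigma_sets_eq[of borel, simplified])

lemma space_hausdorff_measure: "space (hausdorff_measure s) = UNIV"
  by (simp add: hausdorff_measure_def)

lemma emeasure_hausdorff_measure:
  "B \<in> sets borel \<Longrightarrow> emeasure (hausdorff_measure s) B = hausdorff_outer s B"
  unfolding hausdorff_measure_def
  by (rule metric_outer_measure_borel[OF hausdorff_outer_measure_space hausdorff_outer_separated])

text \<open>
  Equal subdivision gives the upper bound. For the lower bound, the second coordinates of a covering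
  set lie in an interval no longer than its diameter, and Lebesgue measure is countably subadditive.
\<close>

lemma hausdorff_outer_vertical_interval:
  fixes h l u :: real
  assumes lu: "l \<le> u"
  shows "hausdorff_outer 1 ({h} \<times> {l<..<u}) = ennreal (u - l)"
proof (rule antisym)
  show "hausdorff_outer 1 ({h} \<times> {l<..<u}) \<le> ennreal (u - l)"
    unfolding hausdorff_outer_def
  proof (rule SUP_least)
    fix \<delta> :: real assume \<delta>: "\<delta> \<in> {0<..}"
    obtain n where n: "(u - l) / \<delta> < real n" using reals_Archimedean2 by blast
    have n0: "0 < real n" using n lu \<delta> by (smt (verit) divide_nonneg_pos greaterThan_iff)
    define w where "w = (u - l) / real n"
    have w: "0 \<le> w" "w \<le> \<delta>" using n n0 lu \<delta> by (auto simp: w_def field_simps)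
    define C where "C i = (if i < n then {h} \<times> {l + real i * w .. l + real (Suc i) * w} else {})" for i
    have diam: "diameter (C i) \<le> w" for i
      by (rule diameter_le) (use w in \<open>auto simp: C_def algebra_simps norm_Pair split: if_splits\<close>)
    have "hausdorff_pre 1 \<delta> ({h} \<times> {l<..<u}) \<le> (\<Sum>i. hausdorff_weight 1 (C i))"
    proof (rule hausdorff_pre_le)
      show "{h} \<times> {l<..<u} \<subseteq> (\<Union>i. C i)"
      proof clarify
        fix t assume t: "t \<in> {l<..<u}"
        then have w0: "0 < w" using n0 by (simp add: w_def)
        define i where "i = nat \<lfloor>(t - l) / w\<rfloor>"
        have fl: "real i \<le> (t - l) / w" "(t - l) / w < real i + 1"
          using t w0 by (auto simp: i_def)
        have "(t - l) / w < real n"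
          using t n0 w0 by (simp add: w_def field_simps)
        then have "i < n" using fl(1) by simp
        moreover have "l + real i * w \<le> t" "t \<le> l + real (Suc i) * w"
          using fl w0 by (auto simp: field_simps)
        ultimately show "(h, t) \<in> (\<Union>i. C i)" by (auto simp: C_def)
      qed
      show "bounded (C i)" for i by (auto simp: C_def intro!: bounded_Times)
      show "diameter (C i) \<le> \<delta>" for i using diam[of i] w by simp
    qed
    also have "\<dots> = (\<Sum>i<n. hausdorff_weight 1 (C i))"
      by (rule suminf_finite) (auto simp: C_def hausdorff_weight_def)
    also have "\<dots> \<le> (\<Sum>i<n. ennreal w)"
      by (intro sum_mono) (use diam in \<open>auto simp: hausdorff_weight_def intro: ennreal_leI\<close>)
    also have "\<dots> = ennreal (u - l)"
      using n0 w by (simp add: w_def ennreal_of_nat_eq_real_of_nat ennreal_mult[symmetric])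
    finally show "hausdorff_pre 1 \<delta> ({h} \<times> {l<..<u}) \<le> ennreal (u - l)" .
  qed
  have "ennreal (u - l) \<le> hausdorff_pre 1 1 ({h} \<times> {l<..<u})"
    unfolding hausdorff_pre_def
  proof (rule INF_greatest, clarify)
    fix C :: "nat \<Rightarrow> (real \<times> real) set"
    assume C: "{h} \<times> {l<..<u} \<subseteq> (\<Union>i. C i)" "\<forall>i. bounded (C i) \<and> diameter (C i) \<le> 1"
    define J where "J i = (if C i = {} then {} else {Inf (snd ` C i) .. Sup (snd ` C i)})" for i
    have J: "snd ` C i \<subseteq> J i \<and> emeasure lborel (J i) \<le> hausdorff_weight 1 (C i)" for i
    proof (cases "C i = {}")
      case False
      have "bounded (snd ` C i)"
        using C(2) by (intro bounded_snd) auto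
      then have bdd: "bdd_above (snd ` C i)" "bdd_below (snd ` C i)"
        by (auto intro: bounded_imp_bdd_above bounded_imp_bdd_below)
      have diff: "y - x \<le> diameter (C i)" if xy: "x \<in> snd ` C i" "y \<in> snd ` C i" for x y
      proof -
        obtain p q where pq: "p \<in> C i" "q \<in> C i" "x = snd p" "y = snd q" using xy by blast
        have "y - x \<le> dist (snd p) (snd q)" by (simp add: pq dist_real_def)
        also have "\<dots> \<le> dist p q" by (rule dist_snd_le)
        also have "\<dots> \<le> diameter (C i)" using C(2) pq by (intro diameter_bounded_bound) auto
        finally show ?thesis .
      qed
      have "y - diameter (C i) \<le> Inf (snd ` C i)" if "y \<in> snd ` C i" for y
        using False diff that by (intro cInf_greatest) (auto simp: algebra_simps)
      then have "Sup (snd ` C i) \<le> Inf (snd ` C i) + diameter (C i)"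
        using False by (intro cSup_least) (auto simp: algebra_simps)
      then have "emeasure lborel (J i) \<le> ennreal (diameter (C i))"
        using False by (auto simp: J_def emeasure_lborel_Icc_eq intro!: ennreal_leI)
      moreover have "snd ` C i \<subseteq> J i"
      proof
        fix t assume t: "t \<in> snd ` C i"
        show "t \<in> J i" using False cInf_lower[OF t bdd(2)] cSup_upper[OF t bdd(1)] by (simp add: J_def)
      qed
      ultimately show ?thesis using False by (simp add: hausdorff_weight_def)
    qed (simp add: J_def)
    have "{l<..<u} \<subseteq> (\<Union>i. J i)"
    proof
      fix t assume "t \<in> {l<..<u}"
      then obtain i where "(h, t) \<in> C i" using C(1) by blast
      then have "t \<in> snd ` C i" by force
      then show "t \<in> (\<Union>i. J i)" using J by blast
    qed
    moreover have Jm: "J i \<in> sets lborel" for i by (simp add: J_def)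
    ultimately have "emeasure lborel {l<..<u} \<le> emeasure lborel (\<Union>i. J i)"
      by (intro emeasure_mono) auto
    also have "\<dots> \<le> (\<Sum>i. emeasure lborel (J i))"
      using Jm by (intro emeasure_subadditive_countably) auto
    also have "\<dots> \<le> (\<Sum>i. hausdorff_weight 1 (C i))"
      using J by (intro suminf_le allI) auto
    finally show "ennreal (u - l) \<le> (\<Sum>i. hausdorff_weight 1 (C i))"
      using lu by simp
  qed
  also have "\<dots> \<le> hausdorff_outer 1 ({h} \<times> {l<..<u})"
    unfolding hausdorff_outer_def by (intro SUP_upper) auto
  finally show "ennreal (u - l) \<le> hausdorff_outer 1 ({h} \<times> {l<..<u})" .
qed

lemma Pair_borel_vertical:
  fixes h :: real and B :: "real set"
  assumes "B \<in> sets borel"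
  shows "{h} \<times> B \<in> sets borel"
  using assms by (intro borel_Times) auto

text \<open>
  Projecting the Hausdorff measure from the vertical line to the second coordinate gives a Borel
  measure that agrees with Lebesgue measure on open intervals.
\<close>

lemma emeasure_hausdorff_vertical:
  fixes h :: real and B :: "real set"
  assumes B: "B \<in> sets borel"
  shows "emeasure (hausdorff_measure 1) ({h} \<times> B) = emeasure lborel B"
proof -
  define \<nu> where "\<nu> = distr (restrict_space (hausdorff_measure 1) ({h} \<times> (UNIV :: real set))) borel snd"
  have L: "{h} \<times> (UNIV :: real set) \<in> sets borel" by (rule Pair_borel_vertical) simp
  have snd: "snd \<in> restrict_space (hausdorff_measure 1) ({h} \<times> UNIV) \<rightarrow>\<^sub>M (borel :: real measure)"
    by (intro measurable_restrict_space1)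
       (simp add: measurable_cong_sets[OF sets_hausdorff_measure refl] borel_prod[symmetric])
  have \<nu>: "emeasure \<nu> A = hausdorff_outer 1 ({h} \<times> A)" if A: "A \<in> sets borel" for A
  proof -
    have "emeasure \<nu> A = emeasure (restrict_space (hausdorff_measure 1) ({h} \<times> UNIV))
        (snd -` A \<inter> space (restrict_space (hausdorff_measure 1) ({h} \<times> UNIV)))"
      unfolding \<nu>_def by (rule emeasure_distr[OF snd A])
    also have "snd -` A \<inter> space (restrict_space (hausdorff_measure 1) ({h} \<times> UNIV)) = {h} \<times> A"
      by (auto simp: space_restrict_space space_hausdorff_measure)
    also have "emeasure (restrict_space (hausdorff_measure 1) ({h} \<times> UNIV)) ({h} \<times> A)
        = emeasure (hausdorff_measure 1) ({h} \<times> A)"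
      using L by (intro emeasure_restrict_space) (auto simp: sets_hausdorff_measure space_hausdorff_measure)
    finally show ?thesis using Pair_borel_vertical[OF A, of h] by (simp add: emeasure_hausdorff_measure)
  qed
  have "lborel = \<nu>"
  proof (rule lborel_eqI)
    fix l u :: real assume "\<And>b. b \<in> Basis \<Longrightarrow> l \<bullet> b \<le> u \<bullet> b"
    then have "l \<le> u" by simp
    then show "emeasure \<nu> (box l u) = ennreal (\<Prod>b\<in>Basis. (u - l) \<bullet> b)"
      by (simp add: \<nu> box_real hausdorff_outer_vertical_interval del: One_nat_def)
  qed (simp add: \<nu>_def)
  then show ?thesis using B \<nu> Pair_borel_vertical[OF B, of h] by (simp add: emeasure_hausdorff_measure)
qed

lemma surface_measure_hypotenuse:
  "surface_measure_on (hypotenuse h)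
     = distr (restrict_space lborel {-h..h}) (restrict_space borel (hypotenuse h)) (\<lambda>t. (h, t))"
proof -
  have hyp: "hypotenuse h = {h} \<times> {-h..h}" by (auto simp: hypotenuse_def)
  have \<Gamma>: "hypotenuse h \<in> sets borel" unfolding hyp by (rule Pair_borel_vertical) simp
  have S: "surface_measure_on (hypotenuse h) = restrict_space (hausdorff_measure 1) (hypotenuse h)"
    by (simp add: surface_measure_on_def)
  have meas: "(\<lambda>t. (h, t)) \<in> restrict_space lborel {-h..h} \<rightarrow>\<^sub>M restrict_space borel (hypotenuse h)"
    by (intro measurable_restrict_space3)
       (auto simp: hyp borel_prod[symmetric])
  show ?thesis unfolding S
  proof (rule measure_eqI)
    show "sets (restrict_space (hausdorff_measure 1) (hypotenuse h)) =
      sets (distr (restrict_space lborel {-h..h}) (restrict_space borel (hypotenuse h)) (\<lambda>t. (h, t)))"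
      by (simp add: sets_restrict_space sets_hausdorff_measure)
    fix A assume "A \<in> sets (restrict_space (hausdorff_measure 1) (hypotenuse h))"
    then have A: "A \<in> sets borel" "A \<subseteq> hypotenuse h"
      using \<Gamma> by (auto simp: sets_restrict_space_iff sets_hausdorff_measure space_hausdorff_measure)
    then have A': "A \<in> sets (restrict_space borel (hypotenuse h))"
      using \<Gamma> by (simp add: sets_restrict_space_iff)
    define B where "B = (\<lambda>t. (h, t)) -` A"
    have "(\<lambda>t. (h, t)) \<in> borel \<rightarrow>\<^sub>M (borel :: (real \<times> real) measure)" by (simp add: borel_prod[symmetric])
    then have B: "B \<in> sets borel" using A(1) unfolding B_def by (rule measurable_sets_borel)
    have AB: "A = {h} \<times> B" and Bsub: "B \<subseteq> {-h..h}" using A(2) by (auto simp: hyp B_def)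
    have "emeasure (restrict_space (hausdorff_measure 1) (hypotenuse h)) A = emeasure (hausdorff_measure 1) A"
      using \<Gamma> A by (intro emeasure_restrict_space) (auto simp: sets_hausdorff_measure space_hausdorff_measure)
    also have "\<dots> = emeasure lborel B" unfolding AB by (rule emeasure_hausdorff_vertical[OF B])
    also have "\<dots> = emeasure (restrict_space lborel {-h..h}) B"
      using Bsub by (subst emeasure_restrict_space) auto
    also have "\<dots> = emeasure (distr (restrict_space lborel {-h..h}) (restrict_space borel (hypotenuse h)) (\<lambda>t. (h, t))) A"
      using Bsub by (subst emeasure_distr[OF meas A']) (auto simp: B_def space_restrict_space intro!: arg_cong2[where f = emeasure])
    finally show "emeasure (restrict_space (hausdorff_measure 1) (hypotenuse h)) A = \<dots>" .
  qed
qed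

lemma integral_surface_hypotenuse:
  fixes f :: "real \<times> real \<Rightarrow> real"
  assumes "f \<in> borel_measurable (restrict_space borel (hypotenuse h))"
  shows "(\<integral>x. f x \<partial>surface_measure_on (hypotenuse h)) = (\<integral>t. f (h, t) \<partial>restrict_space lborel {-h..h})"
  unfolding surface_measure_hypotenuse
  by (rule integral_distr[OF _ assms], intro measurable_restrict_space3)
     (auto simp: hypotenuse_def borel_prod[symmetric])

section \<open>The upper bound\<close>

lemma in_L2_add:
  assumes f: "in_L2 M f" and g: "in_L2 M g"
  shows "in_L2 M (\<lambda>x. f x + g x)"
  unfolding in_L2_def
proof
  have m: "f \<in> borel_measurable M" "g \<in> borel_measurable M" using f g by (simp_all add: in_L2_def)
  then show meas: "(\<lambda>x. f x + g x) \<in> borel_measurable M" by simp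
  show "integrable M (\<lambda>x. (norm (f x + g x))\<^sup>2)"
  proof (rule Bochner_Integration.integrable_bound)
    show "integrable M (\<lambda>x. 2 * (norm (f x))\<^sup>2 + 2 * (norm (g x))\<^sup>2)"
      using f g by (simp add: in_L2_def)
    show "(\<lambda>x. (norm (f x + g x))\<^sup>2) \<in> borel_measurable M" using meas by simp
    show "AE x in M. norm ((norm (f x + g x))\<^sup>2) \<le> norm (2 * (norm (f x))\<^sup>2 + 2 * (norm (g x))\<^sup>2)"
    proof (rule AE_I2)
      fix x
      have "(norm (f x + g x))\<^sup>2 \<le> (norm (f x) + norm (g x))\<^sup>2"
        by (intro power_mono norm_triangle_ineq) auto
      also have "\<dots> \<le> 2 * (norm (f x))\<^sup>2 + 2 * (norm (g x))\<^sup>2"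
        using zero_le_power2[of "norm (f x) - norm (g x)"] by (simp add: power2_sum power2_diff)
      finally show "norm ((norm (f x + g x))\<^sup>2) \<le> norm (2 * (norm (f x))\<^sup>2 + 2 * (norm (g x))\<^sup>2)" by simp
    qed
  qed
qed

lemma in_L2_diff:
  assumes "in_L2 M f" "in_L2 M g" shows "in_L2 M (\<lambda>x. f x - g x)"
proof -
  have "in_L2 M (\<lambda>x. - g x)" using assms(2) by (simp add: in_L2_def)
  from in_L2_add[OF assms(1) this] show ?thesis by simp
qed

lemma L2_norm_nonneg: "0 \<le> L2_norm M f"
  by (simp add: L2_norm_def)

lemma L2_norm_power2: "(L2_norm M f)\<^sup>2 = (\<integral>x. (norm (f x))\<^sup>2 \<partial>M)"
  unfolding L2_norm_def by (rule real_sqrt_pow2) simp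

lemma weighted_square_sum_le:
  fixes a b x y :: real
  assumes "0 < a" "0 < b"
  shows "(x + y)\<^sup>2 \<le> (1 + b / a) * x\<^sup>2 + (1 + a / b) * y\<^sup>2"
proof -
  have "0 \<le> (b * x - a * y)\<^sup>2 / (a * b)" using assms by simp
  also have "\<dots> = b / a * x\<^sup>2 - 2 * x * y + a / b * y\<^sup>2"
    using assms by (simp add: field_simps power2_eq_square)
  finally show ?thesis by (simp add: power2_sum distrib_right)
qed

text \<open>
  Minkowski's inequality from the weighted square inequality, with weights that are the two norms
  enlarged by \<open>e / 2\<close> in order to be positive.
\<close>

lemma L2_norm_add_le:
  assumes f: "in_L2 M f" and g: "in_L2 M g"
  shows "L2_norm M (\<lambda>x. f x + g x) \<le> L2_norm M f + L2_norm M g"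
proof (rule field_le_epsilon)
  fix e :: real assume e: "0 < e"
  define a where "a = L2_norm M f + e / 2"
  define b where "b = L2_norm M g + e / 2"
  have ab: "0 < a" "0 < b" using e L2_norm_nonneg[of M f] L2_norm_nonneg[of M g] by (auto simp: a_def b_def)
  have le: "L2_norm M f \<le> a" "L2_norm M g \<le> b" using e by (simp_all add: a_def b_def)
  have int: "integrable M (\<lambda>x. (norm (f x))\<^sup>2)" "integrable M (\<lambda>x. (norm (g x))\<^sup>2)"
    "integrable M (\<lambda>x. (norm (f x + g x))\<^sup>2)"
    using f g in_L2_add[OF f g] by (simp_all add: in_L2_def)
  have "(L2_norm M (\<lambda>x. f x + g x))\<^sup>2 = (\<integral>x. (norm (f x + g x))\<^sup>2 \<partial>M)" by (rule L2_norm_power2)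
  also have "\<dots> \<le> (\<integral>x. (1 + b / a) * (norm (f x))\<^sup>2 + (1 + a / b) * (norm (g x))\<^sup>2 \<partial>M)"
  proof (rule integral_mono[OF int(3)])
    show "integrable M (\<lambda>x. (1 + b / a) * (norm (f x))\<^sup>2 + (1 + a / b) * (norm (g x))\<^sup>2)"
      by (intro Bochner_Integration.integrable_add integrable_mult_right int)
    fix x
    have "(norm (f x + g x))\<^sup>2 \<le> (norm (f x) + norm (g x))\<^sup>2"
      by (intro power_mono norm_triangle_ineq) auto
    also have "\<dots> \<le> (1 + b / a) * (norm (f x))\<^sup>2 + (1 + a / b) * (norm (g x))\<^sup>2"
      by (rule weighted_square_sum_le[OF ab])
    finally show "(norm (f x + g x))\<^sup>2 \<le> (1 + b / a) * (norm (f x))\<^sup>2 + (1 + a / b) * (norm (g x))\<^sup>2" .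
  qed
  also have "\<dots> = (1 + b / a) * (L2_norm M f)\<^sup>2 + (1 + a / b) * (L2_norm M g)\<^sup>2"
    unfolding L2_norm_power2 using int(1,2)
    by (subst Bochner_Integration.integral_add) simp_all
  also have "\<dots> \<le> (1 + b / a) * a\<^sup>2 + (1 + a / b) * b\<^sup>2"
    using ab by (intro add_mono mult_left_mono power_mono le L2_norm_nonneg add_nonneg_nonneg divide_nonneg_nonneg) simp_all
  also have "\<dots> = (a + b)\<^sup>2"
  proof -
    have "b / a * a\<^sup>2 = a * b" "a / b * b\<^sup>2 = a * b" using ab by (simp_all add: power2_eq_square)
    then show ?thesis by (simp add: distrib_right power2_sum)
  qed
  finally have "L2_norm M (\<lambda>x. f x + g x) \<le> a + b"
    by (rule power2_le_imp_le) (use ab in simp)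
  then show "L2_norm M (\<lambda>x. f x + g x) \<le> L2_norm M f + L2_norm M g + e" by (simp add: a_def b_def)
qed

text \<open>
  The Cauchy-Schwarz inequality against a constant, from expanding \<open>0 \<le> \<integral> (\<mu> f - J)\<^sup>2\<close>, where \<open>J\<close> is the integral
  of \<open>f\<close> and \<open>\<mu>\<close> the total mass.
\<close>

lemma L2_integral_bound:
  fixes f :: "'a \<Rightarrow> real"
  assumes "finite_measure M" and f: "in_L2 M f"
  shows "integrable M f" and "(\<integral>x. f x \<partial>M)\<^sup>2 \<le> measure M (space M) * (L2_norm M f)\<^sup>2"
proof -
  interpret finite_measure M by fact
  have int2: "integrable M (\<lambda>x. (f x)\<^sup>2)" and m: "f \<in> borel_measurable M" using f by (simp_all add: in_L2_def)
  show int: "integrable M f"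
  proof (rule Bochner_Integration.integrable_bound)
    show "integrable M (\<lambda>x. 1 + (f x)\<^sup>2)" using int2 by simp
    show "AE x in M. norm (f x) \<le> norm (1 + (f x)\<^sup>2)"
    proof (rule AE_I2)
      fix x
      have "0 \<le> (\<bar>f x\<bar> - 1)\<^sup>2" by simp
      then show "norm (f x) \<le> norm (1 + (f x)\<^sup>2)" by (simp add: power2_diff)
    qed
  qed (rule m)
  define \<mu> where "\<mu> = measure M (space M)"
  define J where "J = (\<integral>x. f x \<partial>M)"
  have "0 \<le> (\<integral>x. (\<mu> * f x - J)\<^sup>2 \<partial>M)" by simp
  also have "\<dots> = (\<integral>x. \<mu>\<^sup>2 * (f x)\<^sup>2 - 2 * \<mu> * J * f x + J\<^sup>2 \<partial>M)"
    by (intro Bochner_Integration.integral_cong) (auto simp: power2_diff power_mult_distrib)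
  also have "\<dots> = \<mu>\<^sup>2 * (L2_norm M f)\<^sup>2 - 2 * \<mu> * J * J + J\<^sup>2 * \<mu>"
    using int int2 by (simp add: L2_norm_power2 J_def \<mu>_def)
  finally have *: "0 \<le> \<mu> * (\<mu> * (L2_norm M f)\<^sup>2 - J\<^sup>2)" by (simp add: algebra_simps power2_eq_square)
  have "J\<^sup>2 \<le> \<mu> * (L2_norm M f)\<^sup>2"
  proof (cases "\<mu> = 0")
    case True
    then have "emeasure M (space M) = 0" by (simp add: \<mu>_def emeasure_eq_measure)
    then have "AE x in M. f x = 0" by (intro AE_I[of _ _ "space M"]) auto
    then have "J = 0" unfolding J_def using integral_eq_zero_AE by blast
    then show ?thesis using True by simp
  next
    case False
    then have "0 < \<mu>" by (simp add: \<mu>_def less_le)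
    then show ?thesis using * by (simp add: zero_le_mult_iff)
  qed
  then show "(\<integral>x. f x \<partial>M)\<^sup>2 \<le> measure M (space M) * (L2_norm M f)\<^sup>2" by (simp add: J_def \<mu>_def)
qed

lemma finite_measure_surface: "finite_measure (surface_measure_on (hypotenuse h))"
  and measure_surface: "0 \<le> h \<Longrightarrow> measure (surface_measure_on (hypotenuse h)) (hypotenuse h) = 2 * h"
  and space_surface: "space (surface_measure_on (hypotenuse h)) = hypotenuse h"
proof -
  have meas: "(\<lambda>t. (h, t)) \<in> seg h \<rightarrow>\<^sub>M restrict_space borel (hypotenuse h)"
    by (intro measurable_restrict_space3) (auto simp: hypotenuse_def borel_prod[symmetric])
  show "finite_measure (surface_measure_on (hypotenuse h))"
    unfolding surface_measure_hypotenuse by (rule finite_measure.finite_measure_distr[OF finite_measure_seg meas])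
  show "space (surface_measure_on (hypotenuse h)) = hypotenuse h"
    by (simp add: surface_measure_on_def space_restrict_space space_hausdorff_measure)
  have top: "hypotenuse h \<in> sets (restrict_space borel (hypotenuse h))"
    using sets.top[of "restrict_space borel (hypotenuse h)"] by (simp add: space_restrict_space)
  assume "0 \<le> h"
  then show "measure (surface_measure_on (hypotenuse h)) (hypotenuse h) = 2 * h"
    unfolding surface_measure_hypotenuse measure_distr[OF meas top]
    using measure_seg[of h] by (simp add: hypotenuse_def vimage_def Int_def atLeastAtMost_def atLeast_def atMost_def)
qed

lemma in_L2_triangle:
  fixes f :: "real \<times> real \<Rightarrow> real"
  assumes "bounded_borel (square h) f" shows "in_L2 (lebesgue_on (right_triangle h)) f"
  using integrable_triangle(1)[OF assms] integrable_triangle(1)[OF bounded_borel_power2[OF assms]]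
  by (simp add: in_L2_def)

lemma C1_partials_diff_const: "C1_partials \<phi> \<phi>1 \<phi>2 \<Longrightarrow> C1_partials (\<lambda>q. \<phi> q - c) \<phi>1 \<phi>2"
  unfolding C1_partials_def by (auto intro!: derivative_eq_intros)

lemma poincare_triangle_smooth:
  assumes h: "0 < h" and z: "0 < z" "sqrt 2 * z < pi" "z * cot z + 1 = 0"
    and smooth: "smooth \<phi>" and m: "2 * h * m = (\<integral>q. \<phi> q \<partial>surface_measure_on (hypotenuse h))"
  shows "L2_norm (lebesgue_on (right_triangle h)) (\<lambda>q. \<phi> q - m)
    \<le> inverse z * h * L2_norm (lebesgue_on (right_triangle h)) (gradient \<phi>)"
proof -
  let ?M = "lebesgue_on (right_triangle h)"
  note C1 = smooth_C1_partials[OF smooth]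
  have mb: "\<phi> \<in> borel_measurable (restrict_space borel (hypotenuse h))"
    using C1_partials_continuous(1)[OF C1] by (intro measurable_restrict_space1 borel_measurable_continuous_onI)
  have b: "bounded_borel {-h..h} (\<lambda>t. \<phi> (h, t))"
    by (rule bounded_borel_slice(2)[OF C1_partials_bounded_borel(1)[OF C1]]) (use h in auto)
  have "(\<integral>t. \<phi> (h, t) - m \<partial>seg h) = (\<integral>t. \<phi> (h, t) \<partial>seg h) - 2 * h * m"
    using integrable_seg[OF b] integrable_seg[OF bounded_borel_const, of h m] measure_seg[of h] h by simp
  also have "\<dots> = 0" using m integral_surface_hypotenuse[OF mb] by simp
  finally have "z\<^sup>2 * (\<integral>q. (\<phi> q - m)\<^sup>2 \<partial>?M)
      \<le> h\<^sup>2 * (\<integral>q. (partial_deriv (1, 0) \<phi> q)\<^sup>2 + (partial_deriv (0, 1) \<phi> q)\<^sup>2 \<partial>?M)"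
    by (intro poincare_triangle_C1[OF h z C1_partials_diff_const[OF C1]])
  then have "z\<^sup>2 * (L2_norm ?M (\<lambda>q. \<phi> q - m))\<^sup>2 \<le> h\<^sup>2 * (L2_norm ?M (gradient \<phi>))\<^sup>2"
    by (simp add: L2_norm_power2 gradient_prod norm_Pair)
  then have "(z * L2_norm ?M (\<lambda>q. \<phi> q - m))\<^sup>2 \<le> (h * L2_norm ?M (gradient \<phi>))\<^sup>2"
    by (simp add: power_mult_distrib)
  then have "z * L2_norm ?M (\<lambda>q. \<phi> q - m) \<le> h * L2_norm ?M (gradient \<phi>)"
    by (rule power2_le_imp_le) (use h in \<open>simp add: L2_norm_nonneg\<close>)
  then show ?thesis using z by (simp add: field_simps)
qed

text \<open>
  Let \<open>m n\<close> be the mean over the hypotenuse of the \<open>n\<close>-th smooth approximation. Since the traces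
  converge and the limit has mean zero, \<open>m n\<close> tends to \<open>0\<close>, and the inequality for \<open>\<phi> n - m n\<close> passes
  to the limit.
\<close>

lemma admissible_constant_triangle:
  assumes h: "0 < h" and z: "0 < z" "sqrt 2 * z < pi" "z * cot z + 1 = 0"
  shows "admissible_constant (right_triangle h) (hypotenuse h) (inverse z * h)"
  unfolding admissible_constant_def
proof clarify
  fix w G assume "(w, G) \<in> H1_tilde (right_triangle h) (hypotenuse h)"
  then obtain g where tr: "has_trace (right_triangle h) (hypotenuse h) (w, G) g"
      and mean: "surface_mean (hypotenuse h) g = 0"
    by (auto simp: H1_tilde_def)
  let ?M = "lebesgue_on (right_triangle h)" and ?S = "surface_measure_on (hypotenuse h)"
  define K where "K = inverse z * h"
  have K: "0 \<le> K" using h z by (simp add: K_def)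
  obtain \<phi> where smooth: "\<And>n. smooth (\<phi> n)" and w: "L2_tendsto ?M \<phi> w"
    and G: "L2_tendsto ?M (\<lambda>n. gradient (\<phi> n)) G" and g: "L2_tendsto ?S \<phi> g"
    using tr by (auto simp: has_trace_def)
  note fin = finite_measure_surface[of h]
  have \<mu>: "measure ?S (space ?S) = 2 * h" using measure_surface[of h] h by (simp add: space_surface)
  have g0: "(\<integral>q. g q \<partial>?S) = 0"
    using mean measure_surface[of h] h by (simp add: surface_mean_def)
  define m where "m n = (\<integral>q. \<phi> n q \<partial>?S) / (2 * h)" for n
  have m_bound: "\<bar>m n\<bar> \<le> sqrt (2 * h) / (2 * h) * L2_norm ?S (\<lambda>q. \<phi> n q - g q)" for n
  proof -
    have L2: "in_L2 ?S (\<phi> n)" "in_L2 ?S g" using g by (simp_all add: L2_tendsto_def)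
    have "(\<integral>q. \<phi> n q \<partial>?S) = (\<integral>q. \<phi> n q - g q \<partial>?S)"
      using L2_integral_bound(1)[OF fin L2(1)] L2_integral_bound(1)[OF fin L2(2)] g0 by simp
    then have "(\<integral>q. \<phi> n q \<partial>?S)\<^sup>2 \<le> (sqrt (2 * h) * L2_norm ?S (\<lambda>q. \<phi> n q - g q))\<^sup>2"
      using L2_integral_bound(2)[OF fin in_L2_diff[OF L2]] h \<mu> by (simp add: power_mult_distrib)
    then have "\<bar>\<integral>q. \<phi> n q \<partial>?S\<bar>\<^sup>2 \<le> (sqrt (2 * h) * L2_norm ?S (\<lambda>q. \<phi> n q - g q))\<^sup>2"
      by (simp only: power2_abs)
    then have "\<bar>\<integral>q. \<phi> n q \<partial>?S\<bar> \<le> sqrt (2 * h) * L2_norm ?S (\<lambda>q. \<phi> n q - g q)"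
      by (rule power2_le_imp_le) (use h in \<open>simp add: L2_norm_nonneg\<close>)
    then have "\<bar>\<integral>q. \<phi> n q \<partial>?S\<bar> / (2 * h) \<le> sqrt (2 * h) * L2_norm ?S (\<lambda>q. \<phi> n q - g q) / (2 * h)"
      using h by (intro divide_right_mono) auto
    then show ?thesis using h by (simp add: m_def)
  qed
  have "(\<lambda>n. sqrt (2 * h) / (2 * h) * L2_norm ?S (\<lambda>q. \<phi> n q - g q)) \<longlonglongrightarrow> sqrt (2 * h) / (2 * h) * 0"
    using g by (intro tendsto_intros) (simp add: L2_tendsto_def)
  then have "m \<longlonglongrightarrow> 0"
    using m_bound by (intro Lim_null_comparison[of m]) (auto intro: always_eventually)
  then have m0: "(\<lambda>n. \<bar>m n\<bar>) \<longlonglongrightarrow> 0" by (rule tendsto_rabs_zero)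
  define c where "c = L2_norm ?M (\<lambda>q. 1 :: real)"
  have bound: "L2_norm ?M w \<le> K * L2_norm ?M G
      + (L2_norm ?M (\<lambda>q. \<phi> n q - w q) + K * L2_norm ?M (\<lambda>q. gradient (\<phi> n) q - G q) + \<bar>m n\<bar> * c)" for n
  proof -
    have L2: "in_L2 ?M (\<phi> n)" "in_L2 ?M w" "in_L2 ?M (gradient (\<phi> n))" "in_L2 ?M G"
      using w G by (simp_all add: L2_tendsto_def)
    have L2c: "in_L2 ?M (\<lambda>q. m n)" by (rule in_L2_triangle[OF bounded_borel_const])
    have norm_c: "L2_norm ?M (\<lambda>q. m n) = \<bar>m n\<bar> * c"
      by (simp add: L2_norm_def c_def real_sqrt_mult)
    have swap: "L2_norm ?M (\<lambda>q. w q - \<phi> n q) = L2_norm ?M (\<lambda>q. \<phi> n q - w q)"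
      by (simp add: L2_norm_def power2_commute)
    have "L2_norm ?M (\<lambda>q. (w q - \<phi> n q) + (\<phi> n q - m n)) \<le> L2_norm ?M (\<lambda>q. w q - \<phi> n q) + L2_norm ?M (\<lambda>q. \<phi> n q - m n)"
      by (intro L2_norm_add_le in_L2_diff L2 L2c)
    moreover have "L2_norm ?M (\<lambda>q. ((w q - \<phi> n q) + (\<phi> n q - m n)) + m n)
        \<le> L2_norm ?M (\<lambda>q. (w q - \<phi> n q) + (\<phi> n q - m n)) + L2_norm ?M (\<lambda>q. m n)"
      by (intro L2_norm_add_le in_L2_add in_L2_diff L2 L2c)
    moreover have "L2_norm ?M (\<lambda>q. \<phi> n q - m n) \<le> K * L2_norm ?M (gradient (\<phi> n))"
      unfolding K_def by (rule poincare_triangle_smooth[OF h z smooth]) (use h in \<open>simp add: m_def\<close>)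
    moreover have "L2_norm ?M (\<lambda>q. (gradient (\<phi> n) q - G q) + G q)
        \<le> L2_norm ?M (\<lambda>q. gradient (\<phi> n) q - G q) + L2_norm ?M G"
      by (intro L2_norm_add_le in_L2_diff L2)
    then have "K * L2_norm ?M (gradient (\<phi> n)) \<le> K * (L2_norm ?M (\<lambda>q. gradient (\<phi> n) q - G q) + L2_norm ?M G)"
      using K by (intro mult_left_mono) simp_all
    ultimately show ?thesis by (simp add: swap norm_c algebra_simps)
  qed
  have "(\<lambda>n. K * L2_norm ?M G
      + (L2_norm ?M (\<lambda>q. \<phi> n q - w q) + K * L2_norm ?M (\<lambda>q. gradient (\<phi> n) q - G q) + \<bar>m n\<bar> * c))
    \<longlonglongrightarrow> K * L2_norm ?M G + (0 + K * 0 + 0 * c)"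
    using w G m0 by (intro tendsto_intros) (simp_all add: L2_tendsto_def)
  then have "L2_norm ?M w \<le> K * L2_norm ?M G + (0 + K * 0 + 0 * c)"
    by (rule tendsto_lowerbound) (auto intro: always_eventually bound)
  then show "L2_norm ?M w \<le> inverse z * h * L2_norm ?M G" by (simp add: K_def)
qed

section \<open>Sharpness\<close>

lemma cosine_sum_has_derivative:
  "((\<lambda>q. c * cos (k * fst q + \<alpha>) + d * cos (k * snd q + \<beta>)) has_derivative
     (\<lambda>v. fst v * (- c * k * sin (k * fst q + \<alpha>)) + snd v * (- d * k * sin (k * snd q + \<beta>)))) (at q)"
  for c d k \<alpha> \<beta> :: real and q :: "real \<times> real"
  by (auto intro!: derivative_eq_intros simp: algebra_simps)

lemma cosine_sum_partial_deriv:
  fixes c d k \<alpha> \<beta> :: real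
  assumes "i \<in> (Basis :: (real \<times> real) set)"
  shows "partial_deriv i (\<lambda>q. c * cos (k * fst q + \<alpha>) + d * cos (k * snd q + \<beta>))
     = (\<lambda>q. (c * k * fst i) * cos (k * fst q + (\<alpha> + pi / 2)) + (d * k * snd i) * cos (k * snd q + (\<beta> + pi / 2)))"
proof
  fix q :: "real \<times> real"
  have cos: "cos (t + (\<gamma> + pi / 2)) = - sin (t + \<gamma>)" for t \<gamma> :: real
    using cos_add[of "t + \<gamma>" "pi / 2"] by (simp add: add.assoc)
  show "partial_deriv i (\<lambda>q. c * cos (k * fst q + \<alpha>) + d * cos (k * snd q + \<beta>)) q
     = (c * k * fst i) * cos (k * fst q + (\<alpha> + pi / 2)) + (d * k * snd i) * cos (k * snd q + (\<beta> + pi / 2))"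
    unfolding partial_deriv_def frechet_derivative_at[OF cosine_sum_has_derivative, symmetric] cos
    by (simp add: algebra_simps)
qed

text \<open>
  The amplitudes and phases are arbitrary because this class of functions is closed under partial
  derivatives: differentiation shifts the phase by \<open>pi / 2\<close>.
\<close>

lemma Ck_cosine_sum:
  "Ck n (\<lambda>q :: real \<times> real. c * cos (k * fst q + \<alpha>) + d * cos (k * snd q + \<beta>))"
proof (induction n arbitrary: c d \<alpha> \<beta>)
  case 0
  show ?case unfolding Ck.simps by (intro continuous_intros)
next
  case (Suc n)
  show ?case unfolding Ck.simps
  proof (intro conjI allI ballI)
    show "(\<lambda>q :: real \<times> real. c * cos (k * fst q + \<alpha>) + d * cos (k * snd q + \<beta>)) differentiable (at q)" for q
      using cosine_sum_has_derivative differentiableI by blast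
    fix i :: "real \<times> real" assume "i \<in> Basis"
    then show "Ck n (partial_deriv i (\<lambda>q. c * cos (k * fst q + \<alpha>) + d * cos (k * snd q + \<beta>)))"
      by (simp only: cosine_sum_partial_deriv Suc)
  qed
qed

definition cosine_mode :: "real \<Rightarrow> real \<times> real \<Rightarrow> real" where
  "cosine_mode k q = cos (k * fst q) + cos (k * snd q)"

lemma smooth_cosine_mode: "smooth (cosine_mode k)"
  using Ck_cosine_sum[of _ 1 k 0 1 0] unfolding smooth_def cosine_mode_def[abs_def] by simp

lemma gradient_cosine_mode: "gradient (cosine_mode k) q = (- k * sin (k * fst q), - k * sin (k * snd q))"
proof -
  have "cosine_mode k = (\<lambda>q. 1 * cos (k * fst q + 0) + 1 * cos (k * snd q + 0))"
    by (simp add: fun_eq_iff cosine_mode_def)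
  moreover have "(1, 0) \<in> (Basis :: (real \<times> real) set)" "(0, 1) \<in> (Basis :: (real \<times> real) set)"
    by (simp_all add: Basis_prod_def)
  moreover have "cos (t + pi / 2) = - sin t" for t :: real
    using sin_cos_eq[of "- t"] by (simp add: add.commute)
  ultimately show ?thesis by (simp only: gradient_prod cosine_sum_partial_deriv) simp
qed

lemma integral_partials_zero_boundary:
  assumes C1: "C1_partials F F1 F2" and h: "0 < h"
    and bd: "\<And>t. F (h, t) = 0" "\<And>t. F (- h, t) = 0" "\<And>t. F (t, h) = 0" "\<And>t. F (t, - h) = 0"
  shows "(\<integral>q. F1 q \<partial>seg2 h) = 0" "(\<integral>q. F2 q \<partial>seg2 h) = 0"
proof -
  note b = C1_partials_bounded_borel[OF C1]
  have "(\<integral>x. F1 (x, y) \<partial>seg h) = 0" if y: "y \<in> {-h..h}" for y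
  proof -
    have "((\<lambda>x. F1 (x, y)) has_integral (F (h, y) - F (- h, y))) {-h..h}"
      using h by (intro fundamental_theorem_of_calculus)
        (auto simp flip: has_real_derivative_iff_has_vector_derivative intro!: DERIV_subset[OF C1_partials_axes(1)[OF C1]])
    then show ?thesis using has_integral_unique[OF has_integral_seg[OF bounded_borel_slice(1)[OF b(2) y]]] bd by simp
  qed
  then have "(\<integral>y. \<integral>x. F1 (x, y) \<partial>seg h \<partial>seg h) = (\<integral>y. 0 \<partial>seg h)"
    by (intro Bochner_Integration.integral_cong) auto
  then show "(\<integral>q. F1 q \<partial>seg2 h) = 0" using integral_seg2(1)[OF b(2)] by simp
  have "(\<integral>y. F2 (x, y) \<partial>seg h) = 0" if x: "x \<in> {-h..h}" for x
  proof -
    have "((\<lambda>y. F2 (x, y)) has_integral (F (x, h) - F (x, - h))) {-h..h}"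
      using h by (intro fundamental_theorem_of_calculus)
        (auto simp flip: has_real_derivative_iff_has_vector_derivative intro!: DERIV_subset[OF C1_partials_axes(2)[OF C1]])
    then show ?thesis using has_integral_unique[OF has_integral_seg[OF bounded_borel_slice(2)[OF b(3) x]]] bd by simp
  qed
  then have "(\<integral>x. \<integral>y. F2 (x, y) \<partial>seg h \<partial>seg h) = (\<integral>y. 0 \<partial>seg h)"
    by (intro Bochner_Integration.integral_cong) auto
  then show "(\<integral>q. F2 q \<partial>seg2 h) = 0" using integral_seg2(2)[OF b(3)] by simp
qed

text \<open>
  A test function vanishes near the sides of the square, so the fundamental theorem of calculus on
  lines parallel to the axes gives zero for the integral of a partial derivative of \<open>w \<psi>\<close>.
\<close>

lemma smooth_has_weak_gradient:
  assumes w: "smooth w" and h: "0 < h"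
  shows "has_weak_gradient (right_triangle h) w (gradient w)"
  unfolding has_weak_gradient_def
proof (intro allI impI ballI)
  fix \<psi> and i :: "real \<times> real"
  assume \<psi>: "test_function (right_triangle h) \<psi>" and i: "i \<in> Basis"
  let ?T = "right_triangle h"
  note Cw = smooth_C1_partials[OF w]
  have C\<psi>: "C1_partials \<psi> (partial_deriv (1, 0) \<psi>) (partial_deriv (0, 1) \<psi>)"
    using \<psi> by (intro smooth_C1_partials) (simp add: test_function_def)
  have out: "\<psi> q = 0" if "q \<notin> ?T" for q
    using \<psi> that closure_subset[of "{x. \<psi> x \<noteq> 0}"] by (auto simp: test_function_def)
  have out': "partial_deriv j \<psi> q = 0" if q: "q \<notin> ?T" for q j
  proof -
    have "q \<in> - closure {x. \<psi> x \<noteq> 0}" using \<psi> q by (auto simp: test_function_def)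
    moreover have "open (- closure {x. \<psi> x \<noteq> 0})" by auto
    ultimately have "(\<psi> has_derivative (\<lambda>v. 0)) (at q)"
      by (intro has_derivative_transform_within_open[OF has_derivative_const[of 0]])
         (auto intro: closure_subset[THEN subsetD])
    then show ?thesis unfolding partial_deriv_def by (simp add: frechet_derivative_at[symmetric])
  qed
  have C: "C1_partials (\<lambda>q. w q * \<psi> q)
      (\<lambda>q. w q * partial_deriv (1, 0) \<psi> q + partial_deriv (1, 0) w q * \<psi> q)
      (\<lambda>q. w q * partial_deriv (0, 1) \<psi> q + partial_deriv (0, 1) w q * \<psi> q)"
    unfolding C1_partials_def
  proof (intro conjI allI)
    fix q
    show "((\<lambda>q. w q * \<psi> q) has_derivative (\<lambda>v.
        fst v * (w q * partial_deriv (1, 0) \<psi> q + partial_deriv (1, 0) w q * \<psi> q) +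
        snd v * (w q * partial_deriv (0, 1) \<psi> q + partial_deriv (0, 1) w q * \<psi> q))) (at q)"
    proof (rule has_derivative_eq_rhs)
      show "((\<lambda>q. w q * \<psi> q) has_derivative (\<lambda>v.
          w q * (fst v * partial_deriv (1, 0) \<psi> q + snd v * partial_deriv (0, 1) \<psi> q) +
          (fst v * partial_deriv (1, 0) w q + snd v * partial_deriv (0, 1) w q) * \<psi> q)) (at q)"
        using Cw C\<psi> unfolding C1_partials_def by (intro has_derivative_mult) blast+
    qed (simp add: fun_eq_iff algebra_simps)
  qed (intro continuous_intros C1_partials_continuous[OF Cw] C1_partials_continuous[OF C\<psi>])+
  have "(\<integral>q. w q * partial_deriv i \<psi> q + partial_deriv i w q * \<psi> q \<partial>seg2 h) = 0"
  proof -
    have "w q * \<psi> q = 0" if "q \<notin> ?T" for q using out[OF that] by simp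
    then have "w (h, t) * \<psi> (h, t) = 0" "w (- h, t) * \<psi> (- h, t) = 0"
      "w (t, h) * \<psi> (t, h) = 0" "w (t, - h) * \<psi> (t, - h) = 0" for t
      using h by (auto simp: right_triangle_def)
    from integral_partials_zero_boundary[OF C h this] i show ?thesis
      by (auto simp: Basis_prod_def zero_prod_def)
  qed
  moreover have b: "bounded_borel (square h) (\<lambda>q. w q * partial_deriv i \<psi> q)"
    "bounded_borel (square h) (\<lambda>q. partial_deriv i w q * \<psi> q)"
    using i C1_partials_bounded_borel[OF Cw, of h] C1_partials_bounded_borel[OF C\<psi>, of h]
    by (auto intro!: bounded_borel_mult simp: Basis_prod_def zero_prod_def)
  ultimately have "(\<integral>q. w q * partial_deriv i \<psi> q \<partial>seg2 h) = - (\<integral>q. partial_deriv i w q * \<psi> q \<partial>seg2 h)"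
    using integrable_seg2[OF b(1)] integrable_seg2[OF b(2)] by simp
  moreover have "(\<integral>q. w q * partial_deriv i \<psi> q \<partial>lebesgue_on ?T) = (\<integral>q. w q * partial_deriv i \<psi> q \<partial>seg2 h)"
    unfolding integrable_triangle(2)[OF b(1)]
    by (intro Bochner_Integration.integral_cong) (auto simp: indicator_def out')
  moreover have "(\<integral>q. partial_deriv i w q * \<psi> q \<partial>lebesgue_on ?T) = (\<integral>q. partial_deriv i w q * \<psi> q \<partial>seg2 h)"
    unfolding integrable_triangle(2)[OF b(2)]
    by (intro Bochner_Integration.integral_cong) (auto simp: indicator_def out)
  moreover have "gradient w q \<bullet> i = partial_deriv i w q" for q
    using i by (auto simp: gradient_prod Basis_prod_def zero_prod_def)
  ultimately show "(\<integral>q. w q * partial_deriv i \<psi> q \<partial>lebesgue_on ?T) = - (\<integral>q. (gradient w q \<bullet> i) * \<psi> q \<partial>lebesgue_on ?T)"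
    by simp
qed

lemma smooth_in_H1_tilde:
  assumes w: "smooth w" and h: "0 < h" and mean: "(\<integral>t. w (h, t) \<partial>seg h) = 0"
  shows "(w, gradient w) \<in> H1_tilde (right_triangle h) (hypotenuse h)"
proof -
  let ?M = "lebesgue_on (right_triangle h)" and ?S = "surface_measure_on (hypotenuse h)"
  note C1 = smooth_C1_partials[OF w]
  note b = C1_partials_bounded_borel[OF C1, of h]
  have L2w: "in_L2 ?M w" by (rule in_L2_triangle[OF b(1)])
  have L2G: "in_L2 ?M (gradient w)"
    unfolding in_L2_def
  proof
    have "(\<lambda>q. (partial_deriv (1, 0) w q, partial_deriv (0, 1) w q)) \<in> borel_measurable ?M"
      using integrable_triangle(1)[OF b(2)] integrable_triangle(1)[OF b(3)]
      by (intro borel_measurable_Pair) auto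
    then show "gradient w \<in> borel_measurable ?M" by (simp add: gradient_prod[abs_def])
    show "integrable ?M (\<lambda>q. (norm (gradient w q))\<^sup>2)"
      using integrable_triangle(1)[OF bounded_borel_add[OF bounded_borel_power2[OF b(2)] bounded_borel_power2[OF b(3)]]]
      by (simp add: gradient_prod norm_Pair)
  qed
  have mw: "w \<in> borel_measurable (restrict_space borel (hypotenuse h))"
    using C1_partials_continuous(1)[OF C1] by (intro measurable_restrict_space1 borel_measurable_continuous_onI)
  have L2S: "in_L2 ?S w"
  proof -
    have meas: "(\<lambda>t. (h, t)) \<in> seg h \<rightarrow>\<^sub>M restrict_space borel (hypotenuse h)"
      by (intro measurable_restrict_space3) (auto simp: hypotenuse_def borel_prod[symmetric])
    have slice: "bounded_borel {-h..h} (\<lambda>t. w (h, t))"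
      by (rule bounded_borel_slice(2)[OF b(1)]) (use h in auto)
    have "integrable ?S (\<lambda>q. (norm (w q))\<^sup>2)"
      unfolding surface_measure_hypotenuse
      by (subst integrable_distr_eq[OF meas]) (use mw integrable_seg[OF bounded_borel_power2[OF slice]] in auto)
    moreover have "w \<in> borel_measurable ?S"
      unfolding surface_measure_hypotenuse using mw by simp
    ultimately show ?thesis by (simp add: in_L2_def)
  qed
  have "has_trace (right_triangle h) (hypotenuse h) (w, gradient w) w"
    unfolding has_trace_def
    using w L2w L2G L2S by (auto intro!: exI[of _ "\<lambda>_. w"] simp: L2_tendsto_def L2_norm_def)
  moreover have "surface_mean (hypotenuse h) w = 0"
    using mean by (simp add: surface_mean_def integral_surface_hypotenuse[OF mw])
  moreover have "(w, gradient w) \<in> sobolev_H1 (right_triangle h)"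
    using L2w L2G smooth_has_weak_gradient[OF w h] by (simp add: sobolev_H1_def)
  ultimately show ?thesis by (auto simp: H1_tilde_def)
qed

lemma trig_integrals:
  fixes h k :: real
  assumes h: "0 < h" and k: "0 < k"
  shows "(\<integral>x. cos (k * x) \<partial>seg h) = 2 * sin (k * h) / k"
    and "(\<integral>x. (cos (k * x))\<^sup>2 \<partial>seg h) = h + sin (k * h) * cos (k * h) / k"
    and "(\<integral>x. (sin (k * x))\<^sup>2 \<partial>seg h) = h - sin (k * h) * cos (k * h) / k"
proof -
  have *: "(\<integral>x. f x \<partial>seg h) = F h - F (- h)"
    if F: "\<And>x. (F has_real_derivative f x) (at x)" and f: "continuous_on UNIV f" for F f :: "real \<Rightarrow> real"
  proof -
    have "(f has_integral (F h - F (- h))) {-h..h}"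
      using h by (intro fundamental_theorem_of_calculus)
        (auto simp flip: has_real_derivative_iff_has_vector_derivative intro!: DERIV_subset[OF F])
    then show ?thesis
      using has_integral_unique[OF has_integral_seg[OF bounded_borel_continuous[OF f compact_Icc]]] by blast
  qed
  have "((\<lambda>x. sin (k * x) / k) has_real_derivative cos (k * x)) (at x)" for x
    using k by (auto intro!: derivative_eq_intros)
  then show "(\<integral>x. cos (k * x) \<partial>seg h) = 2 * sin (k * h) / k"
    by (subst *[of "\<lambda>x. sin (k * x) / k"]) (auto intro!: continuous_intros)
  have "((\<lambda>x. x / 2 + sin (k * x) * cos (k * x) / (2 * k)) has_real_derivative (cos (k * x))\<^sup>2) (at x)" for x
  proof (rule DERIV_cong)
    show "((\<lambda>x. x / 2 + sin (k * x) * cos (k * x) / (2 * k)) has_real_derivative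
        1 / 2 + ((cos (k * x))\<^sup>2 - (sin (k * x))\<^sup>2) / 2) (at x)"
      using k by (auto intro!: derivative_eq_intros simp: field_simps power2_eq_square)
    show "1 / 2 + ((cos (k * x))\<^sup>2 - (sin (k * x))\<^sup>2) / 2 = (cos (k * x))\<^sup>2"
      using sin_cos_squared_add[of "k * x"] by (simp add: field_simps)
  qed
  then show "(\<integral>x. (cos (k * x))\<^sup>2 \<partial>seg h) = h + sin (k * h) * cos (k * h) / k"
    by (subst *[of "\<lambda>x. x / 2 + sin (k * x) * cos (k * x) / (2 * k)"]) (auto intro!: continuous_intros)
  have "((\<lambda>x. x / 2 - sin (k * x) * cos (k * x) / (2 * k)) has_real_derivative (sin (k * x))\<^sup>2) (at x)" for x
  proof (rule DERIV_cong)
    show "((\<lambda>x. x / 2 - sin (k * x) * cos (k * x) / (2 * k)) has_real_derivative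
        1 / 2 - ((cos (k * x))\<^sup>2 - (sin (k * x))\<^sup>2) / 2) (at x)"
      using k by (auto intro!: derivative_eq_intros simp: field_simps power2_eq_square)
    show "1 / 2 - ((cos (k * x))\<^sup>2 - (sin (k * x))\<^sup>2) / 2 = (sin (k * x))\<^sup>2"
      using sin_cos_squared_add[of "k * x"] by (simp add: field_simps)
  qed
  then show "(\<integral>x. (sin (k * x))\<^sup>2 \<partial>seg h) = h - sin (k * h) * cos (k * h) / k"
    by (subst *[of "\<lambda>x. x / 2 - sin (k * x) * cos (k * x) / (2 * k)"]) (auto intro!: continuous_intros)
qed

text \<open>
  The condition \<open>z cot z = -1\<close> says that \<open>sin z = - z cos z\<close>. It makes the integral over the hypotenuse,
  \<open>2 h cos z + 2 h sin z / z\<close>, vanish, and it puts both norms in closed form. The symmetries of the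
  functions involved allow integrating over the square instead of the triangle.
\<close>

lemma cosine_mode_norms:
  assumes h: "0 < h" and z: "0 < z" "z < pi" "z * cot z + 1 = 0"
  shows "(\<integral>t. cosine_mode (z / h) (h, t) \<partial>seg h) = 0"
    and "L2_norm (lebesgue_on (right_triangle h)) (cosine_mode (z / h)) = h * sqrt (1 + (cos z)\<^sup>2)"
    and "L2_norm (lebesgue_on (right_triangle h)) (gradient (cosine_mode (z / h))) = z * sqrt (1 + (cos z)\<^sup>2)"
proof -
  define k where "k = z / h"
  have k: "0 < k" and kh: "k * h = z" using h z by (simp_all add: k_def)
  have "sin z > 0" using z by (intro sin_gt_zero) auto
  then have s: "sin z = - z * cos z" using z(3) by (simp add: cot_def field_simps)
  have hz: "h = z / k" using k kh by (simp add: field_simps)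
  note C = trig_integrals[OF h k, unfolded kh]
  have b: "bounded_borel {-h..h} (\<lambda>x. cos (k * x))" "bounded_borel {-h..h} (\<lambda>x. sin (k * x))"
    by (intro bounded_borel_continuous compact_Icc continuous_intros)+
  note int = integrable_seg[OF b(1)] integrable_seg[OF bounded_borel_power2[OF b(1)]]
    integrable_seg[OF bounded_borel_const[of "{-h..h}"]]
  show "(\<integral>t. cosine_mode (z / h) (h, t) \<partial>seg h) = 0"
  proof -
    have "(\<integral>t. cosine_mode k (h, t) \<partial>seg h) = 2 * h * cos z + 2 * sin z / k"
      using int(1) int(3)[of "cos z"] measure_seg[of h] h by (simp add: cosine_mode_def kh C)
    also have "\<dots> = 0" unfolding s hz using k by (simp add: field_simps)
    finally show ?thesis by (simp add: k_def)
  qed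
  let ?T = "right_triangle h"
  note Cw = smooth_C1_partials[OF smooth_cosine_mode[of k]]
  have bw: "bounded_borel (square h) (\<lambda>q. (cosine_mode k q)\<^sup>2)"
    by (intro bounded_borel_power2 C1_partials_bounded_borel(1)[OF Cw])
  have "(\<integral>q. (cosine_mode k q)\<^sup>2 \<partial>seg2 h) = (\<integral>q. 4 * (indicator ?T q * (cosine_mode k q)\<^sup>2) \<partial>seg2 h)"
    unfolding integral_square_eq_triangle[OF bw]
    by (intro Bochner_Integration.integral_cong refl) (auto simp: cosine_mode_def add.commute)
  then have T: "(\<integral>q. (cosine_mode k q)\<^sup>2 \<partial>lebesgue_on ?T) = (\<integral>q. (cosine_mode k q)\<^sup>2 \<partial>seg2 h) / 4"
    by (simp add: integrable_triangle(2)[OF bw])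
  have "(\<integral>y. (cosine_mode k (x, y))\<^sup>2 \<partial>seg h)
      = 2 * h * (cos (k * x))\<^sup>2 + 2 * cos (k * x) * (2 * sin z / k) + (h + sin z * cos z / k)" for x
  proof -
    have "(\<integral>y. (cosine_mode k (x, y))\<^sup>2 \<partial>seg h)
      = (\<integral>y. (cos (k * x))\<^sup>2 + 2 * cos (k * x) * cos (k * y) + (cos (k * y))\<^sup>2 \<partial>seg h)"
      by (intro Bochner_Integration.integral_cong) (auto simp: cosine_mode_def power2_sum)
    also have "\<dots> = 2 * h * (cos (k * x))\<^sup>2 + 2 * cos (k * x) * (2 * sin z / k) + (h + sin z * cos z / k)"
      using int(1,2) int(3)[of "(cos (k * x))\<^sup>2"] measure_seg[of h] h by (simp add: C)
    finally show ?thesis .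
  qed
  then have "(\<integral>q. (cosine_mode k q)\<^sup>2 \<partial>seg2 h)
      = (\<integral>x. 2 * h * (cos (k * x))\<^sup>2 + 2 * cos (k * x) * (2 * sin z / k) + (h + sin z * cos z / k) \<partial>seg h)"
    using integral_seg2(2)[OF bw] by simp
  also have "\<dots> = 2 * h * (h + sin z * cos z / k) + 2 * (2 * sin z / k) * (2 * sin z / k) + 2 * h * (h + sin z * cos z / k)"
    using int(1,2) int(3)[of "h + sin z * cos z / k"] measure_seg[of h] h by (simp add: C)
  also have "\<dots> = 4 * (h\<^sup>2 * (1 + (cos z)\<^sup>2))"
    unfolding s hz using k by (simp add: field_simps power2_eq_square)
  finally have "(\<integral>q. (cosine_mode k q)\<^sup>2 \<partial>lebesgue_on ?T) = h\<^sup>2 * (1 + (cos z)\<^sup>2)" unfolding T by simp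
  then show "L2_norm (lebesgue_on ?T) (cosine_mode (z / h)) = h * sqrt (1 + (cos z)\<^sup>2)"
    using h by (simp add: L2_norm_def k_def[symmetric] real_sqrt_mult)
  define g where "g q = k\<^sup>2 * (sin (k * fst q))\<^sup>2" for q :: "real \<times> real"
  have bg: "bounded_borel (square h) g"
    unfolding g_def by (intro bounded_borel_intros bounded_borel_fst[where f = "\<lambda>x. sin (k * x)"] b)
  have bG: "bounded_borel (square h) (\<lambda>q. g q + g (snd q, fst q))"
    by (intro bounded_borel_add bg bounded_borel_swap[OF bg])
  have "(\<integral>q. g q \<partial>seg2 h) = (\<integral>q. 2 * (indicator ?T q * (g q + g (snd q, fst q))) \<partial>seg2 h)"
    unfolding integral_square_eq_triangle[OF bg]
    by (intro Bochner_Integration.integral_cong refl) (auto simp: g_def)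
  then have T': "(\<integral>q. g q + g (snd q, fst q) \<partial>lebesgue_on ?T) = (\<integral>q. g q \<partial>seg2 h) / 2"
    by (simp add: integrable_triangle(2)[OF bG])
  have "(\<integral>q. g q \<partial>seg2 h) = (\<integral>y. k\<^sup>2 * (h - sin z * cos z / k) \<partial>seg h)"
    using integral_seg2(1)[OF bg, symmetric] by (simp add: g_def C)
  also have "\<dots> = 2 * h * (k\<^sup>2 * (h - sin z * cos z / k))"
    using measure_seg[of h] h by simp
  also have "\<dots> = 2 * (z\<^sup>2 * (1 + (cos z)\<^sup>2))"
    unfolding s hz using k by (simp add: field_simps power2_eq_square)
  finally have "(\<integral>q. g q + g (snd q, fst q) \<partial>lebesgue_on ?T) = z\<^sup>2 * (1 + (cos z)\<^sup>2)" unfolding T' by simp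
  moreover have "(norm (gradient (cosine_mode k) q))\<^sup>2 = g q + g (snd q, fst q)" for q
    by (simp add: gradient_cosine_mode norm_Pair g_def power_mult_distrib)
  ultimately show "L2_norm (lebesgue_on ?T) (gradient (cosine_mode (z / h))) = z * sqrt (1 + (cos z)\<^sup>2)"
    using z by (simp add: L2_norm_def k_def[symmetric] real_sqrt_mult)
qed

lemma sharp_constant_triangle:
  assumes h: "0 < h" and z: "0 < z" "sqrt 2 * z < pi" "z * cot z + 1 = 0"
  shows "is_sharp_constant (right_triangle h) (hypotenuse h) (inverse z * h)"
  unfolding is_sharp_constant_def
proof (intro conjI allI impI)
  show "admissible_constant (right_triangle h) (hypotenuse h) (inverse z * h)"
    by (rule admissible_constant_triangle[OF h z])
  fix C assume C: "admissible_constant (right_triangle h) (hypotenuse h) C"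
  have "z * 1 \<le> z * sqrt 2" using z by (intro mult_left_mono) auto
  then have "z < pi" using z(2) by (simp add: mult.commute)
  note N = cosine_mode_norms[OF h z(1) this z(3)]
  define r where "r = sqrt (1 + (cos z)\<^sup>2)"
  have r: "0 < r" unfolding r_def by (simp add: add_pos_nonneg)
  have "(cosine_mode (z / h), gradient (cosine_mode (z / h))) \<in> H1_tilde (right_triangle h) (hypotenuse h)"
    by (rule smooth_in_H1_tilde[OF smooth_cosine_mode h N(1)])
  then have "h * r \<le> C * (z * r)"
    using C N(2,3) unfolding admissible_constant_def r_def by force
  then show "inverse z * h \<le> C" using z r by (simp add: field_simps)
qed

section \<open>The root of the transcendental equation\<close>

lemma Maclaurin_cos_bound:
  "\<bar>cos x - (\<Sum>m<n. cos_coeff m * x ^ m)\<bar> \<le> inverse (fact n) * \<bar>x::real\<bar> ^ n"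
proof -
  have "\<exists>c. \<bar>c\<bar> \<le> 1 \<and> cos x = (\<Sum>m<n. cos_coeff m * x ^ m) + (c / fact n) * x ^ n"
    using Maclaurin_cos_expansion[of x n] abs_cos_le_one by blast
  then obtain c where c: "\<bar>c\<bar> \<le> 1" "cos x = (\<Sum>m<n. cos_coeff m * x ^ m) + (c / fact n) * x ^ n"
    by blast
  have "\<bar>cos x - (\<Sum>m<n. cos_coeff m * x ^ m)\<bar> = \<bar>c / fact n * x ^ n\<bar>"
    unfolding c(2) by (simp only: add_diff_cancel_left')
  also have "\<dots> = \<bar>c\<bar> * (inverse (fact n) * \<bar>x\<bar> ^ n)"
    by (simp only: abs_mult divide_inverse power_abs abs_inverse mult.assoc abs_of_nonneg[OF fact_ge_zero])
  also have "\<dots> \<le> 1 * (inverse (fact n) * \<bar>x\<bar> ^ n)"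
    by (rule mult_right_mono[OF c(1)]) simp
  finally show ?thesis by simp
qed

text \<open>
  The Taylor remainder of order 16 is at most \<open>2.03 ^ 16 / fact 16\<close>.
\<close>

lemma cos_sin_polynomial_bound:
  fixes x :: real
  assumes "0 \<le> x" "x \<le> 2.03"
  shows "\<bar>cos x - (1 - x^2/2 + x^4/24 - x^6/720 + x^8/40320 - x^10/3628800 + x^12/479001600 - x^14/87178291200)\<bar> \<le> 1 / 10^8"
    and "\<bar>sin x - (x - x^3/6 + x^5/120 - x^7/5040 + x^9/362880 - x^11/39916800 + x^13/6227020800 - x^15/1307674368000)\<bar> \<le> 1 / 10^8"
proof -
  have "x ^ 16 \<le> 2.03 ^ 16" using assms by (intro power_mono) auto
  also have "\<dots> \<le> fact 16 / 10 ^ 8" by (simp add: fact_numeral power_divide)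
  finally have *: "inverse (fact 16) * \<bar>x\<bar> ^ 16 \<le> 1 / 10 ^ 8"
    using assms by (simp add: fact_numeral)
  have f: "(\<Sum>m<16. h m) = h 0 + h 1 + h 2 + h 3 + h 4 + h 5 + h 6 + h 7 + h 8 + h 9 + h 10 + h 11
      + h 12 + h 13 + h 14 + h 15" for h :: "nat \<Rightarrow> real"
    by (simp add: eval_nat_numeral)
  have c: "(\<Sum>m<16. cos_coeff m * x ^ m) = 1 - x^2/2 + x^4/24 - x^6/720 + x^8/40320 - x^10/3628800 + x^12/479001600 - x^14/87178291200"
    unfolding f by (simp add: cos_coeff_def fact_numeral)
  have s: "(\<Sum>m<16. sin_coeff m * x ^ m) = x - x^3/6 + x^5/120 - x^7/5040 + x^9/362880 - x^11/39916800 + x^13/6227020800 - x^15/1307674368000"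
    unfolding f by (simp add: sin_coeff_def fact_numeral)
  show "\<bar>cos x - (1 - x^2/2 + x^4/24 - x^6/720 + x^8/40320 - x^10/3628800 + x^12/479001600 - x^14/87178291200)\<bar> \<le> 1 / 10^8"
    using order_trans[OF Maclaurin_cos_bound[of x 16] *] unfolding c .
  show "\<bar>sin x - (x - x^3/6 + x^5/120 - x^7/5040 + x^9/362880 - x^11/39916800 + x^13/6227020800 - x^15/1307674368000)\<bar> \<le> 1 / 10^8"
    using order_trans[OF Maclaurin_sin_bound[of x 16] *] unfolding s .
qed

text \<open>
  The two fractions bracket the root tightly enough; their small denominators keep the rational
  arithmetic short.
\<close>

lemma root_bracket:
  "0 < (2187/1078::real) * cos (2187/1078) + sin (2187/1078)"
  "(917/452::real) * cos (917/452) + sin (917/452) < 0"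
proof -
  define x :: real where "x = 2187/1078"
  have "-44211983/10^8 \<le> 1 - x^2/2 + x^4/24 - x^6/720 + x^8/40320 - x^10/3628800 + x^12/479001600 - x^14/87178291200"
    by (simp add: x_def power_divide)
  moreover have "89695598/10^8 \<le> x - x^3/6 + x^5/120 - x^7/5040 + x^9/362880 - x^11/39916800 + x^13/6227020800 - x^15/1307674368000"
    by (simp add: x_def power_divide)
  moreover have "0 \<le> x" "x \<le> 2.03" by (simp_all add: x_def)
  note cos_sin_polynomial_bound[OF this, unfolded abs_le_iff]
  ultimately have c: "-44211985/10^8 \<le> cos x" and s: "89695596/10^8 \<le> sin x"
    by - linarith+
  have "2187/1078 * (-44211985/10^8) \<le> x * cos x"
    using c unfolding x_def by (intro mult_left_mono) simp_all
  then have "0 < x * cos x + sin x"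
    using s by simp
  then show "0 < (2187/1078::real) * cos (2187/1078) + sin (2187/1078)" unfolding x_def .
next
  define x :: real where "x = 917/452"
  have "1 - x^2/2 + x^4/24 - x^6/720 + x^8/40320 - x^10/3628800 + x^12/479001600 - x^14/87178291200 \<le> -44212346/10^8"
    by (simp add: x_def power_divide)
  moreover have "x - x^3/6 + x^5/120 - x^7/5040 + x^9/362880 - x^11/39916800 + x^13/6227020800 - x^15/1307674368000 \<le> 89695422/10^8"
    by (simp add: x_def power_divide)
  moreover have "0 \<le> x" "x \<le> 2.03" by (simp_all add: x_def)
  note cos_sin_polynomial_bound[OF this, unfolded abs_le_iff]
  ultimately have c: "cos x \<le> -44212344/10^8" and s: "sin x \<le> 89695424/10^8"
    by - linarith+
  have "x * cos x \<le> 917/452 * (-44212344/10^8)"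
    using c unfolding x_def by (intro mult_left_mono) simp_all
  then have "x * cos x + sin x < 0"
    using s by simp
  then show "(917/452::real) * cos (917/452) + sin (917/452) < 0" unfolding x_def .
qed

text \<open>
  On \<open>(0, pi)\<close> the equation is equivalent to \<open>z cos z + sin z = 0\<close>. The left-hand side is positive up
  to \<open>pi / 2\<close> and strictly decreasing afterwards.
\<close>

lemma z_cot_z_root:
  "\<exists>z0::real. {z. 0 < z \<and> z < pi \<and> z * cot z + 1 = 0} = {z0} \<and> \<bar>z0 - 2.02876\<bar> < 5 / 10 ^ 6"
proof -
  define g where "g z = z * cos z + sin z" for z :: real
  have iff: "z * cot z + 1 = 0 \<longleftrightarrow> g z = 0" if "0 < z" "z < pi" for z
    using sin_gt_zero[OF that] by (auto simp: g_def cot_def field_simps)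
  have dg: "(g has_real_derivative (2 * cos z - z * sin z)) (at z)" for z
    unfolding g_def by (auto intro!: derivative_eq_intros)
  have pos: "g z > 0" if "0 < z" "z \<le> pi / 2" for z
    using that sin_gt_zero[of z] cos_ge_zero[of z] unfolding g_def
    by (intro add_nonneg_pos mult_nonneg_nonneg) auto
  have dec: "g y < g x" if "pi / 2 < x" "x < y" "y < pi" for x y
  proof (rule DERIV_neg_imp_decreasing[OF that(2)])
    fix z assume z: "x \<le> z" "z \<le> y"
    have "cos z < 0"
      using cos_monotone_0_pi[of "pi/2" z] that z by auto
    moreover have "z * sin z > 0" using z that sin_gt_zero[of z] pi_gt_zero by (intro mult_pos_pos) linarith+
    ultimately have "2 * cos z - z * sin z < 0" by linarith
    then show "\<exists>d. (g has_real_derivative d) (at z) \<and> d < 0" using dg by blast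
  qed
  have "continuous_on {2187/1078..917/452} g" unfolding g_def by (intro continuous_intros)
  then obtain z0 where z0: "2187/1078 \<le> z0" "z0 \<le> 917/452" "g z0 = 0"
    using IVT2'[of g "917/452" 0 "2187/1078"] root_bracket unfolding g_def by auto
  have "z0 \<noteq> 2187/1078"
    using root_bracket(1) z0(3) unfolding g_def by (metis less_irrefl)
  moreover have "z0 \<noteq> 917/452"
    using root_bracket(2) z0(3) unfolding g_def by (metis less_irrefl)
  ultimately have ne: "2187/1078 < z0" "z0 < 917/452" using z0 by linarith+
  have r: "0 < z0" "z0 < pi" using z0(1,2) pi_gt3 by simp_all
  have "z = z0" if "0 < z" "z < pi" "g z = 0" for z
  proof -
    have "pi / 2 < z" using pos[of z] that by (cases "pi / 2 < z") auto
    moreover have "pi / 2 < z0" using pos[of z0] r z0(3) by (cases "pi / 2 < z0") auto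
    ultimately show ?thesis
      using dec[of z z0] dec[of z0 z] that(2,3) z0(3) r(2) by (cases z z0 rule: linorder_cases) auto
  qed
  then have "{z. 0 < z \<and> z < pi \<and> z * cot z + 1 = 0} = {z0}"
    using iff r z0(3) by blast
  moreover have "\<bar>z0 - 2.02876\<bar> < 5 / 10 ^ 6"
    using ne unfolding abs_less_iff by simp
  ultimately show ?thesis by blast
qed

theorem theorem3p5:
  fixes h :: real
  assumes "h > 0"
  shows "\<exists>z0::real.
      {z. 0 < z \<and> z < pi \<and> z * cot z + 1 = 0} = {z0} \<and>
      \<bar>z0 - 2.02876\<bar> < 5 / 10 ^ 6 \<and>
      is_sharp_constant (right_triangle h) (hypotenuse h) (inverse z0 * h)"
proof -
  obtain z0 :: real where root: "{z. 0 < z \<and> z < pi \<and> z * cot z + 1 = 0} = {z0}"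
    and approx: "\<bar>z0 - 2.02876\<bar> < 5 / 10 ^ 6"
    using z_cot_z_root by blast
  have z0: "0 < z0" "z0 * cot z0 + 1 = 0" using root by blast+
  have "z0 \<le> 2.03" using approx unfolding abs_less_iff by simp
  moreover have "sqrt 2 \<le> 1.42" by (rule real_le_lsqrt) (simp_all add: power2_eq_square)
  ultimately have "sqrt 2 * z0 \<le> 1.42 * 2.03" using z0 by (intro mult_mono) auto
  then have "sqrt 2 * z0 < pi" using pi_gt3 by simp
  then have "is_sharp_constant (right_triangle h) (hypotenuse h) (inverse z0 * h)"
    using z0 by (intro sharp_constant_triangle assms)
  then show ?thesis using root approx by blast
qed

end
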